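(* Suppose $Y$ has dynamics given by $$dY_t=-f(\omega,t,Y_{t-},Z_t)\,dt+Z_t^*\,dM_t .$$ Then the following statements are equivalent: 1. $Y$ is of the form $Y_t=u(t,X_t)$ for some function $u:\mathbb{R}^+\times\mathbb{R}^N\to\mathbb{R}$. 2. Both (i) $f$ is Markovian, that is, it is of the form $$f(\omega,t,Y_t,Z_t)=\tilde f(X_t,t,Y_t,Z_t)\qquad \mathbb{P}\times dt\text{-a.e.}$$ for some function $\tilde f:\mathbb{R}^N\times\mathbb{R}^+\times\mathbb{R}\times\mathbb{R}^N\to\mathbb{R}$; and (ii) up to $\sim_M$ equivalence, $Z_t$ is a deterministic function of $t$ which satisfies $X_0^*Z_0=Y_0$ and, for all $i$, $$\frac{d(e_i^*Z_t)}{dt}=-\tilde f(e_i,t,e_i^*Z_t,Z_t)-Z_t^*A_te_i .$$ Furthermore, under either set of conditions, $e_i^*Z_t=u(t,e_i)$ up to equivalence $\sim_M$.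
   Context: $X$ is a continuous-time finite-state Markov chain on a probability space $(\Omega,\mathbb{P})$, a right-continuous pure jump process taking values in the standard basis vectors $e_1,\dots,e_N$ of $\mathbb{R}^N$, with $X_0$ deterministic. $[\cdot]^*$ denotes transposition. $\{\mathcal{F}_t\}$ is the completion of the filtration generated by $X$. $A_t$ is the rate matrix, deterministic and possibly varying in time: $(A_t)_{ij}$ is the rate of jumping from state $j$ to state $i$, so $(A_t)_{ij}\ge 0$ for $i\ne j$ and every column of $A_t$ sums to $0$; all components of $A$ are uniformly bounded in time. It is assumed that $\mathbb{P}(X_t=e_i)>0$ for every $t>0$ and every $i$. $M$ is the $\mathbb{R}^N$-valued locally-finite-variation pure-jump martingale defined by $X_t=X_0+\int_{]0,t]}A_uX_{u-}\,du+M_t$. For $z\in\mathbb{R}^N$ put $\|z\|_{M_t}^2=z^*\frac{d\langle M,M\rangle_t}{dt}z$, where $\frac{d\langle M,M\rangle_t}{dt}=\mathrm{diag}(A_tX_{t-})-A_t\,\mathrm{diag}(X_{t-})-\mathrm{diag}(X_{t-})A_t^*$. For predictable $\mathbb{R}^N$-valued processes, $Z\sim_M Z'$ means $\|Z_t-Z'_t\|_{M_t}=0$ $dt\times d\mathbb{P}$-a.s. In the equation, $f:\Omega\times\mathbb{R}^+\times\mathbb{R}\times\mathbb{R}^N\to\mathbb{R}$ is progressively measurable, $Y$ is a real adapted process with $E[\sup_{t<T}Y_t^2]<\infty$ for all $T$, and $Z$ is predictable with values in $\mathbb{R}^N$. Standing assumptions on $f$: it is invariant under $\sim_M$, that is,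 if $Z\sim_M Z'$ then $f(\omega,t,y,Z)=f(\omega,t,y,Z')$ up to indistinguishability; and it satisfies sufficient conditions for the equation of interest to have a unique solution. The equation is considered either as a forward equation ($Y_0\in\mathbb{R}$ and the predictable process $Z$ given, $Y$ the solution) or as a backward equation ($Y_T\in L^2(\mathcal{F}_T)$ given for some $T>0$, the pair $(Y,Z)$ the solution, with $Z$ unique up to $\sim_M$). Equality $Y_t=u(t,X_t)$ is understood up to indistinguishability.
   Formalization: In 2, f̃ must itself satisfy the standing assumptions (progressive, ∼_M-invariant dt×dP-a.e., unique forward solution for data (Y_0,Z)); the ODE is in integrated form, on t>0 only for states other than X_0. Without this 2⇒1 fails, e.g. f̃=−2√(y^+), f=−2(t−τ)^+, τ the first jump, Z=0. *)

theory Defs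
  imports "HOL-Probability.Probability"
begin

text \<open>
  Processes are curried as time, then sample point, and only their values at times in
  \<open>{0..}\<close> are used.  The convention at time zero is \<open>W\<^bsub>0-\<^esub> = W\<^sub>0\<close>.
\<close>

definition left_lim :: "(real \<Rightarrow> 'a \<Rightarrow> 'b::t2_space) \<Rightarrow> real \<Rightarrow> 'a \<Rightarrow> 'b" where
  "left_lim W t \<omega> = (if t \<le> 0 then W 0 \<omega> else Lim (at_left t) (\<lambda>s. W s \<omega>))"

definition completed_filtration ::
    "'a measure \<Rightarrow> (real \<Rightarrow> 'a \<Rightarrow> real^'n) \<Rightarrow> real \<Rightarrow> 'a measure" where
  "completed_filtration P X t =
     sigma (space P)
       ((\<Union>s\<in>{0..t}. {X s -` B \<inter> space P | B. B \<in> sets borel}) \<union> null_sets (completion P))"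

definition rate_matrix :: "(real \<Rightarrow> real^'n^'n) \<Rightarrow> bool" where
  "rate_matrix A \<longleftrightarrow>
     A \<in> borel_measurable (restrict_space borel {0..}) \<and>
     (\<forall>t\<ge>0. \<forall>i j. i \<noteq> j \<longrightarrow> 0 \<le> A t $ i $ j) \<and>
     (\<forall>t\<ge>0. \<forall>j. (\<Sum>i\<in>UNIV. A t $ i $ j) = 0) \<and>
     (\<exists>C. \<forall>t\<ge>0. \<forall>i j. \<bar>A t $ i $ j\<bar> \<le> C)"

text \<open>
  Kolmogorov's forward equation in integrated form (\<open>A\<close> is only measurable in time);
  \<open>p s t $ i $ j\<close> is the probability of being in state \<open>i\<close> at time \<open>t\<close> when starting
  from state \<open>j\<close> at time \<open>s\<close>.
\<close>

definition transition_matrices ::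
    "(real \<Rightarrow> real^'n^'n) \<Rightarrow> (real \<Rightarrow> real \<Rightarrow> real^'n^'n) \<Rightarrow> bool" where
  "transition_matrices A p \<longleftrightarrow>
     (\<forall>s t. 0 \<le> s \<and> s \<le> t \<longrightarrow>
        set_integrable lborel {s..t} (\<lambda>u. A u ** p s u) \<and>
        p s t = mat 1 + (LINT u:{s..t}|lborel. A u ** p s u))"

text \<open>
  States are the standard basis vectors, so the vector of conditional probabilities of the
  states at time \<open>t\<close> is the conditional expectation of \<open>X t\<close>, and \<open>p s t *v X s \<omega>\<close> is the
  column of \<open>p s t\<close> belonging to the state at time \<open>s\<close>.  A path in a finite set that is
  right-continuous with left limits has finitely many jumps on bounded intervals and is constant
  between them.
\<close>

locale markov_chain = prob_space P
  for P :: "'a measure" and X :: "real \<Rightarrow> 'a \<Rightarrow> real^'n" and A :: "real \<Rightarrow> real^'n^'n" +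
  assumes rates: "rate_matrix A"
    and measurable: "\<And>t. 0 \<le> t \<Longrightarrow> X t \<in> borel_measurable P"
    and states: "\<And>t \<omega>. 0 \<le> t \<Longrightarrow> \<omega> \<in> space P \<Longrightarrow> X t \<omega> \<in> Basis"
    and right_continuous:
      "\<And>t \<omega>. 0 \<le> t \<Longrightarrow> \<omega> \<in> space P \<Longrightarrow> continuous (at_right t) (\<lambda>s. X s \<omega>)"
    and left_limits:
      "\<And>t \<omega>. 0 < t \<Longrightarrow> \<omega> \<in> space P \<Longrightarrow> \<exists>l. ((\<lambda>s. X s \<omega>) \<longlongrightarrow> l) (at_left t)"
    and deterministic_start: "\<exists>x0. \<forall>\<omega>\<in>space P. X 0 \<omega> = x0"
    and markov:
      "\<exists>p. transition_matrices A p \<and>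
         (\<forall>s t i. 0 \<le> s \<and> s \<le> t \<longrightarrow>
            (AE \<omega> in completion P.
               real_cond_exp (completion P) (completed_filtration P X s) (\<lambda>\<omega>. X t \<omega> $ i) \<omega>
                 = (p s t *v X s \<omega>) $ i))"
    and charges_all_states:
      "\<And>t i. 0 < t \<Longrightarrow> measure P {\<omega> \<in> space P. X t \<omega> = axis i 1} > 0"

definition diag :: "real^'n \<Rightarrow> real^'n^'n" where
  "diag v = (\<chi> i j. if i = j then v $ i else 0)"

definition bracket_density ::
    "(real \<Rightarrow> real^'n^'n) \<Rightarrow> (real \<Rightarrow> 'a \<Rightarrow> real^'n) \<Rightarrow> real \<Rightarrow> 'a \<Rightarrow> real^'n^'n" where
  "bracket_density A X t \<omega> =
     diag (A t *v left_lim X t \<omega>) - A t ** diag (left_lim X t \<omega>)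
       - diag (left_lim X t \<omega>) ** transpose (A t)"

definition M_norm ::
    "(real \<Rightarrow> real^'n^'n) \<Rightarrow> (real \<Rightarrow> 'a \<Rightarrow> real^'n) \<Rightarrow> real \<Rightarrow> 'a \<Rightarrow> real^'n \<Rightarrow> real" where
  "M_norm A X t \<omega> z = sqrt (z \<bullet> (bracket_density A X t \<omega> *v z))"

definition predictable_algebra ::
    "'a measure \<Rightarrow> (real \<Rightarrow> 'a \<Rightarrow> real^'n) \<Rightarrow> (real \<times> 'a) measure" where
  "predictable_algebra P X =
     sigma ({0..} \<times> space P)
       ({{s<..t} \<times> B | s t B. 0 \<le> s \<and> s \<le> t \<and> B \<in> sets (completed_filtration P X s)} \<union>
        {{0} \<times> B | B. B \<in> sets (completed_filtration P X 0)})"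

definition predictable ::
    "'a measure \<Rightarrow> (real \<Rightarrow> 'a \<Rightarrow> real^'n) \<Rightarrow> (real \<Rightarrow> 'a \<Rightarrow> real^'n) \<Rightarrow> bool" where
  "predictable P X Z \<longleftrightarrow> (\<lambda>(t, \<omega>). Z t \<omega>) \<in> borel_measurable (predictable_algebra P X)"

text \<open>
  Everything below is relative to the set \<open>I\<close> of times on which the equation is considered:
  the half-line for an equation run forward without horizon, or \<open>{0..T}\<close>, as for an equation with
  terminal value at \<open>T\<close>.
\<close>

definition time_set :: "real set \<Rightarrow> bool" where
  "time_set I \<longleftrightarrow> I = {0..} \<or> (\<exists>T>0. I = {0..T})"

definition sim_M ::
    "'a measure \<Rightarrow> (real \<Rightarrow> 'a \<Rightarrow> real^'n) \<Rightarrow> (real \<Rightarrow> real^'n^'n) \<Rightarrow> real set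
      \<Rightarrow> (real \<Rightarrow> 'a \<Rightarrow> real^'n) \<Rightarrow> (real \<Rightarrow> 'a \<Rightarrow> real^'n) \<Rightarrow> bool" where
  "sim_M P X A I Z Z' \<longleftrightarrow>
     (AE (t, \<omega>) in lborel \<Otimes>\<^sub>M completion P. t \<in> I \<longrightarrow> M_norm A X t \<omega> (Z t \<omega> - Z' t \<omega>) = 0)"

definition M_mart ::
    "(real \<Rightarrow> 'a \<Rightarrow> real^'n) \<Rightarrow> (real \<Rightarrow> real^'n^'n) \<Rightarrow> real \<Rightarrow> 'a \<Rightarrow> real^'n" where
  "M_mart X A t \<omega> = X t \<omega> - X 0 \<omega> - (LINT u:{0..t}|lborel. A u *v left_lim X u \<omega>)"

text \<open>
  Pathwise Lebesgue-Stieltjes integral of \<open>Z\<close> against \<open>M\<close> over \<open>]0,t]\<close>.  Along a path, the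
  vector measure \<open>dM\<close> is the sum of the finitely many atoms at the jumps of \<open>M\<close> and of the
  absolutely continuous measure with density \<open>- A u *v X\<^bsub>u-\<^esub>\<close>.  Integrability against the latter
  is part of the notion of solution below.
\<close>

definition M_integral ::
    "(real \<Rightarrow> 'a \<Rightarrow> real^'n) \<Rightarrow> (real \<Rightarrow> real^'n^'n) \<Rightarrow> (real \<Rightarrow> 'a \<Rightarrow> real^'n)
      \<Rightarrow> real \<Rightarrow> 'a \<Rightarrow> real" where
  "M_integral X A Z t \<omega> =
     (\<Sum>s\<in>{s\<in>{0<..t}. M_mart X A s \<omega> \<noteq> left_lim (M_mart X A) s \<omega>}.
        Z s \<omega> \<bullet> (M_mart X A s \<omega> - left_lim (M_mart X A) s \<omega>))
     - (LINT u:{0..t}|lborel. Z u \<omega> \<bullet> (A u *v left_lim X u \<omega>))"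

definition progressive_driver ::
    "'a measure \<Rightarrow> (real \<Rightarrow> 'a \<Rightarrow> real^'n) \<Rightarrow> real set
      \<Rightarrow> ('a \<Rightarrow> real \<Rightarrow> real \<Rightarrow> real^'n \<Rightarrow> real) \<Rightarrow> bool" where
  "progressive_driver P X I f \<longleftrightarrow>
     (\<forall>T\<in>I. (\<lambda>(\<omega>, t, y, z). f \<omega> t y z) \<in> borel_measurable
        (completed_filtration P X T \<Otimes>\<^sub>M restrict_space borel {0..T} \<Otimes>\<^sub>M borel \<Otimes>\<^sub>M borel))"

text \<open>
  The exceptional set is a null set of the product of time and sample space that does not depend
  on \<open>y\<close>.  Asking for equality at all times simultaneously would be too much: \<open>Z\<close> may be changed
  freely at any fixed time without leaving its class, so \<open>f\<close> could not depend on \<open>z\<close> at all.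
\<close>

definition invariant_driver ::
    "'a measure \<Rightarrow> (real \<Rightarrow> 'a \<Rightarrow> real^'n) \<Rightarrow> (real \<Rightarrow> real^'n^'n) \<Rightarrow> real set
      \<Rightarrow> ('a \<Rightarrow> real \<Rightarrow> real \<Rightarrow> real^'n \<Rightarrow> real) \<Rightarrow> bool" where
  "invariant_driver P X A I f \<longleftrightarrow>
     (\<forall>Z Z'. predictable P X Z \<and> predictable P X Z' \<and> sim_M P X A I Z Z' \<longrightarrow>
        (AE (t, \<omega>) in lborel \<Otimes>\<^sub>M completion P.
           t \<in> I \<longrightarrow> (\<forall>y. f \<omega> t y (Z t \<omega>) = f \<omega> t y (Z' t \<omega>))))"

text \<open>
  \<open>dY\<^sub>t = - f(\<omega>, t, Y\<^bsub>t-\<^esub>, Z\<^sub>t) dt + Z\<^sub>t\<^sup>* dM\<^sub>t\<close> with \<open>Y\<^sub>0 = y0\<close>.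
  Almost sure existence of left limits of \<open>Y\<close> is a consequence of the integrated equation.
\<close>

definition solves_equation ::
    "'a measure \<Rightarrow> (real \<Rightarrow> 'a \<Rightarrow> real^'n) \<Rightarrow> (real \<Rightarrow> real^'n^'n) \<Rightarrow> real set
      \<Rightarrow> ('a \<Rightarrow> real \<Rightarrow> real \<Rightarrow> real^'n \<Rightarrow> real) \<Rightarrow> real \<Rightarrow> (real \<Rightarrow> 'a \<Rightarrow> real^'n)
      \<Rightarrow> (real \<Rightarrow> 'a \<Rightarrow> real) \<Rightarrow> bool" where
  "solves_equation P X A I f y0 Z Y \<longleftrightarrow>
     (\<forall>t\<in>I. Y t \<in> borel_measurable (completed_filtration P X t)) \<and>
     (AE \<omega> in completion P. Y 0 \<omega> = y0) \<and>
     (AE \<omega> in completion P. \<forall>t\<in>I.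
        set_integrable lborel {0..t} (\<lambda>s. f \<omega> s (left_lim Y s \<omega>) (Z s \<omega>)) \<and>
        set_integrable lborel {0..t} (\<lambda>s. Z s \<omega> \<bullet> (A s *v left_lim X s \<omega>)) \<and>
        Y t \<omega> = Y 0 \<omega> - (LINT s:{0..t}|lborel. f \<omega> s (left_lim Y s \<omega>) (Z s \<omega>))
                 + M_integral X A Z t \<omega>)"

definition indistinguishable ::
    "'a measure \<Rightarrow> real set \<Rightarrow> (real \<Rightarrow> 'a \<Rightarrow> real) \<Rightarrow> (real \<Rightarrow> 'a \<Rightarrow> real) \<Rightarrow> bool" where
  "indistinguishable P I Y Y' \<longleftrightarrow> (AE \<omega> in completion P. \<forall>t\<in>I. Y t \<omega> = Y' t \<omega>)"

definition uniquely_solvable ::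
    "'a measure \<Rightarrow> (real \<Rightarrow> 'a \<Rightarrow> real^'n) \<Rightarrow> (real \<Rightarrow> real^'n^'n) \<Rightarrow> real set
      \<Rightarrow> ('a \<Rightarrow> real \<Rightarrow> real \<Rightarrow> real^'n \<Rightarrow> real) \<Rightarrow> real \<Rightarrow> (real \<Rightarrow> 'a \<Rightarrow> real^'n) \<Rightarrow> bool" where
  "uniquely_solvable P X A I f y0 Z \<longleftrightarrow>
     (\<exists>Y. solves_equation P X A I f y0 Z Y) \<and>
     (\<forall>Y Y'. solves_equation P X A I f y0 Z Y \<and> solves_equation P X A I f y0 Z Y' \<longrightarrow>
        indistinguishable P I Y Y')"

text \<open>The standing assumptions on a driver, for the equation with data \<open>y0\<close> and \<open>Z\<close>.\<close>

definition admissible_driver ::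
    "'a measure \<Rightarrow> (real \<Rightarrow> 'a \<Rightarrow> real^'n) \<Rightarrow> (real \<Rightarrow> real^'n^'n) \<Rightarrow> real set
      \<Rightarrow> real \<Rightarrow> (real \<Rightarrow> 'a \<Rightarrow> real^'n) \<Rightarrow> ('a \<Rightarrow> real \<Rightarrow> real \<Rightarrow> real^'n \<Rightarrow> real) \<Rightarrow> bool" where
  "admissible_driver P X A I y0 Z f \<longleftrightarrow>
     progressive_driver P X I f \<and> invariant_driver P X A I f \<and> uniquely_solvable P X A I f y0 Z"

definition locally_square_bounded ::
    "'a measure \<Rightarrow> real set \<Rightarrow> (real \<Rightarrow> 'a \<Rightarrow> real) \<Rightarrow> bool" where
  "locally_square_bounded P I Y \<longleftrightarrow>
     (\<forall>T\<in>I. (\<integral>\<^sup>+\<omega>. (SUP t\<in>{0..<T}. ennreal ((Y t \<omega>)\<^sup>2)) \<partial>completion P) < \<infinity>)"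

definition state_function ::
    "'a measure \<Rightarrow> (real \<Rightarrow> 'a \<Rightarrow> real^'n) \<Rightarrow> real set
      \<Rightarrow> (real \<Rightarrow> 'a \<Rightarrow> real) \<Rightarrow> (real \<Rightarrow> real^'n \<Rightarrow> real) \<Rightarrow> bool" where
  "state_function P X I Y u \<longleftrightarrow> indistinguishable P I Y (\<lambda>t \<omega>. u t (X t \<omega>))"

text \<open>
  A Markovian representation of the driver along \<open>(Y, Z)\<close>.  The representing function has to be
  a driver satisfying the standing assumptions itself; without this the values of \<open>g\<close> off the
  trajectory of \<open>(Y, Z)\<close> are arbitrary and the equation driven by \<open>g\<close> need not determine \<open>Y\<close>.
\<close>

definition markovian_driver ::
    "'a measure \<Rightarrow> (real \<Rightarrow> 'a \<Rightarrow> real^'n) \<Rightarrow> (real \<Rightarrow> real^'n^'n) \<Rightarrow> real set \<Rightarrow> real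
      \<Rightarrow> (real \<Rightarrow> 'a \<Rightarrow> real) \<Rightarrow> (real \<Rightarrow> 'a \<Rightarrow> real^'n)
      \<Rightarrow> ('a \<Rightarrow> real \<Rightarrow> real \<Rightarrow> real^'n \<Rightarrow> real) \<Rightarrow> (real^'n \<Rightarrow> real \<Rightarrow> real \<Rightarrow> real^'n \<Rightarrow> real)
      \<Rightarrow> bool" where
  "markovian_driver P X A I y0 Y Z f g \<longleftrightarrow>
     admissible_driver P X A I y0 Z (\<lambda>\<omega> t y z. g (X t \<omega>) t y z) \<and>
     (AE (t, \<omega>) in lborel \<Otimes>\<^sub>M completion P.
        t \<in> I \<longrightarrow> f \<omega> t (Y t \<omega>) (Z t \<omega>) = g (X t \<omega>) t (Y t \<omega>) (Z t \<omega>))"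

text \<open>
  Caratheodory solutions on \<open>J\<close> of the \<open>i\<close>-th equation
  \<open>d(e\<^sub>i\<^sup>* \<zeta>\<^sub>t)/dt = - g(e\<^sub>i, t, e\<^sub>i\<^sup>* \<zeta>\<^sub>t, \<zeta>\<^sub>t) - \<zeta>\<^sub>t\<^sup>* A\<^sub>t e\<^sub>i\<close>: since \<open>g\<close> and \<open>A\<close> are only measurable
  in time, the equation means that \<open>e\<^sub>i\<^sup>* \<zeta>\<close> is an indefinite Lebesgue integral of the right-hand
  side on \<open>J\<close>.
\<close>

definition solves_ode_component ::
    "(real \<Rightarrow> real^'n^'n) \<Rightarrow> (real^'n \<Rightarrow> real \<Rightarrow> real \<Rightarrow> real^'n \<Rightarrow> real)
      \<Rightarrow> (real \<Rightarrow> real^'n) \<Rightarrow> 'n \<Rightarrow> real set \<Rightarrow> bool" where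
  "solves_ode_component A g \<zeta> i J \<longleftrightarrow>
     (let rhs = (\<lambda>r. - g (axis i 1) r (axis i 1 \<bullet> \<zeta> r) (\<zeta> r) - \<zeta> r \<bullet> (A r *v axis i 1)) in
      \<forall>s\<in>J. \<forall>t\<in>J. s \<le> t \<longrightarrow>
        set_integrable lborel {s..t} rhs \<and>
        axis i 1 \<bullet> \<zeta> t - axis i 1 \<bullet> \<zeta> s = (LINT r:{s..t}|lborel. rhs r))"

text \<open>
  The component of the initial state solves its equation from time zero on, where it has the
  prescribed initial value.  No other state is charged at time zero, and the corresponding
  components, for which no initial value is prescribed, solve their equations at positive times;
  they need not be bounded near time zero.
\<close>

definition solves_ode_system ::
    "'a measure \<Rightarrow> (real \<Rightarrow> 'a \<Rightarrow> real^'n) \<Rightarrow> (real \<Rightarrow> real^'n^'n) \<Rightarrow> real set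
      \<Rightarrow> (real^'n \<Rightarrow> real \<Rightarrow> real \<Rightarrow> real^'n \<Rightarrow> real) \<Rightarrow> (real \<Rightarrow> real^'n) \<Rightarrow> bool" where
  "solves_ode_system P X A I g \<zeta> \<longleftrightarrow>
     (\<forall>i. solves_ode_component A g \<zeta> i (I \<inter> {0<..})) \<and>
     (\<forall>i. (\<forall>\<omega>\<in>space P. X 0 \<omega> = axis i 1) \<longrightarrow> solves_ode_component A g \<zeta> i I)"

end

theory Submission
  imports Defs
begin

text \<open>
  With \<open>X\<^bsub>t-\<^esub> = e\<^sub>j\<close> one has \<open>\<parallel>z\<parallel>\<^sup>2 = \<Sum>\<^sub>i A\<^sub>i\<^sub>j (z\<^sub>i - z\<^sub>j)\<^sup>2\<close>, and \<open>A\<^sub>i\<^sub>j dt\<close> compensates the jumps from \<open>e\<^sub>j\<close>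
  to \<open>e\<^sub>i\<close>. Hence \<open>Z\<close> is equivalent to a deterministic \<open>\<zeta>\<close> iff almost surely \<open>Z\<^sup>* \<Delta>X = \<zeta>\<^sup>* \<Delta>X\<close> at all jumps.

  If \<open>Y\<^sub>t = u(t, X\<^sub>t)\<close>, then \<open>u(\<cdot>, e\<^sub>i)\<close> is locally absolutely continuous, as \<open>X\<close> stays in \<open>e\<^sub>i\<close> around any
  given time with positive probability. Comparing jumps gives \<open>Z\<^sup>* \<Delta>X = \<zeta>\<^sup>* \<Delta>X\<close> for \<open>\<zeta>\<^sub>t = (u(t, e\<^sub>i))\<^sub>i\<close>; comparing
  drifts shows that the driver along \<open>(Y, Z)\<close> is \<open>- du(t, e\<^sub>i)/dt - \<zeta>\<^sub>t\<^sup>* A\<^sub>t e\<^sub>i\<close> on \<open>X\<^sub>t = e\<^sub>i\<close>. This does not involve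
  \<open>(y, z)\<close>, so it is an admissible Markovian driver. Conversely, the system of differential equations and the
  jump identity say that \<open>X\<^sub>t\<^sup>* \<zeta>\<^sub>t\<close> solves the equation, and uniqueness identifies it with \<open>Y\<close>.
\<close>

section \<open>Indefinite integrals on the line\<close>

text \<open>The Markov property is available only through conditional expectations and transition
  matrices, while everything about \<open>Z\<close> happens at random jump times. The bridge is a
  compensator formula derived from Kolmogorov's equation: the expected number of
  \<open>j\<close>-to-\<open>i\<close> jumps on a past event is the limit of expected crossings of
  ever finer grids, and a Dynkin argument passes from predictable rectangles to all predictable
  sets. Applied to the set where \<open>Z\<close> and \<open>\<zeta>\<close> differ it gives the
  jump criterion, applied to a single time it excludes fixed jumps.

  The function \<open>u\<close> comes without any regularity. Its densities are read off single
  paths near single times, so they have to be glued, and at time zero only the initial state can be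
  observed. This asymmetry is why components are integrated over \<open>state_times\<close>.

  In the converse direction the candidate is first shown to solve an equation whose driver ignores
  \<open>y\<close> and \<open>z\<close>. Only then is the Markovian driver put in, since its
  integrability along the candidate is a conclusion.\<close>

lemma set_integral_split:
  fixes d :: "real \<Rightarrow> real"
  assumes "a \<le> b" "b \<le> c" "set_integrable lborel {a..c} d"
  shows "(LINT x:{a..c}|lborel. d x) = (LINT x:{a..b}|lborel. d x) + (LINT x:{b..c}|lborel. d x)"
proof -
  have i: "set_integrable lborel {a..b} d" "set_integrable lborel {b..c} d"
    using assms by (auto intro: set_integrable_subset)
  have "{a..c} = {a..b} \<union> {b..c}" using assms by auto
  moreover have "AE x in lborel. \<not> (x \<in> {a..b} \<and> x \<in> {b..c})"
    using AE_lborel_singleton[of b] by eventually_elim auto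
  ultimately show ?thesis
    using set_integral_Un_AE[OF _ _ _ i] by auto
qed

lemma set_integrable_join:
  fixes d :: "real \<Rightarrow> real"
  assumes "a \<le> b" "b \<le> c" "set_integrable lborel {a..b} d" "set_integrable lborel {b..c} d"
  shows "set_integrable lborel {a..c} d"
proof -
  have "{a..c} = {a..b} \<union> {b..c}" using assms by auto
  then show ?thesis using set_integrable_Un[OF assms(3,4)] by simp
qed

lemma set_integral_singleton:
  fixes d :: "real \<Rightarrow> real"
  shows "(LINT x:{a..a}|lborel. d x) = 0"
proof -
  have "AE x in lborel. indicator {a..a} x *\<^sub>R d x = 0"
    using AE_lborel_singleton[of a] by eventually_elim (auto simp: indicator_def)
  then show ?thesis
    unfolding set_lebesgue_integral_def by (rule integral_eq_zero_AE)
qed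

text \<open>The truncated difference \<open>d\<close> integrates to zero over every compact
  interval. These intervals are stable under intersection and generate the Borel sets, so the
  integral vanishes over all Borel sets and \<open>d\<close> is zero almost everywhere.\<close>

lemma AE_eq_if_interval_integrals_eq:
  fixes a b :: "real \<Rightarrow> real"
  assumes ia: "set_integrable lborel {s..t} a" and ib: "set_integrable lborel {s..t} b"
    and eq: "\<And>p q. s \<le> p \<Longrightarrow> p \<le> q \<Longrightarrow> q \<le> t \<Longrightarrow>
      (LINT x:{p..q}|lborel. a x) = (LINT x:{p..q}|lborel. b x)"
  shows "AE x in lborel. x \<in> {s..t} \<longrightarrow> a x = b x"
proof (cases "s \<le> t")
  case True
  define d where "d = (\<lambda>x. indicator {s..t} x *\<^sub>R (a x - b x))"
  have id: "integrable lborel d"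
    using set_integral_diff(1)[OF ia ib] unfolding d_def set_integrable_def by simp
  have cc: "(LINT x:{p..q}|lborel. d x) = 0" for p q
  proof (cases "max s p \<le> min t q")
    case True
    define p' q' where "p' = max s p" and "q' = min t q"
    have pq: "s \<le> p'" "p' \<le> q'" "q' \<le> t" using True \<open>s \<le> t\<close> by (auto simp: p'_def q'_def)
    have "(LINT x:{p..q}|lborel. d x) = (LINT x:{p'..q'}|lborel. a x - b x)"
      unfolding d_def set_lebesgue_integral_def p'_def q'_def
      by (intro Bochner_Integration.integral_cong) (auto simp: indicator_def)
    also have "\<dots> = (LINT x:{p'..q'}|lborel. a x) - (LINT x:{p'..q'}|lborel. b x)"
      using pq by (intro set_integral_diff(2) set_integrable_subset[OF ia] set_integrable_subset[OF ib]) auto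
    also have "\<dots> = 0" using eq pq by simp
    finally show ?thesis .
  next
    case False
    then have "(\<lambda>x. indicator {p..q} x *\<^sub>R d x) = (\<lambda>x. 0)"
      by (auto simp: d_def indicator_def fun_eq_iff)
    then show ?thesis unfolding set_lebesgue_integral_def by (simp only: Bochner_Integration.integral_zero)
  qed
  have sd: "set_integrable lborel D d" if "D \<in> sets lborel" for D :: "real set"
    using id that unfolding set_integrable_def by (intro integrable_mult_indicator) auto
  \<comment> \<open>The complement step of the induction subtracts from this total.\<close>
  have tot: "(LINT x:UNIV|lborel. d x) = 0"
  proof -
    have "(LINT x:UNIV|lborel. d x) = (LINT x:{s..t}|lborel. d x)"
      unfolding set_lebesgue_integral_def by (intro Bochner_Integration.integral_cong) (auto simp: d_def indicator_def)
    then show ?thesis using cc by simp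
  qed
  have all: "(LINT x:D|lborel. d x) = 0" if "D \<in> sets borel" for D :: "real set"
  proof -
    have B: "sets borel = sigma_sets UNIV (range (\<lambda>(p, q). {p..q::real}))"
      by (subst borel_eq_atLeastAtMost) (rule sets_measure_of, simp)
    have "Int_stable (range (\<lambda>(p, q). {p..q::real}))"
      by (auto simp: Int_stable_def Int_atLeastAtMost)
    moreover have "range (\<lambda>(p, q). {p..q::real}) \<subseteq> Pow UNIV" by simp
    moreover have "D \<in> sigma_sets UNIV (range (\<lambda>(p, q). {p..q::real}))"
      using that B by simp
    ultimately show ?thesis
    proof (induction D rule: sigma_sets_induct_disjoint)
      case (basic D) then show ?case using cc by auto
    next
      case empty then show ?case by (simp add: set_lebesgue_integral_def)
    next
      case (compl D)
      have D: "D \<in> sets lborel" using compl B by simp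
      have "(LINT x:D \<union> (UNIV - D)|lborel. d x) = (LINT x:D|lborel. d x) + (LINT x:UNIV - D|lborel. d x)"
        using D by (intro set_integral_Un sd) auto
      moreover have "D \<union> (UNIV - D) = UNIV" by auto
      ultimately show ?case using tot compl by simp
    next
      case (union E)
      have E: "E i \<in> sets lborel" for i
        using union(2) B by auto
      have "(LINT x:(\<Union>i. E i)|lborel. d x) = (\<Sum>i. (LINT x:E i|lborel. d x))"
        by (rule lebesgue_integral_countable_add[OF E])
          (use union(1) E in \<open>auto intro!: sd simp: disjoint_family_on_def\<close>)
      then show ?case using union by simp
    qed
  qed
  have "AE x in lborel. d x = 0"
    by (rule density_unique_real[OF id, of "\<lambda>_. 0"]) (use all in auto)
  then show ?thesis by eventually_elim (auto simp: d_def indicator_def)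
qed auto

lemma set_integrable_if_integrable:
  fixes d :: "real \<Rightarrow> real"
  shows "integrable lborel d \<Longrightarrow> set_integrable lborel {a..b} d"
  unfolding set_integrable_def by (intro integrable_mult_indicator) simp_all

lemma finite_if_subsingleton: "(\<And>x y. x \<in> S \<Longrightarrow> y \<in> S \<Longrightarrow> x = y) \<Longrightarrow> finite S"
  by (metis finite.emptyI finite_insert finite_subset insertI1 subsetI subset_singletonD)

text \<open>Made for sets such as half-open intervals, which need not contain their endpoints. A
  countable dense subset of \<open>G\<close> supplies countably many intervals, and a point of
  \<open>G\<close> that lies in none of them is the least or the greatest element of
  \<open>G\<close>.\<close>

lemma AE_on_real_set:
  fixes G :: "real set"
  assumes "\<And>p q. p \<in> G \<Longrightarrow> q \<in> G \<Longrightarrow> AE x in lborel. x \<in> {p..q} \<longrightarrow> P x"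
  shows "AE x in lborel. x \<in> G \<longrightarrow> P x"
proof -
  obtain D where D: "countable D" "D \<subseteq> G" "G \<subseteq> closure D"
    using separable by blast
  have "AE x in lborel. \<forall>p\<in>D. \<forall>q\<in>D. x \<in> {p..q} \<longrightarrow> P x"
    unfolding AE_ball_countable[OF D(1)] using assms D by blast
  moreover have "AE x in lborel. x \<notin> {x \<in> G. \<not> (\<exists>p\<in>D. \<exists>q\<in>D. x \<in> {p..q})}"
  proof -
    have sub: "x = y" if "x \<in> {x \<in> G. \<forall>p\<in>D. \<not> p \<le> x}" "y \<in> {x \<in> G. \<forall>p\<in>D. \<not> p \<le> x}" for x y
    proof (rule ccontr)
      assume "x \<noteq> y"
      have *: False if "x < y" "x \<in> G" "y \<in> G" "\<forall>p\<in>D. \<not> p \<le> y" for x y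
      proof -
        have "x \<in> closure D" using D that by auto
        then have "\<exists>p\<in>D. dist p x < y - x"
          using that(1) by (simp add: closure_approachable)
        then obtain p where "p \<in> D" "dist p x < y - x" by blast
        then show False using that by (auto simp: dist_real_def)
      qed
      show False using *[of x y] *[of y x] that \<open>x \<noteq> y\<close> by (cases "x < y") auto
    qed
    have sub2: "x = y" if "x \<in> {x \<in> G. \<forall>p\<in>D. \<not> x \<le> p}" "y \<in> {x \<in> G. \<forall>p\<in>D. \<not> x \<le> p}" for x y
    proof (rule ccontr)
      assume "x \<noteq> y"
      have *: False if "y < x" "x \<in> G" "y \<in> G" "\<forall>p\<in>D. \<not> y \<le> p" for x y
      proof -
        have "x \<in> closure D" using D that by auto
        then have "\<exists>p\<in>D. dist p x < x - y"
          using that(1) by (simp add: closure_approachable)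
        then obtain p where "p \<in> D" "dist p x < x - y" by blast
        then show False using that by (auto simp: dist_real_def)
      qed
      show False using *[of x y] *[of y x] that \<open>x \<noteq> y\<close> by (cases "x < y") auto
    qed
    have "finite {x \<in> G. \<forall>p\<in>D. \<not> p \<le> x}" "finite {x \<in> G. \<forall>p\<in>D. \<not> x \<le> p}"
      by (rule finite_if_subsingleton, rule sub, assumption, assumption)
        (rule finite_if_subsingleton, rule sub2, assumption, assumption)
    then have "{x \<in> G. \<forall>p\<in>D. \<not> p \<le> x} \<union> {x \<in> G. \<forall>p\<in>D. \<not> x \<le> p} \<in> null_sets lborel"
      by (intro finite_imp_null_set_lborel finite_UnI)
    from AE_not_in[OF this] show ?thesis by eventually_elim auto
  qed
  ultimately show ?thesis by eventually_elim auto
qed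

text \<open>The local densities come from unrelated sources and agree only almost everywhere on
  overlaps. Lindelof leaves countably many of them, so the disagreements form a null set and a
  single density can be selected pointwise.\<close>

lemma glue_densities:
  fixes u :: "real \<Rightarrow> real"
  assumes J: "is_interval J"
    and loc: "\<And>t. t \<in> J \<Longrightarrow> \<exists>\<delta>>0. \<exists>d. integrable lborel d \<and>
      (\<forall>a\<in>J. \<forall>b\<in>J. t - \<delta> < a \<longrightarrow> a \<le> b \<longrightarrow> b < t + \<delta> \<longrightarrow> u b - u a = (LINT x:{a..b}|lborel. d x))"
  obtains w where "w \<in> borel_measurable borel"
    "\<And>a b. a \<in> J \<Longrightarrow> b \<in> J \<Longrightarrow> a \<le> b \<Longrightarrow>
       set_integrable lborel {a..b} w \<and> u b - u a = (LINT x:{a..b}|lborel. w x)"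
proof (cases "J = {}")
  case True
  then show ?thesis by (intro that[of "\<lambda>_. 0"]) simp_all
next
  case False
  have ivl: "{a..b} \<subseteq> J" if "a \<in> J" "b \<in> J" for a b
    using J[unfolded is_interval_1] that by (meson atLeastAtMost_iff subsetI)
  have "\<forall>t\<in>J. \<exists>p. fst p > 0 \<and> integrable lborel (snd p) \<and> (\<forall>a\<in>J. \<forall>b\<in>J. t - fst p < a \<longrightarrow>
    a \<le> b \<longrightarrow> b < t + fst p \<longrightarrow> u b - u a = (LINT x:{a..b}|lborel. snd p x))"
  proof
    fix t assume "t \<in> J"
    from loc[OF this] obtain \<delta> d where "\<delta> > 0" "integrable lborel d"
      "\<forall>a\<in>J. \<forall>b\<in>J. t - \<delta> < a \<longrightarrow> a \<le> b \<longrightarrow> b < t + \<delta> \<longrightarrow> u b - u a = (LINT x:{a..b}|lborel. d x)"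
      by (elim exE conjE)
    then show "\<exists>p. fst p > 0 \<and> integrable lborel (snd p) \<and> (\<forall>a\<in>J. \<forall>b\<in>J. t - fst p < a \<longrightarrow>
      a \<le> b \<longrightarrow> b < t + fst p \<longrightarrow> u b - u a = (LINT x:{a..b}|lborel. snd p x))"
      by (intro exI[of _ "(\<delta>, d)"]) simp
  qed
  from bchoice[OF this] obtain \<pi> where "\<forall>t\<in>J. fst (\<pi> t) > 0 \<and> integrable lborel (snd (\<pi> t)) \<and>
    (\<forall>a\<in>J. \<forall>b\<in>J. t - fst (\<pi> t) < a \<longrightarrow>
    a \<le> b \<longrightarrow> b < t + fst (\<pi> t) \<longrightarrow> u b - u a = (LINT x:{a..b}|lborel. snd (\<pi> t) x))"
    by (elim exE)
  note \<pi> = this[rule_format]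
  define \<delta> d where "\<delta> = (\<lambda>t. fst (\<pi> t))" and "d = (\<lambda>t. snd (\<pi> t))"
  have \<delta>: "\<And>t. t \<in> J \<Longrightarrow> \<delta> t > 0"
    and d: "\<And>t. t \<in> J \<Longrightarrow> integrable lborel (d t)"
    and ud: "\<And>t a b. t \<in> J \<Longrightarrow> a \<in> J \<Longrightarrow> b \<in> J \<Longrightarrow> t - \<delta> t < a \<Longrightarrow> a \<le> b \<Longrightarrow> b < t + \<delta> t
      \<Longrightarrow> u b - u a = (LINT x:{a..b}|lborel. d t x)"
    unfolding \<delta>_def d_def using \<pi> by blast+
  define \<O> where "\<O> = (\<lambda>t. {t - \<delta> t<..<t + \<delta> t}) ` J"
  have "open S" if "S \<in> \<O>" for S using that by (auto simp: \<O>_def)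
  from Lindelof[of \<O>, OF this] obtain \<O>' where \<O>': "\<O>' \<subseteq> \<O>" "countable \<O>'" "\<Union>\<O>' = \<Union>\<O>"
    by metis
  have "countable \<O>' \<and> \<O>' \<subseteq> (\<lambda>t. {t - \<delta> t<..<t + \<delta> t}) ` J" using \<O>'(1,2) by (simp add: \<O>_def)
  then obtain C where C: "C \<subseteq> J" "countable C" "\<O>' = (\<lambda>t. {t - \<delta> t<..<t + \<delta> t}) ` C"
    by (auto simp only: countable_subset_image)
  have cov: "\<exists>c\<in>C. c - \<delta> c < t \<and> t < c + \<delta> c" if "t \<in> J" for t
  proof -
    have "t \<in> \<Union>\<O>" using that \<delta>[OF that] by (auto simp: \<O>_def intro!: bexI[of _ t])
    then have "t \<in> \<Union>\<O>'" using \<O>' by simp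
    then show ?thesis using C by auto
  qed
  have Cne: "C \<noteq> {}" using cov False by blast
  define c where "c = from_nat_into C"
  have cC: "c k \<in> C" for k using from_nat_into[OF Cne] by (simp add: c_def)
  have cJ: "c k \<in> J" for k using cC C by auto
  have ck: "\<exists>k. x = c k" if "x \<in> C" for x
    using that C Cne by (metis c_def from_nat_into_surj)
  define In where "In = (\<lambda>k x. c k - \<delta> (c k) < x \<and> x < c k + \<delta> (c k))"
  have ex: "\<exists>k. In k t" if "t \<in> J" for t
    using cov[OF that] ck by (auto simp: In_def)
  \<comment> \<open>Selecting the neighbourhood with the least index is a countable case
    distinction, hence measurable.\<close>
  define w where "w = (\<lambda>x. d (c (LEAST k. In k x)) x)"
  have [measurable]: "Measurable.pred borel (In k)" for k unfolding In_def by measurable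
  have [measurable]: "d (c k) \<in> borel_measurable borel" for k using d[OF cJ] by auto
  have wm: "w \<in> borel_measurable borel"
    unfolding w_def
    by (rule measurable_compose_countable[where f="\<lambda>k x. d (c k) x"]) measurable
  have pair: "AE x in lborel. x \<in> J \<longrightarrow> In k x \<longrightarrow> In l x \<longrightarrow> d (c k) x = d (c l) x" for k l
  proof -
    have q: "AE x in lborel. x \<in> {p..q} \<longrightarrow> d (c k) x = d (c l) x"
      if pq: "p \<in> J" "q \<in> J" "In k p" "In k q" "In l p" "In l q" for p q
    proof (rule AE_eq_if_interval_integrals_eq)
      show "set_integrable lborel {p..q} (d (c k))" "set_integrable lborel {p..q} (d (c l))"
        by (intro set_integrable_if_integrable d cJ)+
      fix a b assume ab: "p \<le> a" "a \<le> b" "b \<le> q"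
      then have "a \<in> J" "b \<in> J" using ivl[OF pq(1,2)] by auto
      then show "(LINT x:{a..b}|lborel. d (c k) x) = (LINT x:{a..b}|lborel. d (c l) x)"
        using ud[OF cJ[of k], of a b] ud[OF cJ[of l], of a b] pq ab by (auto simp: In_def)
    qed
    \<comment> \<open>The overlap is again an interval, but possibly without its endpoints, so only
      its compact subintervals are compared.\<close>
    define G where "G = {x \<in> J. In k x \<and> In l x}"
    have "AE x in lborel. x \<in> G \<longrightarrow> d (c k) x = d (c l) x"
    proof (rule AE_on_real_set)
      fix p q assume "p \<in> G" "q \<in> G"
      then show "AE x in lborel. x \<in> {p..q} \<longrightarrow> d (c k) x = d (c l) x"
        by (intro q) (simp_all add: G_def)
    qed
    then show ?thesis by eventually_elim (auto simp: G_def)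
  qed
  have wd: "AE x in lborel. \<forall>k. x \<in> J \<longrightarrow> In k x \<longrightarrow> w x = d (c k) x"
  proof -
    have "AE x in lborel. \<forall>k l. x \<in> J \<longrightarrow> In k x \<longrightarrow> In l x \<longrightarrow> d (c k) x = d (c l) x"
      unfolding AE_all_countable using pair by blast
    then show ?thesis
    proof eventually_elim
      case (elim x)
      show ?case
      proof (intro allI impI)
        fix k assume k: "x \<in> J" "In k x"
        have "In (LEAST j. In j x) x" using LeastI[of "\<lambda>j. In j x", OF k(2)] .
        with elim k show "w x = d (c k) x" unfolding w_def by blast
      qed
    qed
  qed
  define Q where "Q = (\<lambda>a b. a \<in> J \<longrightarrow> b \<in> J \<longrightarrow> a \<le> b \<longrightarrow>
     set_integrable lborel {a..b} w \<and> u b - u a = (LINT x:{a..b}|lborel. w x))"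
  have loc: "Q a b" if "In k a" "In k b" for k a b
    unfolding Q_def
  proof (intro impI)
    assume ab: "a \<in> J" "b \<in> J" "a \<le> b"
    have inab: "x \<in> J \<and> In k x" if "x \<in> {a..b}" for x
      using ivl[OF ab(1,2)] that \<open>In k a\<close> \<open>In k b\<close> by (auto simp: In_def)
    have ae: "AE x in lborel. indicator {a..b} x *\<^sub>R w x = indicator {a..b} x *\<^sub>R d (c k) x"
      using wd by eventually_elim (use inab in \<open>simp add: indicator_def\<close>)
    have sd: "set_integrable lborel {a..b} (d (c k))"
      by (intro set_integrable_if_integrable d cJ)
    have "set_integrable lborel {a..b} w"
      unfolding set_integrable_def
    proof (rule integrable_cong_AE_imp[OF sd[unfolded set_integrable_def]])
      show "(\<lambda>x. indicator {a..b} x *\<^sub>R w x) \<in> borel_measurable lborel" using wm by measurable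
      show "AE x in lborel. indicator {a..b} x *\<^sub>R d (c k) x = indicator {a..b} x *\<^sub>R w x"
        using ae by eventually_elim (rule sym)
    qed
    moreover have "(LINT x:{a..b}|lborel. w x) = (LINT x:{a..b}|lborel. d (c k) x)"
      unfolding set_lebesgue_integral_def
    proof (rule integral_cong_AE[OF _ _ ae])
      show "(\<lambda>x. indicator {a..b} x *\<^sub>R w x) \<in> borel_measurable lborel" using wm by measurable
      show "(\<lambda>x. indicator {a..b} x *\<^sub>R d (c k) x) \<in> borel_measurable lborel" by measurable
    qed
    ultimately show "set_integrable lborel {a..b} w \<and> u b - u a = (LINT x:{a..b}|lborel. w x)"
      using ud[OF cJ[of k], of a b] ab that by (auto simp: In_def)
  qed
  have "Q a b" if ab: "a \<in> J" "b \<in> J" "a \<le> b" for a b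
  proof -
    \<comment> \<open>The guard keeps the subintervals of the bisection inside
      \<open>{a..b}\<close>, hence inside \<open>J\<close>.\<close>
    define Q' where "Q' = (\<lambda>p q. a \<le> p \<longrightarrow> q \<le> b \<longrightarrow> Q p q)"
    have "Q' a b" using \<open>a \<le> b\<close>
    proof (induct rule: Bolzano)
      case (trans p q r)
      show ?case unfolding Q'_def
      proof (intro impI)
        assume "a \<le> p" "r \<le> b"
        then have mem: "p \<in> J" "q \<in> J" "r \<in> J" using trans ivl[OF ab(1,2)] by auto
        have 1: "set_integrable lborel {p..q} w" "u q - u p = (LINT x:{p..q}|lborel. w x)"
          "set_integrable lborel {q..r} w" "u r - u q = (LINT x:{q..r}|lborel. w x)"
          using trans mem \<open>a \<le> p\<close> \<open>r \<le> b\<close> by (auto simp: Q'_def Q_def)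
        have "set_integrable lborel {p..r} w"
          using 1 trans by (intro set_integrable_join[of p q r]) auto
        with set_integral_split[of p q r w] show "Q p r"
          unfolding Q_def using 1 trans by auto
      qed
    next
      case (local x)
      then have "x \<in> J" using ivl[OF ab(1,2)] by auto
      then obtain k where k: "In k x" using ex by auto
      define e where "e = min (x - (c k - \<delta> (c k))) (c k + \<delta> (c k) - x)"
      have "e > 0" using k by (auto simp: e_def In_def)
      then show ?case
        by (intro exI[of _ e] conjI allI impI) (auto simp: Q'_def e_def In_def intro!: loc[of k])
    qed
    then show ?thesis by (simp add: Q'_def)
  qed
  then show ?thesis using that[OF wm] by (auto simp: Q_def)
qed

section \<open>Paths of the chain\<close>

lemma eventually_eq_limit_if_finite:
  fixes f :: "'b \<Rightarrow> 'c::t1_space"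
  assumes "(f \<longlongrightarrow> l) F" "eventually (\<lambda>x. f x \<in> S) F" "finite S"
  shows "eventually (\<lambda>x. f x = l) F"
proof -
  have "open (- (S - {l}))" using assms(3) by (intro open_Compl finite_imp_closed) simp
  from topological_tendstoD[OF assms(1) this] have "eventually (\<lambda>x. f x \<in> - (S - {l})) F" by simp
  with assms(2) show ?thesis by eventually_elim auto
qed

section \<open>Left limits and joint measurability of processes\<close>

lemma left_lim_eqI:
  assumes "0 < t" "((\<lambda>s. W s \<omega>) \<longlongrightarrow> l) (at_left t)"
  shows "left_lim W t \<omega> = l"
  using assms tendsto_Lim[OF trivial_limit_at_left_real assms(2)] by (simp add: left_lim_def)

lemma left_lim_const:
  assumes "0 < t" "a < t" "\<And>s. a < s \<Longrightarrow> s < t \<Longrightarrow> W s \<omega> = l"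
  shows "left_lim W t \<omega> = l"
proof (rule left_lim_eqI[OF assms(1)])
  have "eventually (\<lambda>s. W s \<omega> = l) (at_left t)"
    using assms by (auto simp: eventually_at_left_field intro!: exI[of _ a])
  then show "((\<lambda>s. W s \<omega>) \<longlongrightarrow> l) (at_left t)" by (rule tendsto_eventually)
qed

text \<open>Where the integer \<open>k t\<close> is constant, this is the process at a fixed time,
  and the integers are countable. Clamping keeps the time in \<open>{0..T}\<close>, so only values
  of \<open>W\<close> up to \<open>T\<close> are used.\<close>

lemma measurable_grid:
  fixes W :: "real \<Rightarrow> 'a \<Rightarrow> 'b::topological_space"
  assumes T: "0 \<le> T" and W: "\<And>t. 0 \<le> t \<Longrightarrow> t \<le> T \<Longrightarrow> W t \<in> borel_measurable M"
    and k: "k \<in> measurable borel (count_space (UNIV::int set))"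
  shows "(\<lambda>(t, \<omega>). W (min T (max 0 (real_of_int (k t) / real (Suc n)))) \<omega>)
    \<in> borel_measurable (restrict_space borel {0..T} \<Otimes>\<^sub>M M)"
proof -
  have [measurable]: "(\<lambda>p. W (min T (max 0 (real_of_int i / real (Suc n)))) (snd p))
      \<in> borel_measurable (restrict_space borel {0..T} \<Otimes>\<^sub>M M)" for i
    by (rule measurable_compose[OF measurable_snd W]) (use T in auto)
  have [measurable]: "(\<lambda>p. k (fst p)) \<in> measurable (restrict_space borel {0..T} \<Otimes>\<^sub>M M) (count_space UNIV)"
    by (rule measurable_compose[OF measurable_fst measurable_restrict_space1[OF k]])
  show ?thesis
    unfolding case_prod_beta
    by (rule measurable_compose_countable[where f="\<lambda>i p. W (min T (max 0 (real_of_int i / real (Suc n)))) (snd p)"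
          and g="\<lambda>p. k (fst p)"]) measurable
qed

lemma filterlim_at_leftI:
  fixes t :: real
  assumes "\<And>n. g n < t" "\<And>n. t - 1 / real (Suc n) \<le> g n"
  shows "filterlim g (at_left t) sequentially"
proof -
  have "(\<lambda>n. t - 1 / real (Suc n)) \<longlonglongrightarrow> t - 0"
    by (intro tendsto_diff tendsto_const) (use LIMSEQ_inverse_real_of_nat in \<open>simp only: inverse_eq_divide\<close>)
  then have "(\<lambda>n. t - 1 / real (Suc n)) \<longlonglongrightarrow> t" by simp
  then have "g \<longlonglongrightarrow> t"
    by (rule tendsto_sandwich[OF _ _ _ tendsto_const, rotated 2])
      (intro always_eventually allI assms(2), intro always_eventually allI less_imp_le assms(1))
  moreover have "g n \<in> {..<t} \<and> g n \<noteq> t" for n using assms(1)[of n] by simp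
  ultimately show ?thesis by (simp add: filterlim_at)
qed

lemma filterlim_at_rightI:
  fixes t :: real
  assumes "\<And>n. t < g n" "\<And>n. g n \<le> t + 1 / real (Suc n)"
  shows "filterlim g (at_right t) sequentially"
proof -
  have "(\<lambda>n. t + 1 / real (Suc n)) \<longlonglongrightarrow> t + 0"
    by (intro tendsto_add tendsto_const) (use LIMSEQ_inverse_real_of_nat in \<open>simp only: inverse_eq_divide\<close>)
  then have "(\<lambda>n. t + 1 / real (Suc n)) \<longlonglongrightarrow> t" by simp
  then have "g \<longlonglongrightarrow> t"
    by (rule tendsto_sandwich[OF _ _ tendsto_const, rotated 2])
      (intro always_eventually allI less_imp_le assms(1), intro always_eventually allI assms(2))
  moreover have "g n \<in> {t<..} \<and> g n \<noteq> t" for n using assms(1)[of n] by simp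
  ultimately show ?thesis by (simp add: filterlim_at)
qed

text \<open>The last multiple of \<open>1 / real (Suc n)\<close> strictly before \<open>t\<close>:
  ceiling minus one stays strict even if \<open>t\<close> lies on the grid.\<close>

lemma grid_left:
  assumes "0 < (t::real)"
  shows "filterlim (\<lambda>n. max 0 (real_of_int (\<lceil>real (Suc n) * t\<rceil> - 1) / real (Suc n))) (at_left t) sequentially"
    "max 0 (real_of_int (\<lceil>real (Suc n) * t\<rceil> - 1) / real (Suc n)) < t"
proof -
  have u: "max 0 (real_of_int (\<lceil>real (Suc n) * t\<rceil> - 1) / real (Suc n)) < t" for n
  proof -
    have "real_of_int (\<lceil>real (Suc n) * t\<rceil> - 1) < real (Suc n) * t" by linarith
    then show ?thesis using assms by (simp add: pos_divide_less_eq mult.commute)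
  qed
  have l: "t - 1 / real (Suc n) \<le> max 0 (real_of_int (\<lceil>real (Suc n) * t\<rceil> - 1) / real (Suc n))" for n
  proof -
    have "real (Suc n) * t - 1 \<le> real_of_int (\<lceil>real (Suc n) * t\<rceil> - 1)" by linarith
    then have "(real (Suc n) * t - 1) / real (Suc n) \<le> real_of_int (\<lceil>real (Suc n) * t\<rceil> - 1) / real (Suc n)"
      by (rule divide_right_mono) simp
    then show ?thesis by (simp add: diff_divide_distrib del: of_nat_Suc)
  qed
  show "max 0 (real_of_int (\<lceil>real (Suc n) * t\<rceil> - 1) / real (Suc n)) < t" by (rule u)
  show "filterlim (\<lambda>n. max 0 (real_of_int (\<lceil>real (Suc n) * t\<rceil> - 1) / real (Suc n))) (at_left t) sequentially"
    using u l by (rule filterlim_at_leftI)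
qed

text \<open>Floor plus one lies strictly after \<open>t\<close> even if \<open>t\<close> is on the
  grid, as a right limit requires.\<close>

lemma grid_right:
  assumes "0 \<le> (t::real)"
  shows "filterlim (\<lambda>n. real_of_int (\<lfloor>real (Suc n) * t\<rfloor> + 1) / real (Suc n)) (at_right t) sequentially"
proof -
  have u: "real_of_int (\<lfloor>real (Suc n) * t\<rfloor> + 1) / real (Suc n) > t" for n
  proof -
    have "real_of_int (\<lfloor>real (Suc n) * t\<rfloor> + 1) > real (Suc n) * t" by linarith
    then show ?thesis using assms by (simp add: pos_less_divide_eq mult.commute)
  qed
  have l: "t + 1 / real (Suc n) \<ge> real_of_int (\<lfloor>real (Suc n) * t\<rfloor> + 1) / real (Suc n)" for n
  proof -
    have "real (Suc n) * t + 1 \<ge> real_of_int (\<lfloor>real (Suc n) * t\<rfloor> + 1)" by linarith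
    then have "(real (Suc n) * t + 1) / real (Suc n) \<ge> real_of_int (\<lfloor>real (Suc n) * t\<rfloor> + 1) / real (Suc n)"
      by (rule divide_right_mono) simp
    then show ?thesis by (simp add: add_divide_distrib del: of_nat_Suc)
  qed
  show ?thesis
    using u l by (rule filterlim_at_rightI)
qed

lemma measurable_left_lim:
  fixes W :: "real \<Rightarrow> 'a \<Rightarrow> 'b::metric_space"
  assumes T: "0 \<le> T" and W: "\<And>t. 0 \<le> t \<Longrightarrow> t \<le> T \<Longrightarrow> W t \<in> borel_measurable M"
    and lim: "\<And>t \<omega>. 0 < t \<Longrightarrow> t \<le> T \<Longrightarrow> \<omega> \<in> space M \<Longrightarrow> \<exists>l. ((\<lambda>s. W s \<omega>) \<longlongrightarrow> l) (at_left t)"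
  shows "(\<lambda>(t, \<omega>). left_lim W t \<omega>) \<in> borel_measurable (restrict_space borel {0..T} \<Otimes>\<^sub>M M)"
proof (rule borel_measurable_LIMSEQ_metric)
  let ?f = "\<lambda>n (t, \<omega>). W (min T (max 0 (real_of_int (\<lceil>real (Suc n) * t\<rceil> - 1) / real (Suc n)))) \<omega>"
  show "?f n \<in> borel_measurable (restrict_space borel {0..T} \<Otimes>\<^sub>M M)" for n
    by (rule measurable_grid[OF T W]) auto
  fix p assume "p \<in> space (restrict_space borel {0..T} \<Otimes>\<^sub>M M)"
  then obtain t \<omega> where p: "p = (t, \<omega>)" "0 \<le> t" "t \<le> T" "\<omega> \<in> space M"
    by (auto simp: space_pair_measure space_restrict_space)
  show "(\<lambda>n. ?f n p) \<longlonglongrightarrow> (case p of (t, \<omega>) \<Rightarrow> left_lim W t \<omega>)"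
  proof (cases "t = 0")
    \<comment> \<open>At time zero the clamped grid point is zero, which agrees with the convention
      for \<open>left_lim\<close>.\<close>
    case True
    then have "?f n p = W 0 \<omega>" for n using p T by (simp add: max_def min_def)
    then show ?thesis using p True by (simp add: left_lim_def)
  next
    case False
    then have t: "0 < t" using p by simp
    obtain l where l: "((\<lambda>s. W s \<omega>) \<longlongrightarrow> l) (at_left t)" using lim t p by blast
    have "?f n p = W (max 0 (real_of_int (\<lceil>real (Suc n) * t\<rceil> - 1) / real (Suc n))) \<omega>" for n
      using grid_left(2)[OF t, of n] p by (simp add: min_def)
    then show ?thesis
      using filterlim_compose[OF l grid_left(1)[OF t]] left_lim_eqI[of t W \<omega> l, OF t l] p by simp
  qed
qed

text \<open>The grid points are clamped, so only values of \<open>W\<close> up to \<open>T\<close>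
  enter. With \<open>M\<close> the sigma-algebra of the filtration at time \<open>T\<close>, this is
  progressive measurability.\<close>

lemma measurable_right_continuous:
  fixes W :: "real \<Rightarrow> 'a \<Rightarrow> 'b::metric_space"
  assumes T: "0 \<le> T" and W: "\<And>t. 0 \<le> t \<Longrightarrow> t \<le> T \<Longrightarrow> W t \<in> borel_measurable M"
    and lim: "\<And>t \<omega>. 0 \<le> t \<Longrightarrow> t < T \<Longrightarrow> \<omega> \<in> space M \<Longrightarrow> continuous (at_right t) (\<lambda>s. W s \<omega>)"
  shows "(\<lambda>(t, \<omega>). W t \<omega>) \<in> borel_measurable (restrict_space borel {0..T} \<Otimes>\<^sub>M M)"
proof (rule borel_measurable_LIMSEQ_metric)
  let ?f = "\<lambda>n (t, \<omega>). W (min T (max 0 (real_of_int (\<lfloor>real (Suc n) * t\<rfloor> + 1) / real (Suc n)))) \<omega>"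
  show "?f n \<in> borel_measurable (restrict_space borel {0..T} \<Otimes>\<^sub>M M)" for n
    by (rule measurable_grid[OF T W]) auto
  fix p assume "p \<in> space (restrict_space borel {0..T} \<Otimes>\<^sub>M M)"
  then obtain t \<omega> where p: "p = (t, \<omega>)" "0 \<le> t" "t \<le> T" "\<omega> \<in> space M"
    by (auto simp: space_pair_measure space_restrict_space)
  note g = grid_right[OF p(2), unfolded filterlim_at]
  have ev: "eventually (\<lambda>n. t < real_of_int (\<lfloor>real (Suc n) * t\<rfloor> + 1) / real (Suc n)) sequentially"
    using g by (auto elim!: eventually_mono simp del: of_nat_Suc)
  show "(\<lambda>n. ?f n p) \<longlonglongrightarrow> (case p of (t, \<omega>) \<Rightarrow> W t \<omega>)"
  proof (cases "t = T")
    \<comment> \<open>At the right endpoint the clamp freezes the approximations at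
      \<open>T\<close>, so nothing after \<open>T\<close> is consulted.\<close>
    case True
    have "eventually (\<lambda>n. ?f n p = W T \<omega>) sequentially"
      using ev by eventually_elim (use p True T in \<open>simp add: min_def max_def del: of_nat_Suc\<close>)
    then show ?thesis using p True by (simp add: tendsto_eventually)
  next
    case False
    then have t: "t < T" using p by simp
    have l: "((\<lambda>s. W s \<omega>) \<longlongrightarrow> W t \<omega>) (at_right t)"
      using lim[OF p(2) t p(4)] by (simp add: continuous_within)
    have "eventually (\<lambda>n. real_of_int (\<lfloor>real (Suc n) * t\<rfloor> + 1) / real (Suc n) < T) sequentially"
      using order_tendstoD(2)[OF conjunct2[OF g] t] .
    with ev have "eventually (\<lambda>n. W (real_of_int (\<lfloor>real (Suc n) * t\<rfloor> + 1) / real (Suc n)) \<omega> = ?f n p) sequentially"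
      by eventually_elim (use p in \<open>simp add: min_def max_def del: of_nat_Suc\<close>)
    from Lim_transform_eventually[OF filterlim_compose[OF l grid_right[OF p(2)]] this]
    show ?thesis using p by simp
  qed
qed

text \<open>The joint statement over the one-point space \<open>count_space {\<omega>}\<close>,
  restricted to its only section.\<close>

lemma measurable_left_lim_path:
  fixes W :: "real \<Rightarrow> 'a \<Rightarrow> 'b::metric_space"
  assumes T: "0 \<le> T" and lim: "\<And>t. 0 < t \<Longrightarrow> t \<le> T \<Longrightarrow> \<exists>l. ((\<lambda>s. W s \<omega>) \<longlongrightarrow> l) (at_left t)"
  shows "(\<lambda>t. left_lim W t \<omega>) \<in> borel_measurable (restrict_space borel {0..T})"
proof -
  have "(\<lambda>(t, \<omega>). left_lim W t \<omega>) \<in> borel_measurable (restrict_space borel {0..T} \<Otimes>\<^sub>M count_space {\<omega>})"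
    by (rule measurable_left_lim[OF T]) (use lim in auto)
  moreover have "(\<lambda>t. (t, \<omega>)) \<in> restrict_space borel {0..T} \<rightarrow>\<^sub>M restrict_space borel {0..T} \<Otimes>\<^sub>M count_space {\<omega>}"
    by (intro measurable_Pair2') simp
  ultimately show ?thesis using measurable_compose by fastforce
qed

lemma Basis_vec_real: "(x :: real^'n) \<in> Basis \<longleftrightarrow> (\<exists>i. x = axis i 1)"
  by (auto simp: Basis_vec_def)

section \<open>Jump times and constancy between them\<close>

context markov_chain
begin

definition jumps :: "'a \<Rightarrow> real \<Rightarrow> real \<Rightarrow> real set" where
  "jumps \<omega> a b = {r\<in>{a<..b}. X r \<omega> \<noteq> left_lim X r \<omega>}"

lemma jumps_mono: "a' \<le> a \<Longrightarrow> b \<le> b' \<Longrightarrow> jumps \<omega> a b \<subseteq> jumps \<omega> a' b'"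
  by (auto simp: jumps_def)

lemma left_limit_ex:
  assumes "0 < t" "\<omega> \<in> space P"
  obtains \<delta> where "0 < \<delta>" "\<delta> \<le> t" "\<And>s. t - \<delta> < s \<Longrightarrow> s < t \<Longrightarrow> X s \<omega> = left_lim X t \<omega>"
proof -
  obtain l where l: "((\<lambda>s. X s \<omega>) \<longlongrightarrow> l) (at_left t)" using left_limits assms by blast
  have "eventually (\<lambda>s. X s \<omega> \<in> Basis) (at_left t)"
    unfolding eventually_at_left_field using assms states by (intro exI[of _ 0]) auto
  from eventually_eq_limit_if_finite[OF l this]
  have "eventually (\<lambda>s. X s \<omega> = l) (at_left t)" by simp
  then obtain b where b: "b < t" "\<And>s. b < s \<Longrightarrow> s < t \<Longrightarrow> X s \<omega> = l"
    by (auto simp: eventually_at_left_field)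
  have "left_lim X t \<omega> = l" by (rule left_lim_eqI[of t X \<omega> l, OF assms(1) l])
  then show ?thesis using b assms by (intro that[of "min t (t - b)"]) auto
qed

text \<open>One radius controls both sides of \<open>r\<close>, for the values and for the left
  limits, so that \<open>r\<close> is the only possible jump within it. The guard
  \<open>0 \<le> s\<close> is for radii that reach below time zero.\<close>

definition locally_constant :: "'a \<Rightarrow> real \<Rightarrow> real \<Rightarrow> bool" where
  "locally_constant \<omega> r \<delta> \<longleftrightarrow>
    (\<forall>s. r \<le> s \<longrightarrow> s < r + \<delta> \<longrightarrow> X s \<omega> = X r \<omega>) \<and>
    (\<forall>s. r < s \<longrightarrow> s < r + \<delta> \<longrightarrow> left_lim X s \<omega> = X r \<omega>) \<and>
    (\<forall>s. 0 \<le> s \<longrightarrow> r - \<delta> < s \<longrightarrow> s < r \<longrightarrow> X s \<omega> = left_lim X r \<omega>) \<and>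
    (\<forall>s. 0 \<le> s \<longrightarrow> r - \<delta> < s \<longrightarrow> s < r \<longrightarrow> left_lim X s \<omega> = left_lim X r \<omega>)"

lemma locally_constantD:
  assumes "locally_constant \<omega> r \<delta>"
  shows "r \<le> s \<Longrightarrow> s < r + \<delta> \<Longrightarrow> X s \<omega> = X r \<omega>"
    and "r < s \<Longrightarrow> s < r + \<delta> \<Longrightarrow> left_lim X s \<omega> = X r \<omega>"
    and "0 \<le> s \<Longrightarrow> r - \<delta> < s \<Longrightarrow> s < r \<Longrightarrow> X s \<omega> = left_lim X r \<omega>"
    and "0 \<le> s \<Longrightarrow> r - \<delta> < s \<Longrightarrow> s < r \<Longrightarrow> left_lim X s \<omega> = left_lim X r \<omega>"
  using assms unfolding locally_constant_def by blast+

text \<open>There are finitely many states, so convergence from either side means being eventually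
  constant.\<close>

lemma locally_constant_ex:
  assumes "0 \<le> x" "\<omega> \<in> space P" obtains \<delta> where "0 < \<delta>" "locally_constant \<omega> x \<delta>"
proof -
  have "eventually (\<lambda>s. X s \<omega> \<in> Basis) (at_right x)"
    unfolding eventually_at_right_field using assms states by (intro exI[of _ "x + 1"]) auto
  moreover have "((\<lambda>s. X s \<omega>) \<longlongrightarrow> X x \<omega>) (at_right x)"
    using right_continuous[OF assms] by (simp add: continuous_within)
  ultimately have "eventually (\<lambda>s. X s \<omega> = X x \<omega>) (at_right x)"
    using eventually_eq_limit_if_finite finite_Basis by blast
  then obtain b where b: "x < b" "\<And>s. x < s \<Longrightarrow> s < b \<Longrightarrow> X s \<omega> = X x \<omega>"
    by (auto simp: eventually_at_right_field)
  have r: "X s \<omega> = X x \<omega>" if "x \<le> s" "s < b" for s using b(2)[of s] that by (cases "s = x") auto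
  have r': "left_lim X s \<omega> = X x \<omega>" if "x < s" "s < b" for s
    by (rule left_lim_const[of _ x]) (use that assms b in auto)
  obtain \<delta> where \<delta>: "0 < \<delta>" "\<And>s. 0 \<le> s \<Longrightarrow> x - \<delta> < s \<Longrightarrow> s < x \<Longrightarrow> X s \<omega> = left_lim X x \<omega>"
  proof (cases "x = 0")
    case True then show ?thesis using that[of 1] by auto
  next
    case False
    with assms have "0 < x" by simp
    from left_limit_ex[OF this assms(2)] show ?thesis using that by metis
  qed
  have l': "left_lim X s \<omega> = left_lim X x \<omega>" if "0 \<le> s" "x - \<delta> < s" "s < x" for s
  proof (cases "s = 0")
    case True then show ?thesis using \<delta>(2)[of s] that by (simp add: left_lim_def)
  next
    case False
    then show ?thesis
      by (intro left_lim_const[of _ "max 0 (x - \<delta>)"] \<delta>) (use that in auto)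
  qed
  show ?thesis
  proof (rule that[of "min \<delta> (b - x)"])
    show "0 < min \<delta> (b - x)" using \<delta>(1) b(1) by simp
    show "locally_constant \<omega> x (min \<delta> (b - x))"
      unfolding locally_constant_def
    proof (intro conjI allI impI)
      fix s
      show "x \<le> s \<Longrightarrow> s < x + min \<delta> (b - x) \<Longrightarrow> X s \<omega> = X x \<omega>" by (rule r) simp_all
      show "x < s \<Longrightarrow> s < x + min \<delta> (b - x) \<Longrightarrow> left_lim X s \<omega> = X x \<omega>" by (rule r') simp_all
      show "0 \<le> s \<Longrightarrow> x - min \<delta> (b - x) < s \<Longrightarrow> s < x \<Longrightarrow> X s \<omega> = left_lim X x \<omega>"
        by (rule \<delta>(2)) simp_all
      show "0 \<le> s \<Longrightarrow> x - min \<delta> (b - x) < s \<Longrightarrow> s < x \<Longrightarrow> left_lim X s \<omega> = left_lim X x \<omega>"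
        by (rule l') simp_all
    qed
  qed
qed

lemma locally_constant_mono:
  assumes "locally_constant \<omega> r \<delta>" "\<delta>' \<le> \<delta>" shows "locally_constant \<omega> r \<delta>'"
  unfolding locally_constant_def
proof (intro conjI allI impI)
  fix s
  show "X s \<omega> = X r \<omega>" if "r \<le> s" "s < r + \<delta>'"
    by (rule locally_constantD(1)[OF assms(1)]) (use that assms(2) in linarith)+
  show "left_lim X s \<omega> = X r \<omega>" if "r < s" "s < r + \<delta>'"
    by (rule locally_constantD(2)[OF assms(1)]) (use that assms(2) in linarith)+
  show "X s \<omega> = left_lim X r \<omega>" if "0 \<le> s" "r - \<delta>' < s" "s < r"
    by (rule locally_constantD(3)[OF assms(1)]) (use that assms(2) in linarith)+
  show "left_lim X s \<omega> = left_lim X r \<omega>" if "0 \<le> s" "r - \<delta>' < s" "s < r"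
    by (rule locally_constantD(4)[OF assms(1)]) (use that assms(2) in linarith)+
qed

lemma left_lim_Basis:
  assumes "0 \<le> t" "\<omega> \<in> space P" shows "left_lim X t \<omega> \<in> Basis"
proof (cases "t = 0")
  case True then show ?thesis using states[of 0] assms by (simp add: left_lim_def)
next
  case False
  with assms have "0 < t" by simp
  then obtain \<delta> where "0 < \<delta>" "\<delta> \<le> t" "\<And>s. t - \<delta> < s \<Longrightarrow> s < t \<Longrightarrow> X s \<omega> = left_lim X t \<omega>"
    using left_limit_ex assms(2) by metis
  then show ?thesis using states[of "t - \<delta> / 2" \<omega>] assms by (simp add: field_simps)
qed

text \<open>Compactness by bisection: each time has a neighbourhood in which it is the only possible
  jump.\<close>

lemma finite_jumps:
  assumes "0 \<le> a" "\<omega> \<in> space P" shows "finite (jumps \<omega> a b)"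
proof (cases "a \<le> b")
  case True
  then have "0 \<le> a \<longrightarrow> finite (jumps \<omega> a b)"
  proof (induct rule: Bolzano)
    case (trans a b c)
    have "jumps \<omega> a c \<subseteq> jumps \<omega> a b \<union> jumps \<omega> b c" by (auto simp: jumps_def)
    then show ?case using trans by (auto intro: finite_subset)
  next
    case (local x)
    then have "0 \<le> x" using assms by simp
    from locally_constant_ex[OF this assms(2)] obtain \<delta> where \<delta>: "0 < \<delta>" "locally_constant \<omega> x \<delta>" .
    show ?case
    proof (intro exI[of _ \<delta>] conjI allI impI \<delta>(1))
      fix a b assume ab: "a \<le> x \<and> x \<le> b \<and> b - a < \<delta>" "0 \<le> a"
      have "jumps \<omega> a b \<subseteq> {x}"
      proof
        fix r assume r: "r \<in> jumps \<omega> a b"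
        show "r \<in> {x}"
          using r ab locally_constantD[OF \<delta>(2), of r]
          by (cases r x rule: linorder_cases) (simp_all add: jumps_def)
      qed
      then show "finite (jumps \<omega> a b)" by (rule finite_subset) simp
    qed
  qed
  then show ?thesis using assms by simp
next
  case False
  then have "{a<..b} = {}" by simp
  then show ?thesis by (simp add: jumps_def)
qed

end

section \<open>Measurability of vectors and continuity of indefinite integrals\<close>

lemma borel_measurable_vecI:
  fixes f :: "'b \<Rightarrow> real^'n"
  assumes "\<And>i. (\<lambda>x. f x $ i) \<in> borel_measurable M"
  shows "f \<in> borel_measurable M"
proof (subst borel_measurable_euclidean_space, intro ballI)
  fix b :: "real^'n" assume "b \<in> Basis"
  then obtain i where "b = axis i 1" by (auto simp: Basis_vec_real)
  then show "(\<lambda>x. f x \<bullet> b) \<in> borel_measurable M" using assms[of i] by (simp add: inner_axis)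
qed

lemma measurable_vec_nth':
  fixes f :: "'b \<Rightarrow> ('c::real_normed_vector)^'n"
  assumes "f \<in> borel_measurable M" shows "(\<lambda>x. f x $ i) \<in> borel_measurable M"
  using measurable_compose[OF assms
      borel_measurable_continuous_onI[OF linear_continuous_on[OF bounded_linear_vec_nth[of i]]]] .

lemma measurable_matrix_vector_mult [measurable (raw)]:
  fixes a :: "'b \<Rightarrow> real^'n^'m" and x :: "'b \<Rightarrow> real^'n"
  assumes "a \<in> borel_measurable M" "x \<in> borel_measurable M"
  shows "(\<lambda>z. a z *v x z) \<in> borel_measurable M"
proof (rule borel_measurable_vecI)
  fix i
  have "(\<lambda>z. a z $ i $ j) \<in> borel_measurable M" for j
    using assms(1) by (intro measurable_vec_nth')
  moreover have "(\<lambda>z. x z $ j) \<in> borel_measurable M" for j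
    using assms(2) by (intro measurable_vec_nth')
  ultimately show "(\<lambda>z. (a z *v x z) $ i) \<in> borel_measurable M"
    unfolding matrix_vector_mult_def vec_lambda_beta by (intro borel_measurable_sum borel_measurable_times)
qed

lemma set_integrable_bounded:
  fixes f :: "real \<Rightarrow> 'b::{banach, second_countable_topology}"
  assumes f: "f \<in> borel_measurable (restrict_space borel {a..b})"
    and B: "\<And>x. a \<le> x \<Longrightarrow> x \<le> b \<Longrightarrow> norm (f x) \<le> B"
  shows "set_integrable lborel {a..b} f"
  unfolding set_integrable_def
proof (rule integrableI_bounded_set[where A="{a..b}" and B=B])
  show "(\<lambda>x. indicator {a..b} x *\<^sub>R f x) \<in> borel_measurable lborel"
    using f by (simp add: borel_measurable_restrict_space_iff)
  show "emeasure lborel {a..b} < \<infinity>" by (simp add: emeasure_lborel_Icc_eq)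
qed (use B in \<open>auto simp: indicator_def\<close>)

lemma continuous_on_set_integral:
  fixes D :: "real \<Rightarrow> 'e::euclidean_space"
  assumes "set_integrable lborel {a..b} D"
  shows "continuous_on {a..b} (\<lambda>t. LINT u:{a..t}|lborel. D u)"
proof -
  have "D integrable_on {a..b}" using set_borel_integral_eq_integral(1)[OF assms] .
  from indefinite_integral_continuous_1[OF this]
  show ?thesis
  proof (rule continuous_on_eq)
    fix t assume "t \<in> {a..b}"
    then have "set_integrable lborel {a..t} D" by (intro set_integrable_subset[OF assms]) auto
    from set_borel_integral_eq_integral(2)[OF this]
    show "integral {a..t} D = (LINT u:{a..t}|lborel. D u)" by simp
  qed
qed

lemma set_integral_tendsto_left:
  fixes D :: "real \<Rightarrow> 'e::euclidean_space"
  assumes "a < t" "set_integrable lborel {a..t} D"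
  shows "((\<lambda>s. LINT u:{a..s}|lborel. D u) \<longlongrightarrow> (LINT u:{a..t}|lborel. D u)) (at_left t)"
proof -
  have "((\<lambda>s. LINT u:{a..s}|lborel. D u) \<longlongrightarrow> (LINT u:{a..t}|lborel. D u)) (at t within {a..t})"
    using continuous_on_set_integral[OF assms(2)] assms(1) by (auto simp: continuous_on_def)
  moreover have "at t within {a..t} = at_left t" using assms(1) by (rule at_within_Icc_at_left)
  ultimately show ?thesis by simp
qed

section \<open>Drift, jumps of the martingale and equations along a path\<close>

context markov_chain
begin

lemma no_jumps_const:
  assumes "0 \<le> a" "\<omega> \<in> space P" "a \<le> b" "jumps \<omega> a b = {}" shows "X b \<omega> = X a \<omega>"
proof -
  define Q where "Q = (\<lambda>a b. 0 \<le> a \<longrightarrow> jumps \<omega> a b = {} \<longrightarrow> X b \<omega> = X a \<omega>)"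
  have "Q a b" using assms(3)
  proof (induct rule: Bolzano)
    case (trans a b c)
    have "jumps \<omega> a b \<subseteq> jumps \<omega> a c" "jumps \<omega> b c \<subseteq> jumps \<omega> a c"
      using trans(3,4) by (intro jumps_mono; simp)+
    then have sub: "jumps \<omega> a b = {}" "jumps \<omega> b c = {}" if "jumps \<omega> a c = {}"
      using that by auto
    show ?case unfolding Q_def
    proof (intro impI)
      assume h: "0 \<le> a" "jumps \<omega> a c = {}"
      have "X c \<omega> = X b \<omega>"
        by (rule trans(2)[unfolded Q_def, THEN mp, THEN mp]) (use h trans(3) sub in auto)
      also have "\<dots> = X a \<omega>"
        by (rule trans(1)[unfolded Q_def, THEN mp, THEN mp]) (use h sub in auto)
      finally show "X c \<omega> = X a \<omega>" .
    qed
  next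
    case (local x)
    then have "0 \<le> x" using assms by simp
    from locally_constant_ex[OF this assms(2)] obtain \<delta> where \<delta>: "0 < \<delta>" "locally_constant \<omega> x \<delta>" .
    show ?case unfolding Q_def
    proof (intro exI[of _ \<delta>] conjI allI impI \<delta>(1))
      fix a b assume ab: "a \<le> x \<and> x \<le> b \<and> b - a < \<delta>" "0 \<le> a" "jumps \<omega> a b = {}"
      have "X b \<omega> = X x \<omega>" using ab by (intro locally_constantD(1)[OF \<delta>(2)]) simp_all
      moreover have "X x \<omega> = X a \<omega>"
      proof (cases "a = x")
        \<comment> \<open>The state before \<open>x\<close> carries over to \<open>x\<close> because
          \<open>x\<close> itself is not a jump.\<close>
        case False
        then have "x \<in> {a<..b}" using ab by auto
        then have "X x \<omega> = left_lim X x \<omega>" using ab(3) by (auto simp: jumps_def)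
        then show ?thesis using locally_constantD(3)[OF \<delta>(2), of a] ab False by simp
      qed simp
      ultimately show "X b \<omega> = X a \<omega>" by simp
    qed
  qed
  then show ?thesis using assms by (simp add: Q_def)
qed

lemma countable_all_jumps:
  assumes "\<omega> \<in> space P" shows "countable {r. 0 \<le> r \<and> X r \<omega> \<noteq> left_lim X r \<omega>}"
proof (rule countable_subset)
  show "{r. 0 \<le> r \<and> X r \<omega> \<noteq> left_lim X r \<omega>} \<subseteq> (\<Union>n. jumps \<omega> 0 (real n))"
  proof
    fix r assume r: "r \<in> {r. 0 \<le> r \<and> X r \<omega> \<noteq> left_lim X r \<omega>}"
    obtain n where "r \<le> real n" using real_arch_simple by blast
    moreover have "r \<noteq> 0" using r by (auto simp: left_lim_def)
    ultimately have "r \<in> jumps \<omega> 0 (real n)" using r by (simp add: jumps_def)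
    then show "r \<in> (\<Union>n. jumps \<omega> 0 (real n))" by blast
  qed
  show "countable (\<Union>n. jumps \<omega> 0 (real n))"
    by (rule countable_UN) (simp_all add: countable_finite finite_jumps assms)
qed

lemma AE_no_jump:
  assumes "\<omega> \<in> space P" shows "AE r in lborel. 0 \<le> r \<longrightarrow> left_lim X r \<omega> = X r \<omega>"
  using AE_not_in[OF countable_imp_null_set_lborel[OF countable_all_jumps[OF assms]]]
  by eventually_elim auto

lemma rates_bounded:
  obtains C where "0 \<le> C" "\<forall>t\<ge>0. \<forall>i j. \<bar>A t $ i $ j\<bar> \<le> C"
proof -
  obtain C where C: "\<forall>t\<ge>0. \<forall>i j. \<bar>A t $ i $ j\<bar> \<le> C" using rates by (auto simp: rate_matrix_def)
  then have "\<bar>A 0 $ undefined $ undefined\<bar> \<le> C" by simp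
  then have "0 \<le> C" by linarith
  then show ?thesis using C by (rule that)
qed

lemma measurable_rates: "A \<in> borel_measurable (restrict_space borel {0..})"
  using rates by (simp add: rate_matrix_def)

lemma measurable_rates_on: "S \<subseteq> {0..} \<Longrightarrow> A \<in> borel_measurable (restrict_space borel S)"
  by (rule measurable_restrict_mono[OF measurable_rates])

lemma measurable_left_lim_X_path:
  assumes "\<omega> \<in> space P" "0 \<le> T"
  shows "(\<lambda>t. left_lim X t \<omega>) \<in> borel_measurable (restrict_space borel {0..T})"
  by (rule measurable_left_lim_path[OF assms(2)]) (use left_limits assms in blast)

lemma norm_rates_Basis:
  assumes "\<And>t i j. 0 \<le> t \<Longrightarrow> \<bar>A t $ i $ j\<bar> \<le> C" "0 \<le> t" "x \<in> Basis"
  shows "norm (A t *v x) \<le> real CARD('n) * C"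
proof -
  obtain i where x: "x = axis i 1" using assms(3) by (auto simp: Basis_vec_real)
  have "norm (A t *v x) \<le> (\<Sum>k\<in>UNIV. \<bar>(A t *v x) $ k\<bar>)" by (rule norm_le_l1_cart)
  also have "\<dots> \<le> (\<Sum>k\<in>(UNIV::'n set). C)"
    using assms by (intro sum_mono) (simp add: x matrix_vector_mult_basis column_def)
  finally show ?thesis by simp
qed

lemma drift_integrable:
  assumes "\<omega> \<in> space P"
  shows "set_integrable lborel {0..t} (\<lambda>u. A u *v left_lim X u \<omega>)"
proof (cases "0 \<le> t")
  case True
  obtain C where "0 \<le> C" "\<forall>t\<ge>0. \<forall>i j. \<bar>A t $ i $ j\<bar> \<le> C" by (rule rates_bounded)
  note C = this[rule_format]
  show ?thesis
  proof (rule set_integrable_bounded)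
    show "(\<lambda>u. A u *v left_lim X u \<omega>) \<in> borel_measurable (restrict_space borel {0..t})"
      by (intro measurable_matrix_vector_mult measurable_rates_on measurable_left_lim_X_path assms True) simp
    fix u assume "0 \<le> u" "u \<le> t"
    then show "norm (A u *v left_lim X u \<omega>) \<le> real CARD('n) * C"
      by (intro norm_rates_Basis C left_lim_Basis assms)
  qed
qed (simp add: set_integrable_def)

text \<open>The drift integral is continuous in its upper limit, so \<open>M\<close> inherits
  exactly the jumps of \<open>X\<close>.\<close>

lemma M_mart_jump:
  assumes "0 < t" "\<omega> \<in> space P"
  shows "M_mart X A t \<omega> - left_lim (M_mart X A) t \<omega> = X t \<omega> - left_lim X t \<omega>"
proof -
  obtain l where l: "((\<lambda>s. X s \<omega>) \<longlongrightarrow> l) (at_left t)" using left_limits assms by blast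
  have eq: "left_lim X t \<omega> = l" by (rule left_lim_eqI[of t X \<omega> l, OF assms(1) l])
  have "((\<lambda>s. M_mart X A s \<omega>) \<longlongrightarrow> l - X 0 \<omega> - (LINT u:{0..t}|lborel. A u *v left_lim X u \<omega>)) (at_left t)"
    unfolding M_mart_def
    by (intro tendsto_diff l tendsto_const set_integral_tendsto_left drift_integrable assms)
  from left_lim_eqI[of t "M_mart X A" \<omega>, OF assms(1) this] eq show ?thesis
    by (simp add: M_mart_def)
qed

lemma M_integral_eq:
  assumes "\<omega> \<in> space P"
  shows "M_integral X A Z t \<omega> = (\<Sum>s\<in>jumps \<omega> 0 t. Z s \<omega> \<bullet> (X s \<omega> - left_lim X s \<omega>))
    - (LINT u:{0..t}|lborel. Z u \<omega> \<bullet> (A u *v left_lim X u \<omega>))"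
proof -
  have "{s \<in> {0<..t}. M_mart X A s \<omega> \<noteq> left_lim (M_mart X A) s \<omega>} = jumps \<omega> 0 t"
  proof -
    have "M_mart X A s \<omega> \<noteq> left_lim (M_mart X A) s \<omega> \<longleftrightarrow> X s \<omega> \<noteq> left_lim X s \<omega>" if "0 < s" for s
      using M_mart_jump[OF that assms] by (metis right_minus_eq)
    then show ?thesis unfolding jumps_def by (intro Collect_cong) auto
  qed
  moreover have "(\<Sum>s\<in>jumps \<omega> 0 t. Z s \<omega> \<bullet> (M_mart X A s \<omega> - left_lim (M_mart X A) s \<omega>))
    = (\<Sum>s\<in>jumps \<omega> 0 t. Z s \<omega> \<bullet> (X s \<omega> - left_lim X s \<omega>))"
    by (rule sum.cong) (auto simp: jumps_def M_mart_jump[OF _ assms])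
  ultimately show ?thesis by (simp add: M_integral_def)
qed

text \<open>The integrand is a bare path, so that \<open>Z\<close> at a sample point and the
  deterministic \<open>\<zeta>\<close> can be inserted alike.\<close>

definition jump_sum :: "'a \<Rightarrow> (real \<Rightarrow> real^'n) \<Rightarrow> real \<Rightarrow> real \<Rightarrow> real" where
  "jump_sum \<omega> z a b = (\<Sum>s\<in>jumps \<omega> a b. z s \<bullet> (X s \<omega> - left_lim X s \<omega>))"

lemma jump_sum_split:
  assumes "0 \<le> a" "a \<le> b" "b \<le> c" "\<omega> \<in> space P"
  shows "jump_sum \<omega> z a c = jump_sum \<omega> z a b + jump_sum \<omega> z b c"
proof -
  have "{a<..c} = {a<..b} \<union> {b<..c}" using assms by (simp add: ivl_disj_un_two)
  then have "jumps \<omega> a c = jumps \<omega> a b \<union> jumps \<omega> b c" by (auto simp: jumps_def)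
  moreover have "jumps \<omega> a b \<inter> jumps \<omega> b c = {}" by (auto simp: jumps_def)
  ultimately show ?thesis
    unfolding jump_sum_def using assms by (simp add: sum.union_disjoint finite_jumps)
qed

lemma jump_sum_tendsto_left:
  assumes "0 < t" "\<omega> \<in> space P"
  shows "((\<lambda>s. jump_sum \<omega> z 0 s) \<longlongrightarrow> jump_sum \<omega> z 0 t - z t \<bullet> (X t \<omega> - left_lim X t \<omega>)) (at_left t)"
proof (rule tendsto_eventually)
  from locally_constant_ex[OF less_imp_le[OF assms(1)] assms(2)]
  obtain \<delta> where \<delta>: "0 < \<delta>" "locally_constant \<omega> t \<delta>" .
  have "jump_sum \<omega> z 0 s = jump_sum \<omega> z 0 t - z t \<bullet> (X t \<omega> - left_lim X t \<omega>)"
    if s: "max 0 (t - \<delta>) < s" "s < t" for s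
  proof -
    have "jumps \<omega> s t \<subseteq> {t}"
    proof
      fix r assume r: "r \<in> jumps \<omega> s t"
      then have "s < r" "r \<le> t" "X r \<omega> \<noteq> left_lim X r \<omega>" by (simp_all add: jumps_def)
      then show "r \<in> {t}" using s locally_constantD(3,4)[OF \<delta>(2), of r] by (cases "r = t") simp_all
    qed
    \<comment> \<open>If \<open>t\<close> is not a jump, its term is zero, so the sum may run over
      \<open>{t}\<close> in any case.\<close>
    then have "jump_sum \<omega> z s t = (\<Sum>r\<in>{t}. z r \<bullet> (X r \<omega> - left_lim X r \<omega>))"
      unfolding jump_sum_def using s
      by (intro sum.mono_neutral_left) (auto simp: jumps_def)
    then show ?thesis using jump_sum_split[of 0 s t \<omega> z] s assms by simp
  qed
  then show "eventually (\<lambda>s. jump_sum \<omega> z 0 s = jump_sum \<omega> z 0 t - z t \<bullet> (X t \<omega> - left_lim X t \<omega>)) (at_left t)"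
    unfolding eventually_at_left_field using assms \<delta>(1)
    by (intro exI[of _ "max 0 (t - \<delta>)"]) simp
qed

text \<open>Left limits of a solution are obtained from its equation: the integral is continuous,
  and close to the left of \<open>t\<close> the jump sum lacks only the term at
  \<open>t\<close>.\<close>

lemma path_equation_tendsto_left:
  fixes y D :: "real \<Rightarrow> real"
  assumes "0 < t" "\<omega> \<in> space P" "set_integrable lborel {0..t} D"
    and y: "\<And>s. 0 \<le> s \<Longrightarrow> s \<le> t \<Longrightarrow> y s = y 0 + (LINT u:{0..s}|lborel. D u) + jump_sum \<omega> z 0 s"
  shows "(y \<longlongrightarrow> y t - z t \<bullet> (X t \<omega> - left_lim X t \<omega>)) (at_left t)"
proof -
  have "((\<lambda>s. y 0 + (LINT u:{0..s}|lborel. D u) + jump_sum \<omega> z 0 s) \<longlongrightarrow>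
    y 0 + (LINT u:{0..t}|lborel. D u) + (jump_sum \<omega> z 0 t - z t \<bullet> (X t \<omega> - left_lim X t \<omega>))) (at_left t)"
    by (intro tendsto_add tendsto_const set_integral_tendsto_left jump_sum_tendsto_left assms)
  moreover have "eventually (\<lambda>s. y 0 + (LINT u:{0..s}|lborel. D u) + jump_sum \<omega> z 0 s = y s) (at_left t)"
    unfolding eventually_at_left_field
    by (intro exI[of _ 0] conjI allI impI y[symmetric] assms(1)) simp_all
  ultimately have "(y \<longlongrightarrow> y 0 + (LINT u:{0..t}|lborel. D u) + (jump_sum \<omega> z 0 t - z t \<bullet> (X t \<omega> - left_lim X t \<omega>))) (at_left t)"
    by (rule Lim_transform_eventually)
  moreover have "y 0 + (LINT u:{0..t}|lborel. D u) + (jump_sum \<omega> z 0 t - z t \<bullet> (X t \<omega> - left_lim X t \<omega>))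
    = y t - z t \<bullet> (X t \<omega> - left_lim X t \<omega>)"
    unfolding y[OF less_imp_le[OF assms(1)] order_refl] by simp
  ultimately show ?thesis by simp
qed

lemma path_equation_increment:
  fixes y D :: "real \<Rightarrow> real"
  assumes "0 \<le> s" "s \<le> t" "\<omega> \<in> space P" "set_integrable lborel {0..t} D"
    and y: "\<And>s. 0 \<le> s \<Longrightarrow> s \<le> t \<Longrightarrow> y s = y 0 + (LINT u:{0..s}|lborel. D u) + jump_sum \<omega> z 0 s"
  shows "y t - y s = (LINT u:{s..t}|lborel. D u) + jump_sum \<omega> z s t"
proof -
  have "y s = y 0 + (LINT u:{0..s}|lborel. D u) + jump_sum \<omega> z 0 s"
    "y t = y 0 + (LINT u:{0..t}|lborel. D u) + jump_sum \<omega> z 0 t"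
    using assms(1,2) by (intro y; simp)+
  then show ?thesis
    using set_integral_split[of 0 s t D] jump_sum_split[of 0 s t \<omega> z] assms(1-4) by linarith
qed


section \<open>The forward equation\<close>

abbreviation "F \<equiv> completed_filtration P X"
abbreviation "Q \<equiv> completion P"

sublocale Q: prob_space Q
  by (rule prob_space_completion)

lemma F_generators:
  "(\<Union>s\<in>{0..t}. {X s -` B \<inter> space P | B. B \<in> sets borel}) \<union> null_sets Q \<subseteq> sets Q"
proof -
  have "X s -` B \<inter> space P \<in> sets Q" if "0 \<le> s" "B \<in> sets borel" for s B
    using measurable_sets[OF measurable_completion[OF measurable[OF that(1)]] that(2)] by simp
  then show ?thesis by auto
qed

lemma F_generators_Pow:
  "(\<Union>s\<in>{0..t}. {X s -` B \<inter> space P | B. B \<in> sets borel}) \<union> null_sets Q \<subseteq> Pow (space P)"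
  using F_generators[of t] sets.sets_into_space[of _ Q] by fastforce

lemma space_F [simp]: "space (F t) = space P"
  unfolding completed_filtration_def by (rule space_measure_of[OF F_generators_Pow])

lemma sets_F: "sets (F t) = sigma_sets (space P)
  ((\<Union>s\<in>{0..t}. {X s -` B \<inter> space P | B. B \<in> sets borel}) \<union> null_sets Q)"
  unfolding completed_filtration_def by (rule sets_measure_of[OF F_generators_Pow])

lemma F_mono: "s \<le> t \<Longrightarrow> sets (F s) \<subseteq> sets (F t)"
  unfolding sets_F by (rule sigma_sets_mono') fastforce

lemma F_subset_Q: "sets (F t) \<subseteq> sets Q"
  unfolding sets_F using F_generators sets.sigma_sets_subset[of _ Q] by simp

lemma subalgebra_F: "subalgebra Q (F t)"
  by (simp add: subalgebra_def F_subset_Q)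

lemma measurable_X_F: "0 \<le> s \<Longrightarrow> s \<le> t \<Longrightarrow> X s \<in> borel_measurable (F t)"
proof (rule measurableI)
  fix B :: "(real^'n) set" assume "0 \<le> s" "s \<le> t" "B \<in> sets borel"
  then show "X s -` B \<inter> space (F t) \<in> sets (F t)"
    unfolding sets_F space_F by (intro sigma_sets.Basic) auto
qed simp

lemma measurable_X_Q: "0 \<le> s \<Longrightarrow> X s \<in> borel_measurable Q"
  by (rule measurable_completion[OF measurable])

section \<open>Masses of past events in the states and their evolution\<close>

definition at_state :: "real \<Rightarrow> 'n \<Rightarrow> 'a set" where
  "at_state t i = {\<omega> \<in> space P. X t \<omega> = axis i 1}"

lemma at_state_F: "0 \<le> s \<Longrightarrow> s \<le> t \<Longrightarrow> at_state s i \<in> sets (F t)"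
  using measurable_sets[OF measurable_X_F, of s t "{axis i 1}"]
  by (simp add: at_state_def vimage_def Int_def conj_commute)

lemma at_state_Q: "0 \<le> s \<Longrightarrow> at_state s i \<in> sets Q"
  using at_state_F[of s s i] F_subset_Q[of s] by auto

lemma X_nth: "0 \<le> t \<Longrightarrow> \<omega> \<in> space P \<Longrightarrow> X t \<omega> $ i = indicator (at_state t i) \<omega>"
proof -
  assume *: "0 \<le> t" "\<omega> \<in> space P"
  then obtain k where k: "X t \<omega> = axis k 1" using states by (auto simp: Basis_vec_real)
  show ?thesis using * by (auto simp: k at_state_def indicator_def axis_def vec_eq_iff)
qed

text \<open>The law of \<open>X t\<close> restricted to the event \<open>B\<close>. Fixing an event
  of the past turns conditional probabilities into a deterministic curve.\<close>

definition mass :: "'a set \<Rightarrow> real \<Rightarrow> real^'n" where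
  "mass B t = (\<chi> i. measure Q (B \<inter> at_state t i))"

lemma mass_eq_integral:
  assumes "B \<in> sets Q" "0 \<le> t"
  shows "mass B t $ i = (LINT \<omega>:B|Q. X t \<omega> $ i)"
proof -
  have "(LINT \<omega>:B|Q. X t \<omega> $ i) = (LINT \<omega>|Q. indicator (B \<inter> at_state t i) \<omega>)"
    unfolding set_lebesgue_integral_def
    by (rule Bochner_Integration.integral_cong) (auto simp: X_nth assms indicator_def)
  also have "\<dots> = measure Q (B \<inter> at_state t i \<inter> space Q)"
    by (rule Bochner_Integration.integral_indicator[THEN trans])
      (use assms at_state_Q[OF assms(2), of i] in \<open>auto\<close>)
  also have "B \<inter> at_state t i \<inter> space Q = B \<inter> at_state t i" by (auto simp: at_state_def)
  finally show ?thesis by (simp add: mass_def)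
qed

lemma mass_bounds: "B \<in> sets Q \<Longrightarrow> 0 \<le> mass B t $ i \<and> mass B t $ i \<le> measure Q B"
  by (auto simp: mass_def intro!: Q.finite_measure_mono)

lemma X_nth_integrable: "0 \<le> t \<Longrightarrow> integrable Q (\<lambda>\<omega>. X t \<omega> $ i)"
  by (rule Q.integrable_const_bound[where B=1])
    (auto simp: X_nth indicator_def measurable_vec_nth' measurable_X_Q)

text \<open>The conditional probabilities enter only through this forward equation, tested on events of the past.\<close>

lemma mass_forward_equation:
  assumes B: "B \<in> sets (F s)" and st: "0 \<le> s" "s \<le> t"
  shows "set_integrable lborel {s..t} (\<lambda>u. A u *v mass B u)"
    and "mass B t = mass B s + (LINT u:{s..t}|lborel. A u *v mass B u)"
proof -
  obtain p where p: "transition_matrices A p"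
    and ce: "\<forall>s t i. 0 \<le> s \<and> s \<le> t \<longrightarrow> (AE \<omega> in Q.
      real_cond_exp Q (F s) (\<lambda>\<omega>. X t \<omega> $ i) \<omega> = (p s t *v X s \<omega>) $ i)"
    using markov by blast
  have BQ: "B \<in> sets Q" using B F_subset_Q by auto
  interpret S: sigma_finite_subalgebra Q "F s"
    by (intro finite_measure_subalgebra_is_sigma_finite finite_measure_subalgebra.intro
        finite_measure_subalgebra_axioms.intro subalgebra_F Q.finite_measure_axioms)
  \<comment> \<open>Integrating the conditional expectation over \<open>B\<close> moves the
    transition matrix outside, since \<open>p s u\<close> is deterministic.\<close>
  have mp: "mass B u = p s u *v mass B s" if u: "s \<le> u" for u
  proof (subst vec_eq_iff, rule allI)
    fix i
    have "0 \<le> u" using u st by simp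
    have "mass B u $ i = (LINT \<omega>:B|Q. X u \<omega> $ i)"
      by (rule mass_eq_integral[OF BQ \<open>0 \<le> u\<close>])
    also have "\<dots> = (LINT \<omega>:B|Q. real_cond_exp Q (F s) (\<lambda>\<omega>. X u \<omega> $ i) \<omega>)"
      by (rule S.real_cond_exp_intA[OF X_nth_integrable[OF \<open>0 \<le> u\<close>] B])
    also have "\<dots> = (LINT \<omega>:B|Q. \<Sum>j\<in>UNIV. p s u $ i $ j * X s \<omega> $ j)"
      unfolding set_lebesgue_integral_def
    proof (rule integral_cong_AE)
      show "(\<lambda>\<omega>. indicator B \<omega> *\<^sub>R real_cond_exp Q (F s) (\<lambda>\<omega>. X u \<omega> $ i) \<omega>) \<in> borel_measurable Q"
        using BQ by measurable
      have "(\<lambda>\<omega>. X s \<omega> $ j) \<in> borel_measurable Q" for j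
        by (intro measurable_vec_nth' measurable_X_Q st)
      then show "(\<lambda>\<omega>. indicator B \<omega> *\<^sub>R (\<Sum>j\<in>UNIV. p s u $ i $ j * X s \<omega> $ j)) \<in> borel_measurable Q"
        using BQ by measurable
      have "AE \<omega> in Q. real_cond_exp Q (F s) (\<lambda>\<omega>. X u \<omega> $ i) \<omega> = (p s u *v X s \<omega>) $ i"
        using ce st u by blast
      then show "AE \<omega> in Q. indicator B \<omega> *\<^sub>R real_cond_exp Q (F s) (\<lambda>\<omega>. X u \<omega> $ i) \<omega> =
          indicator B \<omega> *\<^sub>R (\<Sum>j\<in>UNIV. p s u $ i $ j * X s \<omega> $ j)"
        by eventually_elim (simp add: matrix_vector_mult_def)
    qed
    also have "\<dots> = (\<Sum>j\<in>UNIV. LINT \<omega>:B|Q. p s u $ i $ j * X s \<omega> $ j)"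
      unfolding set_lebesgue_integral_def scaleR_sum_right
      by (rule Bochner_Integration.integral_sum)
        (intro integrable_mult_indicator BQ integrable_mult_right X_nth_integrable st)
    also have "\<dots> = (\<Sum>j\<in>UNIV. p s u $ i $ j * mass B s $ j)"
      by (simp add: mass_eq_integral[OF BQ st(1)])
    finally show "mass B u $ i = (p s u *v mass B s) $ i"
      by (simp add: matrix_vector_mult_def)
  qed
  have pi: "set_integrable lborel {s..t} (\<lambda>u. A u ** p s u)"
    and pe: "p s t = mat 1 + (LINT u:{s..t}|lborel. A u ** p s u)"
    using p st unfolding transition_matrices_def by blast+
  \<comment> \<open>Applying this fixed linear map to the integral equation of the matrices yields
    that of the masses.\<close>
  have bl: "bounded_linear (\<lambda>M :: real^'n^'n. M *v mass B s)"
    by (intro linear_conv_bounded_linear[THEN iffD1] linearI)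
      (simp_all add: matrix_vector_mult_add_rdistrib scaleR_matrix_vector_assoc)
  have eq: "indicator {s..t} u *\<^sub>R (A u *v mass B u) = (indicator {s..t} u *\<^sub>R (A u ** p s u)) *v mass B s" for u
  proof (cases "u \<in> {s..t}")
    case True
    then have "mass B u = p s u *v mass B s" by (intro mp) simp
    then show ?thesis using True by (simp only: indicator_simps scaleR_one matrix_vector_mul_assoc)
  qed simp
  show "set_integrable lborel {s..t} (\<lambda>u. A u *v mass B u)"
    unfolding set_integrable_def eq
    by (rule integrable_bounded_linear[OF bl pi[unfolded set_integrable_def]])
  have "(LINT u:{s..t}|lborel. A u *v mass B u) = (LINT u:{s..t}|lborel. A u ** p s u) *v mass B s"
    unfolding set_lebesgue_integral_def eq
    by (rule integral_bounded_linear[OF bl pi[unfolded set_integrable_def]])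
  then show "mass B t = mass B s + (LINT u:{s..t}|lborel. A u *v mass B u)"
    by (subst mp[OF st(2)], subst pe) (simp add: matrix_vector_mult_add_rdistrib)
qed

lemma mass_forward_equation_nth:
  assumes B: "B \<in> sets (F s)" and st: "0 \<le> s" "s \<le> t"
  shows "set_integrable lborel {s..t} (\<lambda>u. \<Sum>k\<in>UNIV. A u $ i $ k * mass B u $ k)"
    and "mass B t $ i = mass B s $ i + (LINT u:{s..t}|lborel. \<Sum>k\<in>UNIV. A u $ i $ k * mass B u $ k)"
proof -
  note m = mass_forward_equation[OF B st]
  have eq: "indicator {s..t} u *\<^sub>R (\<Sum>k\<in>UNIV. A u $ i $ k * mass B u $ k) = (indicator {s..t} u *\<^sub>R (A u *v mass B u)) $ i" for u
    by (simp add: matrix_vector_mult_def)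
  show "set_integrable lborel {s..t} (\<lambda>u. \<Sum>k\<in>UNIV. A u $ i $ k * mass B u $ k)"
    unfolding set_integrable_def eq
    by (rule integrable_bounded_linear[OF bounded_linear_vec_nth m(1)[unfolded set_integrable_def]])
  have "(LINT u:{s..t}|lborel. \<Sum>k\<in>UNIV. A u $ i $ k * mass B u $ k) = (LINT u:{s..t}|lborel. A u *v mass B u) $ i"
    unfolding set_lebesgue_integral_def eq
    by (rule integral_bounded_linear[OF bounded_linear_vec_nth m(1)[unfolded set_integrable_def]])
  then show "mass B t $ i = mass B s $ i + (LINT u:{s..t}|lborel. \<Sum>k\<in>UNIV. A u $ i $ k * mass B u $ k)"
    using arg_cong[OF m(2), of "\<lambda>v. v $ i"] by simp
qed

lemma set_integral_abs_le:
  fixes f :: "real \<Rightarrow> real"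
  assumes "s \<le> t" "set_integrable lborel {s..t} f" "\<And>u. s \<le> u \<Longrightarrow> u \<le> t \<Longrightarrow> \<bar>f u\<bar> \<le> K"
  shows "\<bar>LINT u:{s..t}|lborel. f u\<bar> \<le> K * (t - s)"
proof -
  have "\<bar>LINT u:{s..t}|lborel. f u\<bar> \<le> (LINT u:{s..t}|lborel. \<bar>f u\<bar>)"
    using set_integral_norm_bound[OF assms(2)] by simp
  also have "\<dots> \<le> (LINT u:{s..t}|lborel. K)"
  proof (rule set_integral_mono)
    show "set_integrable lborel {s..t} (\<lambda>u. \<bar>f u\<bar>)" by (rule set_integrable_abs[OF assms(2)])
    show "set_integrable lborel {s..t} (\<lambda>u. K)" by (rule set_integrable_bounded[of _ _ _ "\<bar>K\<bar>"]) simp_all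
  qed (use assms(3) in simp)
  also have "\<dots> = K * (t - s)" using assms(1) by (simp add: set_lebesgue_integral_def mult.commute)
  finally show ?thesis .
qed

text \<open>The rate of change of a mass is a sum of \<open>CARD('n)\<close> products of a rate, at
  most \<open>C\<close>, with a mass, at most the probability of \<open>B\<close>.\<close>

lemma mass_lipschitz:
  assumes C: "\<And>t i j. 0 \<le> t \<Longrightarrow> \<bar>A t $ i $ j\<bar> \<le> C"
    and B: "B \<in> sets (F s)" and st: "0 \<le> s" "s \<le> t"
  shows "\<bar>mass B t $ i - mass B s $ i\<bar> \<le> real CARD('n) * C * measure Q B * (t - s)"
proof -
  note m = mass_forward_equation_nth[OF B st, of i]
  have BQ: "B \<in> sets Q" using B F_subset_Q by auto
  have "\<bar>LINT u:{s..t}|lborel. \<Sum>k\<in>UNIV. A u $ i $ k * mass B u $ k\<bar> \<le> real CARD('n) * C * measure Q B * (t - s)"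
  proof (rule set_integral_abs_le[OF st(2) m(1)])
    fix u assume "s \<le> u" "u \<le> t"
    then have u: "0 \<le> u" using st by simp
    have "\<bar>\<Sum>k\<in>UNIV. A u $ i $ k * mass B u $ k\<bar> \<le> (\<Sum>k\<in>(UNIV::'n set). C * measure Q B)"
      by (rule order_trans[OF sum_abs sum_mono], unfold abs_mult)
        (intro mult_mono C u; use mass_bounds[OF BQ] in \<open>auto simp: order_trans[OF abs_ge_zero C[OF u]]\<close>)
    then show "\<bar>\<Sum>k\<in>UNIV. A u $ i $ k * mass B u $ k\<bar> \<le> real CARD('n) * C * measure Q B" by simp
  qed
  then show ?thesis using m(2) by simp
qed

text \<open>The mass is Lipschitz in time, hence measurable, and the product is bounded by
  \<open>C\<close> times the probability of \<open>B\<close>.\<close>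

lemma mass_rate_integrable:
  assumes C: "\<And>t i j. 0 \<le> t \<Longrightarrow> \<bar>A t $ i $ j\<bar> \<le> C"
    and B: "B \<in> sets (F s)" and st: "0 \<le> s"
  shows "set_integrable lborel {s..t} (\<lambda>u. A u $ i $ j * mass B u $ j)"
proof (rule set_integrable_bounded[where B="C * measure Q B"])
  have BQ: "B \<in> sets Q" using B F_subset_Q by auto
  have L: "\<bar>mass B v $ j - mass B u $ j\<bar> \<le> real CARD('n) * C * measure Q B * (v - u)" if "s \<le> u" "u \<le> v" for u v
    by (rule mass_lipschitz[OF C _ _ that(2)]) (use B F_mono[OF that(1)] st that in auto)
  have "continuous_on {s..t} (\<lambda>u. mass B u $ j)"
  proof (rule lipschitz_on_continuous_on[OF lipschitz_onI])
    show "0 \<le> real CARD('n) * C * measure Q B"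
      using order_trans[OF abs_ge_zero C[of 0]] by (intro mult_nonneg_nonneg) simp_all
    fix u v assume uv: "u \<in> {s..t}" "v \<in> {s..t}"
    show "dist (mass B u $ j) (mass B v $ j) \<le> real CARD('n) * C * measure Q B * dist u v"
    proof (cases "u \<le> v")
      case True
      then show ?thesis using L[of u v] uv by (simp add: dist_real_def abs_minus_commute)
    next
      case False
      then show ?thesis using L[of v u] uv by (simp add: dist_real_def)
    qed
  qed
  then have "(\<lambda>u. mass B u $ j) \<in> borel_measurable (restrict_space borel {s..t})"
    by (rule borel_measurable_continuous_on_restrict)
  moreover have "(\<lambda>u. A u $ i $ j) \<in> borel_measurable (restrict_space borel {s..t})"
    by (intro measurable_vec_nth' measurable_rates_on) (use st in auto)
  ultimately show "(\<lambda>u. A u $ i $ j * mass B u $ j) \<in> borel_measurable (restrict_space borel {s..t})"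
    by (rule borel_measurable_times[rotated])
  fix u assume "s \<le> u" "u \<le> t"
  then have u: "0 \<le> u" using st by simp
  show "norm (A u $ i $ j * mass B u $ j) \<le> C * measure Q B"
    unfolding real_norm_def abs_mult
    by (intro mult_mono C u; use mass_bounds[OF BQ] in \<open>auto simp: order_trans[OF abs_ge_zero C[OF u]]\<close>)
qed

text \<open>The local estimate that identifies the intensity of jumps from \<open>j\<close> to \<open>i\<close>; the error is of second
  order and hence disappears after summation over a grid.\<close>

lemma jump_probability_estimate:
  assumes C: "\<And>t i j. 0 \<le> t \<Longrightarrow> \<bar>A t $ i $ j\<bar> \<le> C"
    and B: "B \<in> sets (F s)" and st: "0 \<le> s" "s \<le> t" and ij: "i \<noteq> j"
  shows "\<bar>measure Q (B \<inter> at_state s j \<inter> at_state t i) - (LINT u:{s..t}|lborel. A u $ i $ j * mass B u $ j)\<bar>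
    \<le> 2 * (real CARD('n) * C)\<^sup>2 * (t - s)\<^sup>2"
proof -
  define n where "n = real CARD('n)"
  have n1: "1 \<le> n" unfolding n_def by (simp add: Suc_leI)
  have C0: "0 \<le> C" using order_trans[OF abs_ge_zero C[of 0]] by simp
  \<comment> \<open>Fixing the starting state: at time \<open>s\<close> the mass of \<open>E\<close>
    sits entirely in state \<open>j\<close>, where it equals that of \<open>B\<close>.\<close>
  define E where "E = B \<inter> at_state s j"
  have E: "E \<in> sets (F s)" unfolding E_def by (intro sets.Int B at_state_F st order_refl)
  have EQ: "E \<in> sets Q" and BQ: "B \<in> sets Q" using E B F_subset_Q by auto
  define \<beta> where "\<beta> = measure Q E"
  have \<beta>: "0 \<le> \<beta>" "\<beta> \<le> 1" by (simp_all add: \<beta>_def)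
  have Es: "mass E s $ k = (if k = j then \<beta> else 0)" for k
  proof (cases "k = j")
    case False
    then have "E \<inter> at_state s k = {}" by (auto simp: E_def at_state_def axis_eq_axis)
    then show ?thesis using False by (simp add: mass_def)
  next
    case True
    then have "E \<inter> at_state s k = E" by (auto simp: E_def)
    then show ?thesis using True by (simp add: mass_def \<beta>_def)
  qed
  have Bs: "mass B s $ j = \<beta>" by (simp add: mass_def \<beta>_def E_def)
  note m = mass_forward_equation_nth[OF E st, of i]
  note Ai = mass_rate_integrable[OF C B st(1), of t i j]
  have L: "\<bar>mass D u $ k - mass D s $ k\<bar> \<le> n * C * (t - s)" if "s \<le> u" "u \<le> t" "D \<in> sets (F s)" for u k D
  proof -
    have "\<bar>mass D u $ k - mass D s $ k\<bar> \<le> n * C * measure Q D * (u - s)"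
      unfolding n_def by (rule mass_lipschitz[OF C that(3) st(1) that(1)])
    also have "\<dots> \<le> n * C * 1 * (t - s)"
      using that n1 C0 by (intro mult_mono mult_nonneg_nonneg) simp_all
    finally show ?thesis by simp
  qed
  \<comment> \<open>As \<open>i \<noteq> j\<close>, state \<open>i\<close> carries no mass of
    \<open>E\<close> at time \<open>s\<close>, so the forward equation has no initial term.\<close>
  have "measure Q (B \<inter> at_state s j \<inter> at_state t i) = (LINT u:{s..t}|lborel. \<Sum>k\<in>UNIV. A u $ i $ k * mass E u $ k)"
    using m(2) ij by (simp add: Es) (simp add: mass_def E_def)
  then have "measure Q (B \<inter> at_state s j \<inter> at_state t i) - (LINT u:{s..t}|lborel. A u $ i $ j * mass B u $ j)
     = (LINT u:{s..t}|lborel. (\<Sum>k\<in>UNIV. A u $ i $ k * mass E u $ k) - A u $ i $ j * mass B u $ j)"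
    using set_integral_diff(2)[OF m(1) Ai] by simp
  also have "\<bar>\<dots>\<bar> \<le> (2 * (n * C)\<^sup>2 * (t - s)) * (t - s)"
  proof (rule set_integral_abs_le[OF st(2) set_integral_diff(1)[OF m(1) Ai]])
    fix u assume su: "s \<le> u" "u \<le> t"
    then have u: "0 \<le> u" using st by simp
    \<comment> \<open>The values at time \<open>s\<close> are subtracted on both sides. There
      \<open>mass E\<close> is \<open>\<beta>\<close> in state \<open>j\<close> and zero elsewhere,
      and \<open>mass B\<close> is \<open>\<beta>\<close> in state \<open>j\<close>, so the leading
      terms cancel and only increments of order \<open>t - s\<close> remain.\<close>
    have "(\<Sum>k\<in>UNIV. A u $ i $ k * mass E u $ k) - A u $ i $ j * mass B u $ j
      = (\<Sum>k\<in>UNIV. A u $ i $ k * (mass E u $ k - mass E s $ k)) - A u $ i $ j * (mass B u $ j - mass B s $ j)"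
      by (simp add: Es Bs right_diff_distrib sum_subtractf if_distrib[of "\<lambda>x. _ * x"] cong: if_cong)
    also have "\<bar>\<dots>\<bar> \<le> (\<Sum>k\<in>(UNIV::'n set). C * (n * C * (t - s))) + C * (n * C * (t - s))"
    proof (rule order_trans[OF abs_triangle_ineq4 add_mono])
      show "\<bar>\<Sum>k\<in>UNIV. A u $ i $ k * (mass E u $ k - mass E s $ k)\<bar> \<le> (\<Sum>k\<in>(UNIV::'n set). C * (n * C * (t - s)))"
        by (rule order_trans[OF sum_abs sum_mono], unfold abs_mult) (intro mult_mono C u L su E C0; simp)
      show "\<bar>A u $ i $ j * (mass B u $ j - mass B s $ j)\<bar> \<le> C * (n * C * (t - s))"
        unfolding abs_mult by (intro mult_mono C u L su B C0; simp)
    qed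
    also have "\<dots> = (n + 1) * (n * C\<^sup>2 * (t - s))" by (simp add: n_def power2_eq_square algebra_simps)
    \<comment> \<open>There is at least one state, so \<open>n + 1 \<le> 2 * n\<close>; this is the
      origin of the factor 2.\<close>
    also have "\<dots> \<le> (2 * n) * (n * C\<^sup>2 * (t - s))"
      using n1 st by (intro mult_right_mono) simp_all
    finally show "\<bar>(\<Sum>k\<in>UNIV. A u $ i $ k * mass E u $ k) - A u $ i $ j * mass B u $ j\<bar> \<le> 2 * (n * C)\<^sup>2 * (t - s)"
      by (simp add: power2_eq_square mult.assoc mult.left_commute)
  qed
  finally show ?thesis by (simp add: n_def power2_eq_square mult.assoc)
qed

end

section \<open>Expected numbers of jumps\<close>

definition grid :: "real \<Rightarrow> real \<Rightarrow> nat \<Rightarrow> nat \<Rightarrow> real" where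
  "grid a b n k = a + real k * ((b - a) / real n)"

lemma grid_0 [simp]: "grid a b n 0 = a"
  by (simp add: grid_def)

lemma grid_end [simp]: "0 < n \<Longrightarrow> grid a b n n = b"
  by (simp add: grid_def)

lemma grid_step: "grid a b n (Suc k) - grid a b n k = (b - a) / real n"
proof -
  have "a + real (Suc k) * c - (a + real k * c) = c" for c by (simp add: distrib_right)
  then show ?thesis unfolding grid_def .
qed

lemma grid_mono: "a \<le> b \<Longrightarrow> k \<le> l \<Longrightarrow> grid a b n k \<le> grid a b n l"
  unfolding grid_def by (intro add_left_mono mult_right_mono divide_nonneg_nonneg) simp_all

lemma grid_ge: "a \<le> b \<Longrightarrow> a \<le> grid a b n k"
  using grid_mono[of a b 0 k n] by simp

lemma grid_le: "a \<le> b \<Longrightarrow> k \<le> n \<Longrightarrow> 0 < n \<Longrightarrow> grid a b n k \<le> b"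
  using grid_mono[of a b k n n] by simp

lemma grid_cell:
  assumes "a < r" "r \<le> b" "0 < n"
  obtains k where "k < n" "grid a b n k < r" "r \<le> grid a b n (Suc k)"
proof -
  define K where "K = (LEAST k. r \<le> grid a b n k)"
  have ex: "r \<le> grid a b n n" using assms by simp
  have K: "r \<le> grid a b n K" unfolding K_def by (rule LeastI[of "\<lambda>k. r \<le> grid a b n k", OF ex])
  have Kn: "K \<le> n" unfolding K_def by (rule Least_le[of "\<lambda>k. r \<le> grid a b n k", OF ex])
  have "K \<noteq> 0" using K assms(1) by (cases K) simp_all
  then obtain k where k: "K = Suc k" by (cases K) simp_all
  have "\<not> r \<le> grid a b n k"
    using not_less_Least[of k "\<lambda>k. r \<le> grid a b n k"] k unfolding K_def by simp
  then show ?thesis using k K Kn by (intro that[of k]) simp_all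
qed

lemma set_integral_grid:
  fixes f :: "real \<Rightarrow> real"
  assumes "a \<le> b" "0 < n" "set_integrable lborel {a..b} f"
  shows "(LINT u:{a..b}|lborel. f u) = (\<Sum>k<n. LINT u:{grid a b n k..grid a b n (Suc k)}|lborel. f u)"
proof -
  have "(LINT u:{a..grid a b n m}|lborel. f u) = (\<Sum>k<m. LINT u:{grid a b n k..grid a b n (Suc k)}|lborel. f u)"
    if "m \<le> n" for m
    using that
  proof (induction m)
    case 0
    then show ?case using set_integral_singleton[of a f] by simp
  next
    case (Suc m)
    have "set_integrable lborel {a..grid a b n (Suc m)} f"
      using grid_le[of a b "Suc m" n] assms Suc by (intro set_integrable_subset[OF assms(3)]) auto
    then show ?case
      using set_integral_split[of a "grid a b n m" "grid a b n (Suc m)" f] Suc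
        grid_ge[OF assms(1), of n m] grid_mono[OF assms(1), of m "Suc m" n] by simp
  qed
  from this[of n] assms(2) show ?thesis by simp
qed

section \<open>Crossings of a grid and jumps of a given type\<close>

context markov_chain
begin

text \<open>Only values at grid points enter, so the expected number of crossings is a finite sum of
  probabilities of two-time events.\<close>

definition crossings :: "(real^'n \<Rightarrow> real^'n \<Rightarrow> bool) \<Rightarrow> 'a \<Rightarrow> real \<Rightarrow> real \<Rightarrow> nat \<Rightarrow> nat set" where
  "crossings R \<omega> a b n = {k. k < n \<and> R (X (grid a b n k) \<omega>) (X (grid a b n (Suc k)) \<omega>)}"

definition jumps_of :: "(real^'n \<Rightarrow> real^'n \<Rightarrow> bool) \<Rightarrow> 'a \<Rightarrow> real \<Rightarrow> real \<Rightarrow> real set" where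
  "jumps_of R \<omega> a b = {r \<in> jumps \<omega> a b. R (left_lim X r \<omega>) (X r \<omega>)}"

text \<open>Assigns to a crossed cell one of the jumps inside it; a coarse cell may contain
  several.\<close>

definition cell_jump :: "'a \<Rightarrow> real \<Rightarrow> real \<Rightarrow> nat \<Rightarrow> nat \<Rightarrow> real" where
  "cell_jump \<omega> a b n k = (SOME r. r \<in> jumps \<omega> (grid a b n k) (grid a b n (Suc k)))"

lemma cell_jump_in:
  assumes "0 \<le> a" "a \<le> b" "\<omega> \<in> space P" "X (grid a b n k) \<omega> \<noteq> X (grid a b n (Suc k)) \<omega>"
  shows "cell_jump \<omega> a b n k \<in> jumps \<omega> (grid a b n k) (grid a b n (Suc k))"
proof -
  have "jumps \<omega> (grid a b n k) (grid a b n (Suc k)) \<noteq> {}"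
  proof
    assume e: "jumps \<omega> (grid a b n k) (grid a b n (Suc k)) = {}"
    have "X (grid a b n (Suc k)) \<omega> = X (grid a b n k) \<omega>"
      by (rule no_jumps_const[OF _ assms(3) _ e])
        (use grid_ge[OF assms(2), of n k] assms(1,2) grid_mono[OF assms(2), of k "Suc k" n] in auto)
    then show False using assms(4) by simp
  qed
  then have "\<exists>r. r \<in> jumps \<omega> (grid a b n k) (grid a b n (Suc k))" by blast
  then show ?thesis unfolding cell_jump_def by (rule someI_ex)
qed

text \<open>Jumps chosen in different cells differ because the half-open cells are disjoint.\<close>

lemma inj_on_cell_jump:
  assumes "0 \<le> a" "a \<le> b" "\<omega> \<in> space P" "\<And>x y. R x y \<Longrightarrow> x \<noteq> y"
  shows "inj_on (cell_jump \<omega> a b n) (crossings R \<omega> a b n)"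
proof -
  have c: "grid a b n k < cell_jump \<omega> a b n k" "cell_jump \<omega> a b n k \<le> grid a b n (Suc k)"
    if "k \<in> crossings R \<omega> a b n" for k
  proof -
    have "R (X (grid a b n k) \<omega>) (X (grid a b n (Suc k)) \<omega>)" using that unfolding crossings_def by blast
    from cell_jump_in[OF assms(1,2,3) assms(4)[OF this]]
    show "grid a b n k < cell_jump \<omega> a b n k" "cell_jump \<omega> a b n k \<le> grid a b n (Suc k)"
      by (simp_all add: jumps_def)
  qed
  have ne: "cell_jump \<omega> a b n k \<noteq> cell_jump \<omega> a b n l"
    if "k \<in> crossings R \<omega> a b n" "l \<in> crossings R \<omega> a b n" "k < l" for k l
    using c(2)[OF that(1)] c(1)[OF that(2)] grid_mono[OF assms(2), of "Suc k" l n] that(3) by simp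
  show ?thesis
  proof (rule inj_onI)
    fix k l assume k: "k \<in> crossings R \<omega> a b n" and l: "l \<in> crossings R \<omega> a b n"
      and eq: "cell_jump \<omega> a b n k = cell_jump \<omega> a b n l"
    have "\<not> k < l" "\<not> l < k" using ne[OF k l] ne[OF l k] eq by argo+
    then show "k = l" by simp
  qed
qed

lemma cell_jump_jumps:
  assumes "0 \<le> a" "a \<le> b" "\<omega> \<in> space P" "\<And>x y. R x y \<Longrightarrow> x \<noteq> y" "k \<in> crossings R \<omega> a b n"
  shows "cell_jump \<omega> a b n k \<in> jumps \<omega> a b"
proof -
  have k: "k < n" and Rk: "R (X (grid a b n k) \<omega>) (X (grid a b n (Suc k)) \<omega>)"
    using assms(5) by (simp_all only: crossings_def mem_Collect_eq)
  have "jumps \<omega> (grid a b n k) (grid a b n (Suc k)) \<subseteq> jumps \<omega> a b"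
    using k by (intro jumps_mono grid_ge grid_le assms) simp_all
  then show ?thesis using cell_jump_in[OF assms(1,2,3) assms(4)[OF Rk]] by blast
qed

text \<open>The bound is by all jumps, not by those of type \<open>R\<close>: a cell with several
  jumps can be crossed from \<open>j\<close> to \<open>i\<close> without containing a direct jump.
  Being uniform in \<open>n\<close>, it serves for dominated convergence.\<close>

lemma card_crossings_le:
  assumes "0 \<le> a" "a \<le> b" "\<omega> \<in> space P" "\<And>x y. R x y \<Longrightarrow> x \<noteq> y"
  shows "card (crossings R \<omega> a b n) \<le> card (jumps \<omega> a b)"
proof (rule card_inj_on_le)
  show "inj_on (cell_jump \<omega> a b n) (crossings R \<omega> a b n)"
    by (rule inj_on_cell_jump[OF assms])
  show "cell_jump \<omega> a b n ` crossings R \<omega> a b n \<subseteq> jumps \<omega> a b"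
    by (rule image_subsetI, rule cell_jump_jumps[OF assms])
qed (rule finite_jumps[OF assms(1,3)])

lemma uniform_locally_constant:
  assumes "\<omega> \<in> space P" "finite S" "S \<subseteq> {0..}"
  shows "\<exists>\<delta>>0. \<forall>r\<in>S. locally_constant \<omega> r \<delta>"
  using assms(2,3)
proof (induction S rule: finite_induct)
  case empty
  then show ?case using zero_less_one by blast
next
  case (insert x S)
  then obtain \<delta>1 where \<delta>1: "\<delta>1 > 0" "\<forall>r\<in>S. locally_constant \<omega> r \<delta>1" by auto
  have "0 \<le> x" using insert.prems by simp
  from locally_constant_ex[OF this assms(1)] obtain \<delta>2 where \<delta>2: "\<delta>2 > 0" "locally_constant \<omega> x \<delta>2" .
  have "locally_constant \<omega> r (min \<delta>1 \<delta>2)" if "r \<in> insert x S" for r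
    using that \<delta>1(2) \<delta>2(2) by (auto intro: locally_constant_mono)
  moreover have "0 < min \<delta>1 \<delta>2" using \<delta>1(1) \<delta>2(1) by simp
  ultimately show ?case by blast
qed

text \<open>The finitely many jumps have a common radius of constancy. Once the mesh is smaller, a
  cell contains at most one jump and its endpoints show the states before and after that
  jump.\<close>

lemma card_crossings_eventually:
  assumes ab: "0 \<le> a" "a \<le> b" and \<omega>: "\<omega> \<in> space P" and R: "\<And>x y. R x y \<Longrightarrow> x \<noteq> y"
  shows "eventually (\<lambda>n. card (crossings R \<omega> a b n) = card (jumps_of R \<omega> a b)) sequentially"
proof -
  let ?F = "jumps \<omega> a b"
  have sub: "?F \<subseteq> {0..}" using ab by (auto simp: jumps_def)
  from uniform_locally_constant[OF \<omega> finite_jumps[OF ab(1) \<omega>] sub]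
  obtain \<delta> where \<delta>: "\<delta> > 0" and str: "\<forall>r\<in>?F. locally_constant \<omega> r \<delta>" by blast
  have "(\<lambda>n. (b - a) / real n) \<longlonglongrightarrow> 0" by (rule lim_const_over_n)
  then have ev: "eventually (\<lambda>n. (b - a) / real n < \<delta>) sequentially" using \<delta> by (rule order_tendstoD(2))
  show ?thesis
    using ev eventually_gt_at_top[of 0]
  proof eventually_elim
    case (elim n)
    let ?t = "grid a b n"
    have cell: "X (?t k) \<omega> = left_lim X r \<omega> \<and> X (?t (Suc k)) \<omega> = X r \<omega> \<and> jumps \<omega> (?t k) (?t (Suc k)) = {r}"
      if r: "r \<in> ?F" "?t k < r" "r \<le> ?t (Suc k)" for r k
    proof (intro conjI)
      note st = bspec[OF str r(1)]
      have h: "?t (Suc k) < ?t k + \<delta>" using grid_step[of a b n k] elim(1) by linarith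
      have t0: "0 \<le> ?t k" using grid_ge[OF ab(2), of n k] ab(1) by linarith
      show "X (?t k) \<omega> = left_lim X r \<omega>"
        by (rule locally_constantD(3)[OF st]) (use t0 r h in linarith)+
      show "X (?t (Suc k)) \<omega> = X r \<omega>"
        by (rule locally_constantD(1)[OF st]) (use r h in linarith)+
      show "jumps \<omega> (?t k) (?t (Suc k)) = {r}"
      proof (intro equalityI subsetI)
        fix q assume "q \<in> jumps \<omega> (?t k) (?t (Suc k))"
        then have q: "?t k < q" "q \<le> ?t (Suc k)" "X q \<omega> \<noteq> left_lim X q \<omega>" by (simp_all add: jumps_def)
        have "0 \<le> q" "r - \<delta> < q" "q < r + \<delta>" using q r h t0 by linarith+
        then have "\<not> q < r" "\<not> r < q"
          using q(3) locally_constantD[OF st, of q] by (metis less_imp_le)+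
        then show "q \<in> {r}" by simp
      next
        fix q assume "q \<in> {r}"
        then show "q \<in> jumps \<omega> (?t k) (?t (Suc k))" using r by (simp add: jumps_def)
      qed
    qed
    have "cell_jump \<omega> a b n ` crossings R \<omega> a b n = jumps_of R \<omega> a b"
    proof (intro equalityI subsetI)
      fix r assume "r \<in> cell_jump \<omega> a b n ` crossings R \<omega> a b n"
      then obtain k where k: "k \<in> crossings R \<omega> a b n" "r = cell_jump \<omega> a b n k" by blast
      have F: "r \<in> ?F" using cell_jump_jumps[OF ab \<omega> R k(1)] k(2) by simp
      have Rk: "R (X (?t k) \<omega>) (X (?t (Suc k)) \<omega>)" using k by (simp add: crossings_def)
      have "r \<in> jumps \<omega> (?t k) (?t (Suc k))" using cell_jump_in[OF ab \<omega> R[OF Rk]] k(2) by simp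
      then have "?t k < r" "r \<le> ?t (Suc k)" by (simp_all add: jumps_def)
      from cell[OF F this] Rk F show "r \<in> jumps_of R \<omega> a b" by (simp add: jumps_of_def)
    next
      fix r assume "r \<in> jumps_of R \<omega> a b"
      then have r: "r \<in> ?F" "R (left_lim X r \<omega>) (X r \<omega>)" by (simp_all add: jumps_of_def)
      then have "a < r" "r \<le> b" by (simp_all add: jumps_def)
      then obtain k where k: "k < n" "?t k < r" "r \<le> ?t (Suc k)" using grid_cell[OF _ _ elim(2)] by blast
      note c = cell[OF r(1) k(2,3)]
      have "k \<in> crossings R \<omega> a b n" using c r(2) k(1) by (simp add: crossings_def)
      moreover have "cell_jump \<omega> a b n k = r" using c by (simp add: cell_jump_def)
      ultimately show "r \<in> cell_jump \<omega> a b n ` crossings R \<omega> a b n" by blast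
    qed
    then show ?case using card_image[OF inj_on_cell_jump[OF ab \<omega> R, of R n]] by simp
  qed
qed

definition from_to :: "'n \<Rightarrow> 'n \<Rightarrow> real^'n \<Rightarrow> real^'n \<Rightarrow> bool" where
  "from_to j i x y \<longleftrightarrow> x = axis j 1 \<and> y = axis i 1"

lemma from_to_neq: "i \<noteq> j \<Longrightarrow> from_to j i x y \<Longrightarrow> x \<noteq> y"
  by (simp add: from_to_def axis_eq_axis)

lemma card_crossings_eq_sum:
  assumes "\<omega> \<in> space P"
  shows "real (card (crossings (from_to j i) \<omega> a b n)) =
    (\<Sum>k<n. indicator (at_state (grid a b n k) j \<inter> at_state (grid a b n (Suc k)) i) \<omega>)"
proof -
  have "crossings (from_to j i) \<omega> a b n = {k \<in> {..<n}. \<omega> \<in> at_state (grid a b n k) j \<inter> at_state (grid a b n (Suc k)) i}"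
    using assms by (auto simp: crossings_def from_to_def at_state_def)
  moreover have "(\<Sum>k<n. indicator (at_state (grid a b n k) j \<inter> at_state (grid a b n (Suc k)) i) \<omega>) =
    real (card {k \<in> {..<n}. \<omega> \<in> at_state (grid a b n k) j \<inter> at_state (grid a b n (Suc k)) i})"
    by (simp add: indicator_def sum.If_cases Int_def del: Int_iff)
  ultimately show ?thesis by simp
qed

lemma measurable_card_crossings:
  assumes "0 \<le> a" "a \<le> b"
  shows "(\<lambda>\<omega>. real (card (crossings (from_to j i) \<omega> a b n))) \<in> borel_measurable Q"
proof (subst measurable_cong[OF card_crossings_eq_sum])
  have "0 \<le> grid a b n k" for k using grid_ge[OF assms(2), of n k] assms(1) by linarith
  then show "(\<lambda>\<omega>. \<Sum>k<n. indicator (at_state (grid a b n k) j \<inter> at_state (grid a b n (Suc k)) i) \<omega> :: real) \<in> borel_measurable Q"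
    by (intro borel_measurable_sum borel_measurable_indicator sets.Int at_state_Q)
qed simp

lemma integral_card_crossings:
  assumes "0 \<le> a" "a \<le> b" "B \<in> sets Q"
  shows "(LINT \<omega>|Q. indicator B \<omega> * real (card (crossings (from_to j i) \<omega> a b n))) =
    (\<Sum>k<n. measure Q (B \<inter> at_state (grid a b n k) j \<inter> at_state (grid a b n (Suc k)) i))"
proof -
  have g: "0 \<le> grid a b n k" for k using grid_ge[OF assms(2), of n k] assms(1) by linarith
  have S: "B \<inter> at_state (grid a b n k) j \<inter> at_state (grid a b n (Suc k)) i \<in> sets Q" for k
    by (intro sets.Int assms at_state_Q g)
  have "(LINT \<omega>|Q. indicator B \<omega> * real (card (crossings (from_to j i) \<omega> a b n))) =
    (LINT \<omega>|Q. (\<Sum>k<n. indicator (B \<inter> at_state (grid a b n k) j \<inter> at_state (grid a b n (Suc k)) i) \<omega>))"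
  proof (rule Bochner_Integration.integral_cong[OF refl])
    fix \<omega> assume "\<omega> \<in> space Q"
    then have \<omega>: "\<omega> \<in> space P" by simp
    show "indicator B \<omega> * real (card (crossings (from_to j i) \<omega> a b n)) =
      (\<Sum>k<n. indicator (B \<inter> at_state (grid a b n k) j \<inter> at_state (grid a b n (Suc k)) i) \<omega>)"
      unfolding card_crossings_eq_sum[OF \<omega>] sum_distrib_left
      by (intro sum.cong refl) (simp add: indicator_def)
  qed
  also have "\<dots> = (\<Sum>k<n. LINT \<omega>|Q. indicator (B \<inter> at_state (grid a b n k) j \<inter> at_state (grid a b n (Suc k)) i) \<omega>)"
    by (rule Bochner_Integration.integral_sum, rule integrable_real_indicator[OF S])
      (simp add: less_top[symmetric])
  also have "\<dots> = (\<Sum>k<n. measure Q (B \<inter> at_state (grid a b n k) j \<inter> at_state (grid a b n (Suc k)) i))"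
  proof (rule sum.cong[OF refl])
    fix k
    have "B \<inter> at_state (grid a b n k) j \<inter> at_state (grid a b n (Suc k)) i \<inter> space Q =
      B \<inter> at_state (grid a b n k) j \<inter> at_state (grid a b n (Suc k)) i" by (auto simp: at_state_def)
    then show "(LINT \<omega>|Q. indicator (B \<inter> at_state (grid a b n k) j \<inter> at_state (grid a b n (Suc k)) i) \<omega>) =
       measure Q (B \<inter> at_state (grid a b n k) j \<inter> at_state (grid a b n (Suc k)) i)"
      by simp
  qed
  finally show ?thesis .
qed

lemma measurable_card_jumps_of:
  assumes "0 \<le> a" "a \<le> b" "i \<noteq> j"
  shows "(\<lambda>\<omega>. real (card (jumps_of (from_to j i) \<omega> a b))) \<in> borel_measurable Q"
proof (rule borel_measurable_LIMSEQ_real)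
  show "(\<lambda>\<omega>. real (card (crossings (from_to j i) \<omega> a b n))) \<in> borel_measurable Q" for n
    by (rule measurable_card_crossings[OF assms(1,2)])
  fix \<omega> assume "\<omega> \<in> space Q"
  then have "eventually (\<lambda>n. card (crossings (from_to j i) \<omega> a b n) = card (jumps_of (from_to j i) \<omega> a b)) sequentially"
    by (intro card_crossings_eventually assms from_to_neq[OF assms(3)]) simp
  then show "(\<lambda>n. real (card (crossings (from_to j i) \<omega> a b n))) \<longlonglongrightarrow> real (card (jumps_of (from_to j i) \<omega> a b))"
    by (intro tendsto_eventually) (auto elim!: eventually_mono)
qed

text \<open>Each of the \<open>n\<close> cells contributes an error of second order in the mesh
  \<open>(b - a) / n\<close>, which leaves a total of order \<open>1 / n\<close>. An event known at
  time \<open>a\<close> is known at every later grid point, so the local estimate applies in each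
  cell.\<close>

lemma crossing_probabilities_bound:
  assumes ab: "0 \<le> a" "a \<le> b" and B: "B \<in> sets (F a)" and ij: "i \<noteq> j"
  obtains K where "0 \<le> K"
    "\<forall>n>0. \<bar>(\<Sum>k<n. measure Q (B \<inter> at_state (grid a b n k) j \<inter> at_state (grid a b n (Suc k)) i))
      - (LINT u:{a..b}|lborel. A u $ i $ j * mass B u $ j)\<bar> \<le> K / real n"
proof -
  obtain C where C0: "0 \<le> C" and C: "\<forall>t\<ge>0. \<forall>i j. \<bar>A t $ i $ j\<bar> \<le> C" by (rule rates_bounded)
  have C': "\<And>t i j. 0 \<le> t \<Longrightarrow> \<bar>A t $ i $ j\<bar> \<le> C" using C by blast
  define K where "K = 2 * (real CARD('n) * C)\<^sup>2 * (b - a)\<^sup>2"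
  show ?thesis
  proof (rule that[of K])
    show "0 \<le> K" by (simp add: K_def)
    show "\<forall>n>0. \<bar>(\<Sum>k<n. measure Q (B \<inter> at_state (grid a b n k) j \<inter> at_state (grid a b n (Suc k)) i))
      - (LINT u:{a..b}|lborel. A u $ i $ j * mass B u $ j)\<bar> \<le> K / real n"
    proof (intro allI impI)
    fix n :: nat assume n: "0 < n"
    let ?t = "grid a b n"
    have t0: "a \<le> ?t k" for k by (rule grid_ge[OF ab(2)])
    have tm: "?t k \<le> ?t (Suc k)" for k by (rule grid_mono[OF ab(2)]) simp
    have "\<bar>(\<Sum>k<n. measure Q (B \<inter> at_state (?t k) j \<inter> at_state (?t (Suc k)) i))
      - (LINT u:{a..b}|lborel. A u $ i $ j * mass B u $ j)\<bar>
      = \<bar>\<Sum>k<n. measure Q (B \<inter> at_state (?t k) j \<inter> at_state (?t (Suc k)) i)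
        - (LINT u:{?t k..?t (Suc k)}|lborel. A u $ i $ j * mass B u $ j)\<bar>"
      using set_integral_grid[OF ab(2) n mass_rate_integrable[OF C' B ab(1)], of i j]
      by (simp add: sum_subtractf)
    also have "\<dots> \<le> (\<Sum>k<n. 2 * (real CARD('n) * C)\<^sup>2 * ((b - a) / real n)\<^sup>2)"
    proof (rule order_trans[OF sum_abs sum_mono])
      fix k
      have "0 \<le> ?t k" using t0[of k] ab(1) by linarith
      moreover have "B \<in> sets (F (?t k))" using F_mono[OF t0[of k]] B by blast
      ultimately show "\<bar>measure Q (B \<inter> at_state (?t k) j \<inter> at_state (?t (Suc k)) i)
        - (LINT u:{?t k..?t (Suc k)}|lborel. A u $ i $ j * mass B u $ j)\<bar>
        \<le> 2 * (real CARD('n) * C)\<^sup>2 * ((b - a) / real n)\<^sup>2"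
        using jump_probability_estimate[OF C' _ _ tm[of k] ij, of B] by (simp only: grid_step)
    qed
    also have "\<dots> = K / real n" using n by (simp add: K_def power2_eq_square field_simps)
    finally show "\<bar>(\<Sum>k<n. measure Q (B \<inter> at_state (?t k) j \<inter> at_state (?t (Suc k)) i))
      - (LINT u:{a..b}|lborel. A u $ i $ j * mass B u $ j)\<bar> \<le> K / real n" .
    qed
  qed
qed

text \<open>Fatou along the grids, with the whole space as event: the expected crossings stay
  bounded by the integrated rate plus \<open>K\<close>. This integrability is what permits dominated
  convergence afterwards.\<close>

lemma integrable_card_jumps_of:
  assumes ab: "0 \<le> a" "a \<le> b" and ij: "i \<noteq> j"
  shows "integrable Q (\<lambda>\<omega>. real (card (jumps_of (from_to j i) \<omega> a b)))"
proof -
  have S: "space P \<in> sets (F a)" using sets.top[of "F a"] by simp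
  obtain K where K: "0 \<le> K"
    "\<forall>n>0. \<bar>(\<Sum>k<n. measure Q (space P \<inter> at_state (grid a b n k) j \<inter> at_state (grid a b n (Suc k)) i))
      - (LINT u:{a..b}|lborel. A u $ i $ j * mass (space P) u $ j)\<bar> \<le> K / real n"
    by (rule crossing_probabilities_bound[OF ab S ij])
  let ?L = "LINT u:{a..b}|lborel. A u $ i $ j * mass (space P) u $ j"
  let ?c = "\<lambda>n \<omega>. real (card (crossings (from_to j i) \<omega> a b n))"
  \<comment> \<open>The crude bound \<open>n\<close> makes each crossing count integrable; the bound
    uniform in \<open>n\<close> is one on expectations.\<close>
  have cn: "card (crossings (from_to j i) \<omega> a b n) \<le> n" for n \<omega>
    using card_mono[of "{..<n}" "crossings (from_to j i) \<omega> a b n"] by (simp add: crossings_def subset_iff)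
  have int: "integrable Q (?c n)" for n
  proof (rule Q.integrable_const_bound[where B="real n"])
    show "AE \<omega> in Q. norm (?c n \<omega>) \<le> real n" by (rule AE_I2) (simp add: cn)
  qed (rule measurable_card_crossings[OF ab])
  have le: "(\<integral>\<^sup>+\<omega>. ennreal (?c n \<omega>) \<partial>Q) \<le> ennreal (\<bar>?L\<bar> + K)" if n: "0 < n" for n
  proof -
    have "(LINT \<omega>|Q. ?c n \<omega>) = (LINT \<omega>|Q. indicator (space P) \<omega> * ?c n \<omega>)"
      by (rule Bochner_Integration.integral_cong) simp_all
    also have "\<dots> = (\<Sum>k<n. measure Q (space P \<inter> at_state (grid a b n k) j \<inter> at_state (grid a b n (Suc k)) i))"
      by (rule integral_card_crossings[OF ab]) (use sets.top[of Q] in simp)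
    also have "\<dots> \<le> \<bar>?L\<bar> + K / real n" using K(2)[rule_format, OF n] by linarith
    also have "\<dots> \<le> \<bar>?L\<bar> + K" 
    proof -
      have "K * 1 \<le> K * real n" using n K(1) by (intro mult_left_mono) simp_all
      then show ?thesis using n by (simp add: divide_le_eq)
    qed
    finally show ?thesis
      using nn_integral_eq_integral[OF int[of n]] by (simp add: ennreal_leI)
  qed
  have "(\<integral>\<^sup>+\<omega>. ennreal (real (card (jumps_of (from_to j i) \<omega> a b))) \<partial>Q)
    = (\<integral>\<^sup>+\<omega>. liminf (\<lambda>n. ennreal (?c n \<omega>)) \<partial>Q)"
  proof (rule nn_integral_cong)
    fix \<omega> assume "\<omega> \<in> space Q"
    then have "eventually (\<lambda>n. card (crossings (from_to j i) \<omega> a b n) = card (jumps_of (from_to j i) \<omega> a b)) sequentially"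
      by (intro card_crossings_eventually ab from_to_neq[OF ij]) simp
    then have "(\<lambda>n. ennreal (?c n \<omega>)) \<longlonglongrightarrow> ennreal (real (card (jumps_of (from_to j i) \<omega> a b)))"
      by (intro tendsto_eventually) (auto elim!: eventually_mono)
    from lim_imp_Liminf[OF _ this]
    show "ennreal (real (card (jumps_of (from_to j i) \<omega> a b))) = liminf (\<lambda>n. ennreal (?c n \<omega>))" by simp
  qed
  also have "\<dots> \<le> liminf (\<lambda>n. \<integral>\<^sup>+\<omega>. ennreal (?c n \<omega>) \<partial>Q)"
    by (rule nn_integral_liminf) (intro measurable_compose[OF measurable_card_crossings[OF ab] measurable_ennreal])
  also have "\<dots> \<le> liminf (\<lambda>n. ennreal (\<bar>?L\<bar> + K))"
    by (rule Liminf_mono) (use le in \<open>auto intro!: eventually_sequentiallyI[of 1]\<close>)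
  also have "\<dots> = ennreal (\<bar>?L\<bar> + K)" by (simp add: Liminf_const)
  finally have "(\<integral>\<^sup>+\<omega>. ennreal (real (card (jumps_of (from_to j i) \<omega> a b))) \<partial>Q) < \<infinity>"
    by (rule le_less_trans) simp
  then show ?thesis
    by (intro integrableI_nonneg measurable_card_jumps_of ab ij) simp_all
qed

lemma jumps_eq_Union: "\<omega> \<in> space P \<Longrightarrow> 0 \<le> a \<Longrightarrow>
  jumps \<omega> a b = (\<Union>(i, j)\<in>{(i, j). i \<noteq> j}. jumps_of (from_to j i) \<omega> a b)"
proof (intro equalityI subsetI)
  fix r assume \<omega>: "\<omega> \<in> space P" "0 \<le> a" and r: "r \<in> jumps \<omega> a b"
  then have "0 \<le> r" "X r \<omega> \<noteq> left_lim X r \<omega>" by (simp_all add: jumps_def)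
  moreover obtain i where "X r \<omega> = axis i 1" using states[OF \<open>0 \<le> r\<close> \<omega>(1)] by (auto simp: Basis_vec_real)
  moreover obtain j where "left_lim X r \<omega> = axis j 1"
    using left_lim_Basis[OF \<open>0 \<le> r\<close> \<omega>(1)] by (auto simp: Basis_vec_real)
  ultimately have "i \<noteq> j" "r \<in> jumps_of (from_to j i) \<omega> a b"
    using r by (auto simp: jumps_of_def from_to_def)
  then show "r \<in> (\<Union>(i, j)\<in>{(i, j). i \<noteq> j}. jumps_of (from_to j i) \<omega> a b)" by blast
qed (auto simp: jumps_of_def)

text \<open>Crossings converge to jumps pathwise and are dominated by the number of all jumps, while
  their expectations converge to the integrated rate.\<close>

lemma expected_jumps:
  assumes ab: "0 \<le> a" "a \<le> b" and B: "B \<in> sets (F a)" and ij: "i \<noteq> j"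
  shows "(LINT \<omega>|Q. indicator B \<omega> * real (card (jumps_of (from_to j i) \<omega> a b)))
    = (LINT u:{a..b}|lborel. A u $ i $ j * mass B u $ j)"
proof -
  have BQ: "B \<in> sets Q" using B F_subset_Q by auto
  let ?c = "\<lambda>n \<omega>. real (card (crossings (from_to j i) \<omega> a b n))"
  \<comment> \<open>A bound for the number of all jumps, split by type so that its integrability
    follows from \<open>integrable_card_jumps_of\<close>.\<close>
  let ?w = "\<lambda>\<omega>. \<Sum>(i, j)\<in>{(i, j). i \<noteq> j}. real (card (jumps_of (from_to j i) \<omega> a b))"
  have 1: "(\<lambda>n. LINT \<omega>|Q. indicator B \<omega> * ?c n \<omega>) \<longlonglongrightarrow>
    (LINT \<omega>|Q. indicator B \<omega> * real (card (jumps_of (from_to j i) \<omega> a b)))"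
  proof (rule integral_dominated_convergence[where w="?w"])
    show "(\<lambda>\<omega>. indicator B \<omega> * real (card (jumps_of (from_to j i) \<omega> a b))) \<in> borel_measurable Q"
      by (intro borel_measurable_times borel_measurable_indicator BQ measurable_card_jumps_of ab ij)
    show "(\<lambda>\<omega>. indicator B \<omega> * ?c n \<omega>) \<in> borel_measurable Q" for n
      by (intro borel_measurable_times borel_measurable_indicator BQ measurable_card_crossings ab)
    show "integrable Q ?w"
      by (intro Bochner_Integration.integrable_sum) (auto intro!: integrable_card_jumps_of ab)
    show "AE \<omega> in Q. (\<lambda>n. indicator B \<omega> * ?c n \<omega>) \<longlonglongrightarrow> indicator B \<omega> * real (card (jumps_of (from_to j i) \<omega> a b))"
    proof (rule AE_I2)
      fix \<omega> assume "\<omega> \<in> space Q"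
      then have "eventually (\<lambda>n. card (crossings (from_to j i) \<omega> a b n) = card (jumps_of (from_to j i) \<omega> a b)) sequentially"
        by (intro card_crossings_eventually ab from_to_neq[OF ij]) simp
      then show "(\<lambda>n. indicator B \<omega> * ?c n \<omega>) \<longlonglongrightarrow> indicator B \<omega> * real (card (jumps_of (from_to j i) \<omega> a b))"
        by (intro tendsto_eventually) (auto elim!: eventually_mono)
    qed
    show "AE \<omega> in Q. norm (indicator B \<omega> * ?c n \<omega>) \<le> ?w \<omega>" for n
    proof (rule AE_I2)
      fix \<omega> assume "\<omega> \<in> space Q"
      then have \<omega>: "\<omega> \<in> space P" by simp
      have "norm (indicator B \<omega> * ?c n \<omega>) \<le> ?c n \<omega>" by (simp add: indicator_def)
      also have "\<dots> \<le> real (card (jumps \<omega> a b))"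
        using card_crossings_le[OF ab \<omega> from_to_neq[OF ij]] by simp
      also have "\<dots> \<le> real (\<Sum>(i, j)\<in>{(i, j). i \<noteq> j}. card (jumps_of (from_to j i) \<omega> a b))"
        unfolding jumps_eq_Union[OF \<omega> ab(1)]
        using card_UN_le[of "{(i, j). i \<noteq> j}" "\<lambda>(i, j). jumps_of (from_to j i) \<omega> a b"]
        by (simp add: case_prod_beta' del: of_nat_sum)
      also have "\<dots> = ?w \<omega>" by (simp add: case_prod_beta')
      finally show "norm (indicator B \<omega> * ?c n \<omega>) \<le> ?w \<omega>" .
    qed
  qed
  obtain K where K: "0 \<le> K"
    "\<forall>n>0. \<bar>(\<Sum>k<n. measure Q (B \<inter> at_state (grid a b n k) j \<inter> at_state (grid a b n (Suc k)) i))
      - (LINT u:{a..b}|lborel. A u $ i $ j * mass B u $ j)\<bar> \<le> K / real n"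
    by (rule crossing_probabilities_bound[OF ab B ij])
  have "(\<lambda>n. (LINT \<omega>|Q. indicator B \<omega> * ?c n \<omega>) - (LINT u:{a..b}|lborel. A u $ i $ j * mass B u $ j)) \<longlonglongrightarrow> 0"
  proof (rule tendsto_0_le[OF lim_const_over_n[of K], where K=1])
    show "eventually (\<lambda>n. norm ((LINT \<omega>|Q. indicator B \<omega> * ?c n \<omega>) - (LINT u:{a..b}|lborel. A u $ i $ j * mass B u $ j))
      \<le> norm (K / real n) * 1) sequentially"
      using eventually_gt_at_top[of 0]
    proof eventually_elim
      case (elim n)
      show ?case using K(2)[rule_format, OF elim] K(1) by (simp add: integral_card_crossings[OF ab BQ])
    qed
  qed
  then have "(\<lambda>n. LINT \<omega>|Q. indicator B \<omega> * ?c n \<omega>) \<longlonglongrightarrow> (LINT u:{a..b}|lborel. A u $ i $ j * mass B u $ j)"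
    by (rule LIM_zero_cancel)
  from LIMSEQ_unique[OF 1 this] show ?thesis .
qed


section \<open>The compensator of the jumps\<close>

abbreviation "PA \<equiv> predictable_algebra P X"
abbreviation "L \<equiv> (lborel :: real measure) \<Otimes>\<^sub>M Q"

sublocale LQ: pair_sigma_finite lborel Q
  by unfold_locales

lemma sets_L: "sets L = sets (borel \<Otimes>\<^sub>M Q)"
  by (rule sets_pair_measure_cong) simp_all

text \<open>Tonelli for the exceptional set, whose measurability allows the two almost-everywhere
  quantifiers to be interchanged.\<close>

lemma AE_pair_if_AE_paths:
  assumes "Measurable.pred (borel \<Otimes>\<^sub>M Q) (\<lambda>p. R (fst p) (snd p))"
    and "AE \<omega> in Q. AE u in lborel. R u \<omega>"
  shows "AE (u, \<omega>) in L. R u \<omega>"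
proof -
  have m: "{x \<in> space L. R (fst x) (snd x)} \<in> sets L"
    using assms(1) unfolding pred_def sets_L by (simp add: space_pair_measure)
  have "AE u in lborel. AE \<omega> in Q. R u \<omega>"
    using LQ.AE_commute[of R] m assms(2) by simp
  then have "AE u in lborel. AE \<omega> in Q. R (fst (u, \<omega>)) (snd (u, \<omega>))" by simp
  from LQ.AE_pair_measure[OF m this] show ?thesis by (simp add: case_prod_beta')
qed

text \<open>Tonelli is applied to a measurable null set covering the exceptional set, so
  \<open>R\<close> may be arbitrary.\<close>

lemma AE_paths_if_AE_pair:
  assumes "AE (u, \<omega>) in L. R u \<omega>"
  shows "AE \<omega> in Q. AE u in lborel. R u \<omega>"
proof -
  obtain N where N: "{x \<in> space L. \<not> (case x of (u, \<omega>) \<Rightarrow> R u \<omega>)} \<subseteq> N" "N \<in> null_sets L"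
    using assms by (auto simp: eventually_ae_filter)
  have "AE x in L. x \<notin> N" using AE_not_in[OF N(2)] .
  from LQ.AE_pair[OF this] have "AE u in lborel. AE \<omega> in Q. (u, \<omega>) \<notin> N" .
  moreover have "{x \<in> space L. (fst x, snd x) \<notin> N} \<in> sets L"
  proof -
    have "{x \<in> space L. (fst x, snd x) \<notin> N} = space L - N" by auto
    then show ?thesis using sets.compl_sets[OF null_setsD2[OF N(2)]] by (simp only:)
  qed
  ultimately have "AE \<omega> in Q. AE u in lborel. (u, \<omega>) \<notin> N"
    using LQ.AE_commute[of "\<lambda>u \<omega>. (u, \<omega>) \<notin> N"] by simp
  moreover have "AE \<omega> in Q. \<omega> \<in> space P" using AE_space[of Q] by simp
  ultimately show ?thesis
  proof eventually_elim
    case (elim \<omega>)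
    from elim(1) show ?case
      by eventually_elim (use N(1) elim(2) in \<open>auto simp: space_pair_measure\<close>)
  qed
qed

text \<open>Joint measurability is known on bounded horizons, and processes are unconstrained at
  negative times. Clamping transports it to the whole line without changing values on
  \<open>{0..T}\<close>.\<close>

lemma measurable_clamp:
  assumes "0 \<le> (T::real)" "g \<in> measurable (restrict_space borel {0..T} \<Otimes>\<^sub>M Q) N"
  shows "(\<lambda>p. g (max 0 (min T (fst p)), snd p)) \<in> measurable (borel \<Otimes>\<^sub>M Q) N"
proof -
  have "(\<lambda>p. max 0 (min T (fst p))) \<in> measurable (borel \<Otimes>\<^sub>M Q) (restrict_space borel {0..T})"
  proof (rule measurable_restrict_space2)
    show "(\<lambda>p. max 0 (min T (fst p))) \<in> space (borel \<Otimes>\<^sub>M Q) \<rightarrow> {0..T}"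
      using assms(1) by (intro funcsetI) (simp add: max_def min_def)
    show "(\<lambda>p. max 0 (min T (fst p))) \<in> borel_measurable (borel \<Otimes>\<^sub>M Q)" by measurable
  qed
  then have "(\<lambda>p. (max 0 (min T (fst p)), snd p)) \<in> measurable (borel \<Otimes>\<^sub>M Q) (restrict_space borel {0..T} \<Otimes>\<^sub>M Q)"
    by (rule measurable_Pair) simp
  from measurable_compose[OF this assms(2)] show ?thesis .
qed

lemma measurable_X_pair:
  assumes "0 \<le> T"
  shows "(\<lambda>(t, \<omega>). X t \<omega>) \<in> borel_measurable (restrict_space borel {0..T} \<Otimes>\<^sub>M Q)"
  by (rule measurable_right_continuous[OF assms measurable_X_Q]) (use right_continuous in auto)

lemma measurable_left_lim_X_pair:
  assumes "0 \<le> T"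
  shows "(\<lambda>(t, \<omega>). left_lim X t \<omega>) \<in> borel_measurable (restrict_space borel {0..T} \<Otimes>\<^sub>M Q)"
  by (rule measurable_left_lim[OF assms measurable_X_Q]) (use left_limits in auto)

lemma AE_pair_no_jump: "AE (u, \<omega>) in L. 0 \<le> u \<longrightarrow> left_lim X u \<omega> = X u \<omega>"
proof -
  have T: "AE (u, \<omega>) in L. 0 \<le> u \<and> u \<le> real T \<longrightarrow> left_lim X u \<omega> = X u \<omega>" for T :: nat
  proof (rule AE_pair_if_AE_paths)
    let ?c = "\<lambda>u. max 0 (min (real T) u)"
    have X: "(\<lambda>p. X (?c (fst p)) (snd p)) \<in> borel_measurable (borel \<Otimes>\<^sub>M Q)"
      using measurable_clamp[OF _ measurable_X_pair, of "real T"] by simp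
    have Xl: "(\<lambda>p. left_lim X (?c (fst p)) (snd p)) \<in> borel_measurable (borel \<Otimes>\<^sub>M Q)"
      using measurable_clamp[OF _ measurable_left_lim_X_pair, of "real T"] by simp
    note [measurable] = X Xl
    have "Measurable.pred (borel \<Otimes>\<^sub>M Q) (\<lambda>p. 0 \<le> fst p \<and> fst p \<le> real T \<longrightarrow>
      left_lim X (?c (fst p)) (snd p) = X (?c (fst p)) (snd p))" by measurable
    \<comment> \<open>Under the guard the clamp does nothing.\<close>
    moreover have "(0 \<le> u \<and> u \<le> real T \<longrightarrow> left_lim X (?c u) \<omega> = X (?c u) \<omega>) \<longleftrightarrow>
      (0 \<le> u \<and> u \<le> real T \<longrightarrow> left_lim X u \<omega> = X u \<omega>)" for u \<omega> by auto
    ultimately show "Measurable.pred (borel \<Otimes>\<^sub>M Q)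
      (\<lambda>p. 0 \<le> fst p \<and> fst p \<le> real T \<longrightarrow> left_lim X (fst p) (snd p) = X (fst p) (snd p))" by simp
    have "AE \<omega> in Q. \<omega> \<in> space P" using AE_space[of Q] by simp
    then show "AE \<omega> in Q. AE u in lborel. 0 \<le> u \<and> u \<le> real T \<longrightarrow> left_lim X u \<omega> = X u \<omega>"
    proof eventually_elim
      case (elim \<omega>)
      from AE_no_jump[OF this] show ?case by eventually_elim simp
    qed
  qed
  have "AE p in L. \<forall>T. case p of (u, \<omega>) \<Rightarrow> 0 \<le> u \<and> u \<le> real T \<longrightarrow> left_lim X u \<omega> = X u \<omega>"
    using T by (simp add: AE_all_countable)
  then show ?thesis
  proof eventually_elim
    case (elim p)
    obtain T where "fst p \<le> real T" using real_arch_simple by blast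
    with elim[rule_format, of T] show ?case by (cases p) simp
  qed
qed

section \<open>Predictable rectangles and the compensator formula\<close>

definition rectangles :: "(real \<times> 'a) set set" where
  "rectangles = {{s<..t} \<times> B | s t B. 0 \<le> s \<and> s \<le> t \<and> B \<in> sets (F s)} \<union> {{0} \<times> B | B. B \<in> sets (F 0)}"

lemma rectangles_Pow: "rectangles \<subseteq> Pow ({0..} \<times> space P)"
proof -
  have "B \<subseteq> space P" if "B \<in> sets (F s)" for B s using sets.sets_into_space[OF that] by simp
  then show ?thesis unfolding rectangles_def by force
qed

lemma sets_PA: "sets PA = sigma_sets ({0..} \<times> space P) rectangles"
  unfolding predictable_algebra_def rectangles_def[symmetric] by (rule sets_measure_of[OF rectangles_Pow])

lemma space_PA: "space PA = {0..} \<times> space P"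
  unfolding predictable_algebra_def rectangles_def[symmetric] by (rule space_measure_of[OF rectangles_Pow])

lemma PA_subset: "sets PA \<subseteq> sets (borel \<Otimes>\<^sub>M Q)"
  unfolding sets_PA
proof (rule sets.sigma_sets_subset')
  have "B \<in> sets Q" if "B \<in> sets (F s)" for B s using that F_subset_Q by blast
  then show "rectangles \<subseteq> sets (borel \<Otimes>\<^sub>M Q)" unfolding rectangles_def by (auto intro!: pair_measureI)
  show "{0::real..} \<times> space P \<in> sets (borel \<Otimes>\<^sub>M Q)"
    using sets.top[of Q] by (intro pair_measureI borel_closed closed_atLeast) (simp only: space_completion)
qed

text \<open>Two rectangles intersect in one that starts at the later of the two times, when both
  events are known.\<close>

lemma Int_stable_rectangles: "Int_stable rectangles"
proof (rule Int_stableI)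
  have empty: "{} \<in> rectangles" unfolding rectangles_def by (rule UnI2) (auto intro!: exI[of _ "{}"])
  fix a b assume ab: "a \<in> rectangles" "b \<in> rectangles"
  consider (1) s t B s' t' B' where "a = {s<..t} \<times> B" "0 \<le> s" "s \<le> t" "B \<in> sets (F s)"
      "b = {s'<..t'} \<times> B'" "0 \<le> s'" "s' \<le> t'" "B' \<in> sets (F s')"
    | (2) B B' where "a = {0} \<times> B" "b = {0} \<times> B'" "B \<in> sets (F 0)" "B' \<in> sets (F 0)"
    | (3) "a \<inter> b = {}"
    using ab unfolding rectangles_def by fastforce
  then show "a \<inter> b \<in> rectangles"
  proof cases
    case 1
    have eq: "a \<inter> b = {max s s'<..min t t'} \<times> (B \<inter> B')" using 1 by auto
    show ?thesis
    proof (cases "max s s' \<le> min t t'")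
      case True
      have "B \<in> sets (F (max s s'))" "B' \<in> sets (F (max s s'))"
        using 1 F_mono[of s "max s s'"] F_mono[of s' "max s s'"] by auto
      then have "B \<inter> B' \<in> sets (F (max s s'))" by (rule sets.Int)
      then show ?thesis using True 1 unfolding eq rectangles_def
        by (intro UnI1 CollectI exI[of _ "max s s'"] exI[of _ "min t t'"] exI[of _ "B \<inter> B'"]) simp
    next
      case False
      then have "{max s s'<..min t t'} = {}" by (intro greaterThanAtMost_empty) linarith
      then have "a \<inter> b = {}" unfolding eq by blast
      then show ?thesis using empty by simp
    qed
  next
    case 2
    have "a \<inter> b = {0} \<times> (B \<inter> B')" using 2 by auto
    then show ?thesis using sets.Int[OF 2(3,4)] unfolding rectangles_def by blast
  next
    case 3
    then show ?thesis using empty by simp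
  qed
qed

definition jump_count :: "real \<Rightarrow> 'n \<Rightarrow> 'n \<Rightarrow> (real \<times> 'a) set \<Rightarrow> 'a \<Rightarrow> ennreal" where
  "jump_count T i j D \<omega> = (\<Sum>r\<in>jumps_of (from_to j i) \<omega> 0 T. indicator D (r, \<omega>))"

text \<open>On \<open>]0,T]\<close> this is the rate from \<open>j\<close> to \<open>i\<close> on
  the event that the state is \<open>j\<close>. It uses the current state, which fits
  \<open>mass\<close> and differs from the left limit only on a null set; the clamp makes it jointly
  measurable on the whole line.\<close>

definition intensity :: "real \<Rightarrow> 'n \<Rightarrow> 'n \<Rightarrow> real \<times> 'a \<Rightarrow> real" where
  "intensity T i j p = indicator {0<..T} (fst p) * A (max 0 (min T (fst p))) $ i $ j
    * X (max 0 (min T (fst p))) (snd p) $ j"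

definition compensator :: "real \<Rightarrow> 'n \<Rightarrow> 'n \<Rightarrow> (real \<times> 'a) set \<Rightarrow> ennreal" where
  "compensator T i j D = (\<integral>\<^sup>+p. indicator D p * ennreal (intensity T i j p) \<partial>L)"

lemma finite_jumps_of: "\<omega> \<in> space P \<Longrightarrow> 0 \<le> a \<Longrightarrow> finite (jumps_of R \<omega> a b)"
  unfolding jumps_of_def using finite_jumps by simp

lemma rates_nonneg: "0 \<le> t \<Longrightarrow> i \<noteq> j \<Longrightarrow> 0 \<le> A t $ i $ j"
  using rates by (simp add: rate_matrix_def)

lemma measurable_intensity:
  assumes "0 \<le> T" shows "intensity T i j \<in> borel_measurable (borel \<Otimes>\<^sub>M Q)"
proof -
  have X: "(\<lambda>p. X (max 0 (min T (fst p))) (snd p)) \<in> borel_measurable (borel \<Otimes>\<^sub>M Q)"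
    using measurable_clamp[OF assms measurable_X_pair[OF assms]] by simp
  have A: "(\<lambda>p. A (max 0 (min T (fst p)))) \<in> borel_measurable (borel \<Otimes>\<^sub>M Q)"
    by (rule measurable_compose[OF _ measurable_rates], rule measurable_restrict_space2) auto
  show ?thesis unfolding intensity_def
    by (intro borel_measurable_times measurable_vec_nth' X A) measurable
qed

text \<open>On a rectangle the count is the indicator of \<open>B\<close> times a number of jumps
  after \<open>s\<close>, so the identity is \<open>expected_jumps\<close> combined with
  Tonelli.\<close>

lemma compensator_rectangle:
  assumes T: "0 \<le> T" and ij: "i \<noteq> j" and s: "0 \<le> s" "s \<le> t" and B: "B \<in> sets (F s)"
  shows "jump_count T i j ({s<..t} \<times> B) \<in> borel_measurable Q \<and>
    (\<integral>\<^sup>+\<omega>. jump_count T i j ({s<..t} \<times> B) \<omega> \<partial>Q) = compensator T i j ({s<..t} \<times> B)"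
proof (cases "s \<le> T")
  case False
  have z: "jump_count T i j ({s<..t} \<times> B) \<omega> = 0" if "\<omega> \<in> space Q" for \<omega>
    unfolding jump_count_def by (rule sum.neutral) (use False in \<open>auto simp: jumps_of_def jumps_def\<close>)
  then have "(\<integral>\<^sup>+\<omega>. jump_count T i j ({s<..t} \<times> B) \<omega> \<partial>Q) = (\<integral>\<^sup>+\<omega>. 0 \<partial>Q)"
    by (rule nn_integral_cong)
  moreover have "indicator ({s<..t} \<times> B) p * ennreal (intensity T i j p) = 0" for p
    using False by (cases p) (auto simp: intensity_def indicator_def)
  ultimately have "compensator T i j ({s<..t} \<times> B) = 0" "(\<integral>\<^sup>+\<omega>. jump_count T i j ({s<..t} \<times> B) \<omega> \<partial>Q) = 0"
    unfolding compensator_def by (simp_all only: nn_integral_const mult_zero_left)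
  moreover have "jump_count T i j ({s<..t} \<times> B) \<in> borel_measurable Q"
    by (subst measurable_cong[of Q _ "\<lambda>_. 0"]) (use z in simp_all)
  ultimately show ?thesis by simp
next
  case True
  \<comment> \<open>The count only sees the part of the rectangle up to the horizon
    \<open>T\<close>.\<close>
  define b where "b = min t T"
  have sb: "s \<le> b" using True s by (simp add: b_def)
  have BQ: "B \<in> sets Q" using B F_subset_Q by blast
  let ?f = "\<lambda>\<omega>. indicator B \<omega> * real (card (jumps_of (from_to j i) \<omega> s b))"
  have jc: "jump_count T i j ({s<..t} \<times> B) \<omega> = ennreal (?f \<omega>)" if "\<omega> \<in> space Q" for \<omega>
  proof -
    have fin: "finite (jumps_of (from_to j i) \<omega> 0 T)" using finite_jumps_of that by simp
    have "jump_count T i j ({s<..t} \<times> B) \<omega> = (\<Sum>r\<in>jumps_of (from_to j i) \<omega> s b. indicator B \<omega>)"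
      unfolding jump_count_def
      by (rule sum.mono_neutral_cong_right[OF fin])
        (use s in \<open>auto simp: jumps_of_def jumps_def b_def indicator_def\<close>)
    also have "\<dots> = ennreal (?f \<omega>)"
      by (cases "\<omega> \<in> B") (simp_all add: ennreal_of_nat_eq_real_of_nat)
    finally show ?thesis .
  qed
  have fi: "integrable Q ?f"
    using integrable_mult_indicator[OF BQ integrable_card_jumps_of[OF s(1) sb ij]] by simp
  have m: "jump_count T i j ({s<..t} \<times> B) \<in> borel_measurable Q"
    by (subst measurable_cong[OF jc]) (use borel_measurable_integrable[OF fi] in measurable)
  have "(\<integral>\<^sup>+\<omega>. jump_count T i j ({s<..t} \<times> B) \<omega> \<partial>Q) = (\<integral>\<^sup>+\<omega>. ennreal (?f \<omega>) \<partial>Q)"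
    by (rule nn_integral_cong[OF jc])
  also have "\<dots> = ennreal (LINT \<omega>|Q. ?f \<omega>)"
    by (rule nn_integral_eq_integral[OF fi]) simp
  also have "\<dots> = ennreal (LINT u:{s..b}|lborel. A u $ i $ j * mass B u $ j)"
    by (simp only: expected_jumps[OF s(1) sb B ij])
  also have "\<dots> = (\<integral>\<^sup>+u. ennreal (indicator {s..b} u * (A u $ i $ j * mass B u $ j)) \<partial>lborel)"
  proof -
    obtain C where "0 \<le> C" "\<forall>t\<ge>0. \<forall>i j. \<bar>A t $ i $ j\<bar> \<le> C" by (rule rates_bounded)
    note C = this(2)[rule_format]
    have "set_integrable lborel {s..b} (\<lambda>u. A u $ i $ j * mass B u $ j)"
      by (rule mass_rate_integrable[OF C B s(1)])
    moreover have "0 \<le> indicator {s..b} u * (A u $ i $ j * mass B u $ j)" for u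
      using rates_nonneg[OF _ ij, of u] mass_bounds[OF BQ, of u j] s(1) by (auto simp: indicator_def)
    ultimately show ?thesis
      unfolding set_integrable_def set_lebesgue_integral_def
      by (subst nn_integral_eq_integral) simp_all
  qed
  also have "\<dots> = (\<integral>\<^sup>+u. (\<integral>\<^sup>+\<omega>. indicator ({s<..t} \<times> B) (u, \<omega>) * ennreal (intensity T i j (u, \<omega>)) \<partial>Q) \<partial>lborel)"
  proof (rule nn_integral_cong_AE)
    \<comment> \<open>The left endpoint, which the rectangle excludes, is a null set.\<close>
    show "AE u in lborel. ennreal (indicator {s..b} u * (A u $ i $ j * mass B u $ j)) =
      (\<integral>\<^sup>+\<omega>. indicator ({s<..t} \<times> B) (u, \<omega>) * ennreal (intensity T i j (u, \<omega>)) \<partial>Q)"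
      using AE_lborel_singleton[of s]
    proof eventually_elim
      case (elim u)
      show ?case
      proof (cases "u \<in> {s<..b}")
        case False
        then have "u \<notin> {s..b}" using elim by auto
        then have l: "ennreal (indicator {s..b} u * (A u $ i $ j * mass B u $ j)) = 0" by simp
        have "indicator ({s<..t} \<times> B) (u, \<omega>) * ennreal (intensity T i j (u, \<omega>)) = 0" for \<omega>
          using False by (auto simp: intensity_def indicator_def b_def)
        then have "(\<integral>\<^sup>+\<omega>. indicator ({s<..t} \<times> B) (u, \<omega>) * ennreal (intensity T i j (u, \<omega>)) \<partial>Q) = (\<integral>\<^sup>+\<omega>. 0 \<partial>Q)"
          by (intro nn_integral_cong)
        then show ?thesis unfolding l by simp
      next
        case True
        then have u: "0 < u" "u \<le> T" "s < u" "u \<le> t" using s(1) by (auto simp: b_def)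
        have "(\<integral>\<^sup>+\<omega>. indicator ({s<..t} \<times> B) (u, \<omega>) * ennreal (intensity T i j (u, \<omega>)) \<partial>Q)
          = (\<integral>\<^sup>+\<omega>. ennreal (A u $ i $ j) * indicator (B \<inter> at_state u j) \<omega> \<partial>Q)"
        proof (rule nn_integral_cong)
          fix \<omega> assume "\<omega> \<in> space Q"
          then have "X u \<omega> $ j = indicator (at_state u j) \<omega>" using X_nth[of u \<omega> j] u by simp
          then show "indicator ({s<..t} \<times> B) (u, \<omega>) * ennreal (intensity T i j (u, \<omega>)) =
            ennreal (A u $ i $ j) * indicator (B \<inter> at_state u j) \<omega>"
            using u by (auto simp: intensity_def indicator_def)
        qed
        also have "\<dots> = ennreal (A u $ i $ j) * emeasure Q (B \<inter> at_state u j)"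
          using u by (intro nn_integral_cmult_indicator sets.Int BQ at_state_Q) simp
        also have "\<dots> = ennreal (A u $ i $ j * mass B u $ j)"
          using rates_nonneg[OF _ ij, of u] u by (simp add: Q.emeasure_eq_measure mass_def ennreal_mult)
        finally show ?thesis using True by simp
      qed
    qed
  qed
  also have "\<dots> = compensator T i j ({s<..t} \<times> B)"
    unfolding compensator_def
  proof (rule Q.nn_integral_fst)
    have "{s<..t} \<times> B \<in> sets (borel \<Otimes>\<^sub>M Q)" using BQ by (intro pair_measureI) simp_all
    then have "(\<lambda>p. indicator ({s<..t} \<times> B) p * ennreal (intensity T i j p)) \<in> borel_measurable (borel \<Otimes>\<^sub>M Q)"
      using measurable_intensity[OF T, of i j] by measurable
    then show "(\<lambda>p. indicator ({s<..t} \<times> B) p * ennreal (intensity T i j p)) \<in> borel_measurable L"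
      by (simp add: measurable_cong_sets[OF sets_L refl])
  qed
  finally show ?thesis using m by simp
qed

text \<open>Finiteness is what allows cancellation in the extended reals when passing to
  complements. The bound is the expected number of jumps up to \<open>T\<close>.\<close>

lemma finite_compensator:
  assumes "0 \<le> T" "i \<noteq> j"
  shows "compensator T i j D < \<infinity>"
proof -
  have S: "space P \<in> sets (F 0)" using sets.top[of "F 0"] by simp
  have "(\<integral>\<^sup>+\<omega>. jump_count T i j ({0<..T} \<times> space P) \<omega> \<partial>Q)
    = (\<integral>\<^sup>+\<omega>. ennreal (real (card (jumps_of (from_to j i) \<omega> 0 T))) \<partial>Q)"
  proof (rule nn_integral_cong)
    fix \<omega> assume "\<omega> \<in> space Q"
    then have "jump_count T i j ({0<..T} \<times> space P) \<omega> = (\<Sum>r\<in>jumps_of (from_to j i) \<omega> 0 T. 1)"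
      unfolding jump_count_def by (intro sum.cong) (auto simp: jumps_of_def jumps_def)
    then show "jump_count T i j ({0<..T} \<times> space P) \<omega> = ennreal (real (card (jumps_of (from_to j i) \<omega> 0 T)))"
      by (simp add: ennreal_of_nat_eq_real_of_nat)
  qed
  also have "\<dots> = ennreal (LINT \<omega>|Q. real (card (jumps_of (from_to j i) \<omega> 0 T)))"
    by (rule nn_integral_eq_integral[OF integrable_card_jumps_of]) (use assms in simp_all)
  finally have "compensator T i j ({0<..T} \<times> space P) < \<infinity>"
    using compensator_rectangle[OF assms order_refl assms(1) S] by simp
  moreover have "compensator T i j D \<le> compensator T i j ({0<..T} \<times> space P)"
    unfolding compensator_def
    by (rule nn_integral_mono) (auto simp: intensity_def indicator_def space_pair_measure)
  ultimately show ?thesis by (rule le_less_trans[rotated])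
qed

text \<open>Both sides are countably additive in \<open>D\<close> and agree on the predictable
  rectangles, an intersection-stable generator. Measurability of the count is carried through the
  same Dynkin induction.\<close>

theorem compensator:
  assumes T: "0 \<le> T" and ij: "i \<noteq> j" and D: "D \<in> sets PA"
  shows "jump_count T i j D \<in> borel_measurable Q \<and>
    (\<integral>\<^sup>+\<omega>. jump_count T i j D \<omega> \<partial>Q) = compensator T i j D"
proof -
  let ?S = "\<lambda>D. jump_count T i j D \<in> borel_measurable Q \<and>
    (\<integral>\<^sup>+\<omega>. jump_count T i j D \<omega> \<partial>Q) = compensator T i j D"
  have L: "(\<lambda>p. indicator D p * ennreal (intensity T i j p)) \<in> borel_measurable L" if "D \<in> sets PA" for D
  proof -
    have "D \<in> sets (borel \<Otimes>\<^sub>M Q)" using that PA_subset by blast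
    then have "(\<lambda>p. indicator D p * ennreal (intensity T i j p)) \<in> borel_measurable (borel \<Otimes>\<^sub>M Q)"
      using measurable_intensity[OF T, of i j] by measurable
    then show ?thesis by (simp add: measurable_cong_sets[OF sets_L refl])
  qed
  have S: "space P \<in> sets (F 0)" using sets.top[of "F 0"] by simp
  have top: "?S ({0..} \<times> space P)"
  proof -
    have "jump_count T i j ({0..} \<times> space P) = jump_count T i j ({0<..T} \<times> space P)"
      unfolding jump_count_def by (intro ext sum.cong) (auto simp: jumps_of_def jumps_def indicator_def)
    moreover have "compensator T i j ({0..} \<times> space P) = compensator T i j ({0<..T} \<times> space P)"
      unfolding compensator_def by (rule nn_integral_cong) (auto simp: intensity_def indicator_def)
    ultimately show ?thesis using compensator_rectangle[OF T ij order_refl T S] by simp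
  qed
  have "D \<in> sigma_sets ({0..} \<times> space P) rectangles" using D by (simp add: sets_PA)
  from Int_stable_rectangles rectangles_Pow this show ?thesis
  proof (induction D rule: sigma_sets_induct_disjoint)
    case (basic D)
    then consider s t B where "D = {s<..t} \<times> B" "0 \<le> s" "s \<le> t" "B \<in> sets (F s)" | B where "D = {0} \<times> B"
      unfolding rectangles_def by blast
    then show ?case
    proof cases
      case 1
      then show ?thesis using compensator_rectangle[OF T ij] by simp
    next
      case 2
      \<comment> \<open>Jumps occur at positive times and the intensity vanishes at zero, so
        rectangles over time zero contribute nothing.\<close>
      have "jump_count T i j D = (\<lambda>\<omega>. 0)"
        unfolding jump_count_def 2 by (intro ext sum.neutral) (auto simp: jumps_of_def jumps_def)
      moreover have "compensator T i j D = 0"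
        unfolding compensator_def 2 by (subst nn_integral_cong[of _ _ "\<lambda>_. 0"]) (auto simp: intensity_def indicator_def)
      ultimately show ?thesis by simp
    qed
  next
    case empty
    have "jump_count T i j {} = (\<lambda>\<omega>. 0)" by (simp add: jump_count_def fun_eq_iff)
    then show ?case by (simp add: compensator_def)
  next
    case (compl D)
    let ?\<Omega> = "{0..} \<times> space P"
    have DPA: "D \<in> sets PA" "?\<Omega> - D \<in> sets PA"
      using compl.hyps sigma_sets.Compl[OF compl.hyps] by (simp_all add: sets_PA)
    have sub: "D \<subseteq> ?\<Omega>" using sets.sets_into_space[OF DPA(1)] by (simp add: space_PA)
    have ind: "indicator ?\<Omega> p = (indicator D p + indicator (?\<Omega> - D) p :: ennreal)" for p
      using sub by (auto simp: indicator_def)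
    have add: "jump_count T i j ?\<Omega> \<omega> = jump_count T i j D \<omega> + jump_count T i j (?\<Omega> - D) \<omega>" for \<omega>
      unfolding jump_count_def ind by (rule sum.distrib)
    have fin: "jump_count T i j D \<omega> < \<infinity>" for \<omega>
    proof -
      have "jump_count T i j D \<omega> \<le> (\<Sum>r\<in>jumps_of (from_to j i) \<omega> 0 T. 1)"
        unfolding jump_count_def by (rule sum_mono) (simp add: indicator_def)
      also have "\<dots> < \<infinity>" by (simp add: of_nat_less_top)
      finally show ?thesis .
    qed
    \<comment> \<open>A pathwise finite count may be subtracted, which gives measurability for the
      complement.\<close>
    have diff: "jump_count T i j (?\<Omega> - D) \<omega> = jump_count T i j ?\<Omega> \<omega> - jump_count T i j D \<omega>" for \<omega>
      unfolding add using fin[of \<omega>] by (simp add: less_top[symmetric])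
    have m: "jump_count T i j (?\<Omega> - D) \<in> borel_measurable Q"
      unfolding diff[abs_def] using compl.IH top by (intro borel_measurable_minus_ennreal) blast+
    have "compensator T i j ?\<Omega> = compensator T i j D + compensator T i j (?\<Omega> - D)"
      unfolding compensator_def ind distrib_right by (rule nn_integral_add[OF L[OF DPA(1)] L[OF DPA(2)]])
    moreover have "(\<integral>\<^sup>+\<omega>. jump_count T i j ?\<Omega> \<omega> \<partial>Q) =
      (\<integral>\<^sup>+\<omega>. jump_count T i j D \<omega> \<partial>Q) + (\<integral>\<^sup>+\<omega>. jump_count T i j (?\<Omega> - D) \<omega> \<partial>Q)"
      unfolding add using compl.IH m by (intro nn_integral_add) blast+
    ultimately have "compensator T i j D + (\<integral>\<^sup>+\<omega>. jump_count T i j (?\<Omega> - D) \<omega> \<partial>Q)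
      = compensator T i j D + compensator T i j (?\<Omega> - D)"
      using conjunct2[OF top] conjunct2[OF compl.IH] by (simp only:)
    then have "(\<integral>\<^sup>+\<omega>. jump_count T i j (?\<Omega> - D) \<omega> \<partial>Q) = compensator T i j (?\<Omega> - D)"
      using finite_compensator[OF T ij, of D] by (auto simp: ennreal_add_left_cancel)
    with m show ?case by simp
  next
    case (union E)
    have EPA: "E n \<in> sets PA" for n using union.hyps(2) by (auto simp: sets_PA)
    have ind: "indicator (\<Union>n. E n) p = (\<Sum>n. indicator (E n) p :: ennreal)" for p
      using suminf_indicator[OF union.hyps(1), of p] by simp
    have jc: "jump_count T i j (\<Union>n. E n) \<omega> = (\<Sum>n. jump_count T i j (E n) \<omega>)" for \<omega>
      unfolding jump_count_def ind by (rule suminf_sum[symmetric]) simp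
    have m: "jump_count T i j (E n) \<in> borel_measurable Q" for n using union.IH by blast
    have "(\<integral>\<^sup>+\<omega>. jump_count T i j (\<Union>n. E n) \<omega> \<partial>Q) = (\<Sum>n. \<integral>\<^sup>+\<omega>. jump_count T i j (E n) \<omega> \<partial>Q)"
      unfolding jc by (rule nn_integral_suminf[OF m])
    also have "\<dots> = (\<Sum>n. compensator T i j (E n))" using union.IH by simp
    also have "\<dots> = compensator T i j (\<Union>n. E n)"
      unfolding compensator_def ind ennreal_suminf_multc[symmetric]
      by (rule nn_integral_suminf[symmetric, OF L[OF EPA]])
    finally show ?case using m unfolding jc[abs_def] by (simp add: borel_measurable_suminf)
  qed
qed

text \<open>This turns agreement of \<open>Z\<close> and \<open>\<zeta>\<close> at the jumps of \<open>X\<close> into equivalence up to \<open>M\<close>, and back.\<close>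

corollary AE_jumps_iff_AE_intensity:
  assumes T: "0 \<le> T" and ij: "i \<noteq> j" and D: "D \<in> sets PA"
  shows "(AE \<omega> in Q. \<forall>r\<in>jumps_of (from_to j i) \<omega> 0 T. (r, \<omega>) \<notin> D) \<longleftrightarrow>
    (AE (u, \<omega>) in L. 0 < u \<and> u \<le> T \<and> left_lim X u \<omega> = axis j 1 \<and> (u, \<omega>) \<in> D \<longrightarrow> A u $ i $ j = 0)"
proof -
  note c = compensator[OF T ij D]
  have DL: "D \<in> sets (borel \<Otimes>\<^sub>M Q)" using D PA_subset by blast
  then have "(\<lambda>p. indicator D p * ennreal (intensity T i j p)) \<in> borel_measurable (borel \<Otimes>\<^sub>M Q)"
    using measurable_intensity[OF T, of i j] by measurable
  then have mL: "(\<lambda>p. indicator D p * ennreal (intensity T i j p)) \<in> borel_measurable L"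
    by (simp add: measurable_cong_sets[OF sets_L refl])
  have "(AE \<omega> in Q. \<forall>r\<in>jumps_of (from_to j i) \<omega> 0 T. (r, \<omega>) \<notin> D) \<longleftrightarrow> (AE \<omega> in Q. jump_count T i j D \<omega> = 0)"
  proof (rule AE_cong)
    fix \<omega> assume "\<omega> \<in> space Q"
    then have "finite (jumps_of (from_to j i) \<omega> 0 T)" using finite_jumps_of by simp
    then show "(\<forall>r\<in>jumps_of (from_to j i) \<omega> 0 T. (r, \<omega>) \<notin> D) \<longleftrightarrow> jump_count T i j D \<omega> = 0"
      unfolding jump_count_def by (simp add: sum_eq_0_iff indicator_eq_0_iff)
  qed
  \<comment> \<open>A nonnegative function has integral zero iff it vanishes almost everywhere; this
    is used for the count and then for the intensity.\<close>
  also have "\<dots> \<longleftrightarrow> compensator T i j D = 0"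
    using nn_integral_0_iff_AE[OF conjunct1[OF c]] conjunct2[OF c] by simp
  also have "\<dots> \<longleftrightarrow> (AE p in L. indicator D p * ennreal (intensity T i j p) = 0)"
    unfolding compensator_def by (rule nn_integral_0_iff_AE[OF mL])
  also have "\<dots> \<longleftrightarrow> (AE (u, \<omega>) in L. 0 < u \<and> u \<le> T \<and> left_lim X u \<omega> = axis j 1 \<and> (u, \<omega>) \<in> D \<longrightarrow> A u $ i $ j = 0)"
  proof -
    \<comment> \<open>Almost everywhere the current state is the left limit, so the factor
      \<open>X\<close> of the intensity can be read as the event on
      \<open>left_lim X\<close>.\<close>
    have ev: "AE p in L. (indicator D p * ennreal (intensity T i j p) = 0) \<longleftrightarrow>
      (case p of (u, \<omega>) \<Rightarrow> 0 < u \<and> u \<le> T \<and> left_lim X u \<omega> = axis j 1 \<and> (u, \<omega>) \<in> D \<longrightarrow> A u $ i $ j = 0)"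
      using AE_pair_no_jump AE_space[of L]
    proof eventually_elim
      case (elim p)
      obtain u \<omega> where p: "p = (u, \<omega>)" "\<omega> \<in> space P" using elim(2) by (cases p) (auto simp: space_pair_measure)
      show ?case
      proof (cases "0 < u \<and> u \<le> T")
        case True
        have "X u \<omega> $ j = indicator (at_state u j) \<omega>" using X_nth[of u \<omega> j] True p by simp
        moreover have "left_lim X u \<omega> = X u \<omega>" using elim(1) True p by simp
        moreover have "0 \<le> A u $ i $ j" using rates_nonneg[OF _ ij] True by simp
        ultimately show ?thesis using True p
          by (auto simp: intensity_def indicator_def at_state_def ennreal_eq_0_iff)
      next
        case False
        then show ?thesis using p by (auto simp: intensity_def indicator_def)
      qed
    qed
    show ?thesis
    proof
      assume "AE p in L. indicator D p * ennreal (intensity T i j p) = 0"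
      with ev show "AE (u, \<omega>) in L. 0 < u \<and> u \<le> T \<and> left_lim X u \<omega> = axis j 1 \<and> (u, \<omega>) \<in> D \<longrightarrow> A u $ i $ j = 0"
        by eventually_elim (rule iffD1)
    next
      assume "AE (u, \<omega>) in L. 0 < u \<and> u \<le> T \<and> left_lim X u \<omega> = axis j 1 \<and> (u, \<omega>) \<in> D \<longrightarrow> A u $ i $ j = 0"
      with ev show "AE p in L. indicator D p * ennreal (intensity T i j p) = 0"
        by eventually_elim (rule iffD2)
    qed
  qed
  finally show ?thesis .
qed

end

section \<open>The seminorm of the martingale\<close>

lemma diag_mult_vec: "(diag v *v z) $ a = v $ a * z $ a"
  by (simp add: diag_def matrix_vector_mult_def if_distrib[of "\<lambda>x. x * _"] cong: if_cong)

lemma time_set_cases: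
  assumes "time_set I"
  shows "0 \<in> I" "I \<subseteq> {0..}" "I \<in> sets borel" "\<And>a b. a \<in> I \<Longrightarrow> b \<in> I \<Longrightarrow> {a..b} \<subseteq> I"
    "\<And>t. t \<in> I \<Longrightarrow> {0..t} \<subseteq> I"
  using assms unfolding time_set_def by auto

text \<open>Countably many horizons inside \<open>I\<close> reduce almost-everywhere statements on
  \<open>I\<close> to bounded intervals; a bounded \<open>I\<close> repeats its last time.\<close>

lemma time_set_exhaust:
  assumes "time_set I"
  obtains T :: "nat \<Rightarrow> real" where "\<forall>n. T n \<in> I" "\<forall>t\<in>I. eventually (\<lambda>n. t \<le> T n) sequentially"
proof (cases "I = {0..}")
  case True
  have "eventually (\<lambda>n. t \<le> real n) sequentially" for t
    using filterlim_real_sequentially by (simp add: filterlim_at_top)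
  then show ?thesis using True by (intro that[of real]) simp_all
next
  case False
  then obtain S where "S > 0" "I = {0..S}" using assms by (auto simp: time_set_def)
  then show ?thesis by (intro that[of "\<lambda>_. S"]) simp_all
qed

context markov_chain
begin

lemma M_norm_eq:
  assumes "0 \<le> t" "left_lim X t \<omega> = axis j 1"
  shows "M_norm A X t \<omega> z = sqrt (\<Sum>i\<in>UNIV. A t $ i $ j * (z $ i - z $ j)\<^sup>2)"
proof -
  let ?e = "axis j 1 :: real^'n"
  have zero: "(\<Sum>i\<in>UNIV. A t $ i $ j) = 0" using rates assms(1) by (simp add: rate_matrix_def)
  have Ae: "(A t *v ?e) $ a = A t $ a $ j" for a by (simp add: matrix_vector_mult_basis column_def)
  have de: "diag ?e *v x = (x $ j) *\<^sub>R ?e" for x :: "real^'n"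
    by (simp add: vec_eq_iff diag_mult_vec axis_def)
  have "(bracket_density A X t \<omega> *v z) = diag (A t *v ?e) *v z - z $ j *\<^sub>R (A t *v ?e) - (transpose (A t) *v z) $ j *\<^sub>R ?e"
    unfolding bracket_density_def assms(2)
    by (simp add: matrix_vector_mult_diff_rdistrib de matrix_vector_mult_scaleR flip: matrix_vector_mul_assoc)
  then have "z \<bullet> (bracket_density A X t \<omega> *v z) =
    z \<bullet> (diag (A t *v ?e) *v z) - z $ j * (z \<bullet> (A t *v ?e)) - (transpose (A t) *v z) $ j * (z \<bullet> ?e)"
    by (simp add: inner_diff_right)
  also have "\<dots> = (\<Sum>i\<in>UNIV. A t $ i $ j * (z $ i)\<^sup>2) - 2 * z $ j * (\<Sum>i\<in>UNIV. A t $ i $ j * z $ i)"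
  proof -
    have "z \<bullet> (diag (A t *v ?e) *v z) = (\<Sum>i\<in>UNIV. A t $ i $ j * (z $ i)\<^sup>2)"
      by (simp add: inner_vec_def diag_mult_vec Ae power2_eq_square mult.left_commute)
    moreover have "z \<bullet> (A t *v ?e) = (\<Sum>i\<in>UNIV. A t $ i $ j * z $ i)"
      by (simp add: inner_vec_def Ae mult.commute)
    moreover have "(transpose (A t) *v z) $ j = (\<Sum>i\<in>UNIV. A t $ i $ j * z $ i)"
      by (simp add: matrix_vector_mult_def transpose_def)
    moreover have "z \<bullet> ?e = z $ j" by (simp add: inner_axis)
    ultimately show ?thesis by simp
  qed
  \<comment> \<open>Adding \<open>(z $ j)\<^sup>2\<close> times the column sum, which is zero,
    completes the square.\<close>
  also have "\<dots> = (\<Sum>i\<in>UNIV. A t $ i $ j * (z $ i)\<^sup>2) - 2 * z $ j * (\<Sum>i\<in>UNIV. A t $ i $ j * z $ i)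
    + (z $ j)\<^sup>2 * (\<Sum>i\<in>UNIV. A t $ i $ j)" by (simp add: zero)
  also have "\<dots> = (\<Sum>i\<in>UNIV. A t $ i $ j * (z $ i)\<^sup>2 - 2 * z $ j * (A t $ i $ j * z $ i) + (z $ j)\<^sup>2 * A t $ i $ j)"
    by (simp only: sum.distrib sum_subtractf sum_distrib_left)
  also have "\<dots> = (\<Sum>i\<in>UNIV. A t $ i $ j * (z $ i - z $ j)\<^sup>2)"
    by (intro sum.cong refl) (simp add: power2_eq_square algebra_simps)
  finally show ?thesis unfolding M_norm_def by simp
qed

lemma M_norm_eq_0_iff:
  assumes "0 \<le> t" "left_lim X t \<omega> = axis j 1"
  shows "M_norm A X t \<omega> z = 0 \<longleftrightarrow> (\<forall>i. i \<noteq> j \<longrightarrow> A t $ i $ j = 0 \<or> z $ i = z $ j)"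
proof -
  \<comment> \<open>The diagonal rate is nonpositive, but its factor is zero.\<close>
  have nn: "0 \<le> A t $ i $ j * (z $ i - z $ j)\<^sup>2" for i
    using rates_nonneg[OF assms(1), of i j] by (cases "i = j") simp_all
  have "M_norm A X t \<omega> z = 0 \<longleftrightarrow> (\<Sum>i\<in>UNIV. A t $ i $ j * (z $ i - z $ j)\<^sup>2) = 0"
    unfolding M_norm_eq[OF assms] by simp
  also have "\<dots> \<longleftrightarrow> (\<forall>i. A t $ i $ j * (z $ i - z $ j)\<^sup>2 = 0)"
    using nn by (subst sum_nonneg_eq_0_iff) simp_all
  finally show ?thesis by auto
qed

text \<open>The columns of \<open>A\<close> sum to zero, so pairing with the drift of
  \<open>X\<close> sees only differences of components, and only where the rate is nonzero.\<close>

lemma M_norm_eq_0_drift: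
  assumes "0 \<le> t" "\<omega> \<in> space P" "M_norm A X t \<omega> (z - z') = 0"
  shows "z \<bullet> (A t *v left_lim X t \<omega>) = z' \<bullet> (A t *v left_lim X t \<omega>)"
proof -
  obtain j where j: "left_lim X t \<omega> = axis j 1" using left_lim_Basis[OF assms(1,2)] by (auto simp: Basis_vec_real)
  have zero: "(\<Sum>i\<in>UNIV. A t $ i $ j) = 0" using rates assms(1) by (simp add: rate_matrix_def)
  have "A t $ i $ j * (z - z') $ i = A t $ i $ j * (z - z') $ j" for i
    using M_norm_eq_0_iff[OF assms(1) j, of "z - z'"] assms(3) by (cases "i = j") auto
  then have "(\<Sum>i\<in>UNIV. A t $ i $ j * (z - z') $ i) = (\<Sum>i\<in>UNIV. A t $ i $ j * (z - z') $ j)"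
    by (rule sum.cong[OF refl])
  moreover have "(z - z') \<bullet> (A t *v axis j 1) = (\<Sum>i\<in>UNIV. A t $ i $ j * (z - z') $ i)"
    by (simp add: inner_vec_def matrix_vector_mult_basis column_def mult.commute)
  ultimately have "(z - z') \<bullet> (A t *v axis j 1) = (\<Sum>i\<in>UNIV. A t $ i $ j * (z - z') $ j)"
    by (rule trans[rotated])
  also have "\<dots> = 0" unfolding sum_distrib_right[symmetric] zero by simp
  finally show ?thesis using j by (simp add: inner_diff_left)
qed

text \<open>Brings equivalence into the form of \<open>AE_jumps_iff_AE_intensity\<close>, with a
  separate condition for each of the finitely many pairs of states.\<close>

lemma sim_M_iff_intensity:
  assumes I: "time_set I"
  shows "sim_M P X A I Z Z' \<longleftrightarrow> (\<forall>i j. i \<noteq> j \<longrightarrow>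
    (AE (u, \<omega>) in L. u \<in> I \<and> left_lim X u \<omega> = axis j 1 \<and> (Z u \<omega> - Z' u \<omega>) \<bullet> (axis i 1 - axis j 1) \<noteq> 0
      \<longrightarrow> A u $ i $ j = 0))"
proof -
  have I0: "u \<in> I \<Longrightarrow> 0 \<le> u" for u using time_set_cases(2)[OF I] by auto
  have diff: "z \<bullet> (axis i 1 - axis j 1) = z $ i - z $ j" for z :: "real^'n" and i j
    by (simp add: inner_diff_right inner_axis)
  have "sim_M P X A I Z Z' \<longleftrightarrow> (AE p in L. \<forall>i j. i \<noteq> j \<longrightarrow> (case p of (u, \<omega>) \<Rightarrow>
    u \<in> I \<and> left_lim X u \<omega> = axis j 1 \<and> (Z u \<omega> - Z' u \<omega>) \<bullet> (axis i 1 - axis j 1) \<noteq> 0 \<longrightarrow> A u $ i $ j = 0))"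
    unfolding sim_M_def
  proof (rule AE_cong)
    fix p :: "real \<times> 'a" assume "p \<in> space L"
    then obtain u \<omega> where p: "p = (u, \<omega>)" "\<omega> \<in> space P" by (cases p) (auto simp: space_pair_measure)
    show "(case p of (u, \<omega>) \<Rightarrow> u \<in> I \<longrightarrow> M_norm A X u \<omega> (Z u \<omega> - Z' u \<omega>) = 0) \<longleftrightarrow>
      (\<forall>i j. i \<noteq> j \<longrightarrow> (case p of (u, \<omega>) \<Rightarrow>
    u \<in> I \<and> left_lim X u \<omega> = axis j 1 \<and> (Z u \<omega> - Z' u \<omega>) \<bullet> (axis i 1 - axis j 1) \<noteq> 0 \<longrightarrow> A u $ i $ j = 0))"
    proof (cases "u \<in> I")
      case True
      obtain k where k: "left_lim X u \<omega> = axis k 1"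
        using left_lim_Basis[OF I0[OF True] p(2)] by (auto simp: Basis_vec_real)
      show ?thesis unfolding p prod.case M_norm_eq_0_iff[OF I0[OF True] k] diff k
        using True by (auto simp: axis_eq_axis)
    qed (simp add: p)
  qed
  also have "\<dots> \<longleftrightarrow> (\<forall>i j. i \<noteq> j \<longrightarrow> (AE (u, \<omega>) in L. u \<in> I \<and> left_lim X u \<omega> = axis j 1 \<and>
      (Z u \<omega> - Z' u \<omega>) \<bullet> (axis i 1 - axis j 1) \<noteq> 0 \<longrightarrow> A u $ i $ j = 0))"
  proof -
    have imp: "(AE p in L. c \<longrightarrow> R p) \<longleftrightarrow> (c \<longrightarrow> (AE p in L. R p))" for c and R :: "real \<times> 'a \<Rightarrow> bool"
      by (cases c) simp_all
    show ?thesis unfolding AE_all_countable imp ..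
  qed
  finally show ?thesis .
qed

section \<open>Predictability of deterministic functions, fixed times and the jump criterion\<close>

lemma measurable_fst_PA: "fst \<in> borel_measurable PA"
proof (rule borel_measurableI_le)
  fix a :: real
  have S: "space P \<in> sets (F s)" for s using sets.top[of "F s"] by simp
  show "{p \<in> space PA. fst p \<le> a} \<in> sets PA"
  proof (cases "0 \<le> a")
    case True
    have "{0<..a} \<times> space P \<in> sets PA" "{0} \<times> space P \<in> sets PA"
      unfolding sets_PA using True S by (auto intro!: sigma_sets.Basic simp: rectangles_def)
    moreover have "{p \<in> space PA. fst p \<le> a} = {0<..a} \<times> space P \<union> {0} \<times> space P"
      using True by (auto simp: space_PA)
    ultimately show ?thesis by (simp add: sets.Un)
  next
    case False
    then have "{p \<in> space PA. fst p \<le> a} = {}" by (auto simp: space_PA)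
    then show ?thesis by (simp only: sets.empty_sets)
  qed
qed

text \<open>The slice at time \<open>t\<close> is predictable and null in time, hence carries no
  intensity and almost surely no jump.\<close>

lemma no_fixed_jump:
  assumes "0 < t" shows "AE \<omega> in Q. left_lim X t \<omega> = X t \<omega>"
proof -
  have D: "{p \<in> space PA. fst p = t} \<in> sets PA" using measurable_fst_PA by measurable
  have "AE \<omega> in Q. \<forall>r\<in>jumps_of (from_to j i) \<omega> 0 t. (r, \<omega>) \<notin> {p \<in> space PA. fst p = t}" if "i \<noteq> j" for i j
  proof (rule AE_jumps_iff_AE_intensity[OF less_imp_le[OF assms] that D, THEN iffD2])
    have "AE (u, \<omega>) in L. u \<noteq> t"
      by (rule AE_pair_if_AE_paths) (use AE_lborel_singleton[of t] in simp_all)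
    then show "AE (u, \<omega>) in L. 0 < u \<and> u \<le> t \<and> left_lim X u \<omega> = axis j 1 \<and> (u, \<omega>) \<in> {p \<in> space PA. fst p = t} \<longrightarrow> A u $ i $ j = 0"
      by eventually_elim auto
  qed
  then have "AE \<omega> in Q. \<forall>i j. i \<noteq> j \<longrightarrow> (\<forall>r\<in>jumps_of (from_to j i) \<omega> 0 t. (r, \<omega>) \<notin> {p \<in> space PA. fst p = t})"
    by (auto simp: AE_all_countable)
  moreover have "AE \<omega> in Q. \<omega> \<in> space P" using AE_space[of Q] by simp
  ultimately show ?thesis
  proof eventually_elim
    case (elim \<omega>)
    show ?case
    proof (rule ccontr)
      assume "left_lim X t \<omega> \<noteq> X t \<omega>"
      then have "t \<in> jumps \<omega> 0 t" using assms by (auto simp: jumps_def)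
      then obtain i j where "i \<noteq> j" "t \<in> jumps_of (from_to j i) \<omega> 0 t"
        using jumps_eq_Union[OF elim(2), of 0 t] by auto
      then have "(t, \<omega>) \<notin> {p \<in> space PA. fst p = t}" using elim(1) by blast
      then show False using elim(2) assms by (simp add: space_PA)
    qed
  qed
qed

lemma sim_M_iff_jumps:
  assumes I: "time_set I" and Z: "predictable P X Z"
    and \<zeta>: "(\<lambda>t. indicator I t *\<^sub>R \<zeta> t) \<in> borel_measurable borel"
  shows "sim_M P X A I Z (\<lambda>t \<omega>. \<zeta> t) \<longleftrightarrow>
    (AE \<omega> in Q. \<forall>r\<in>I. 0 < r \<longrightarrow> Z r \<omega> \<bullet> (X r \<omega> - left_lim X r \<omega>) = \<zeta> r \<bullet> (X r \<omega> - left_lim X r \<omega>))"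
proof -
  let ?\<zeta> = "\<lambda>t. indicator I t *\<^sub>R \<zeta> t"
  \<comment> \<open>The predictable set where \<open>Z\<close> and \<open>\<zeta>\<close> differ in
    the direction of a jump from \<open>j\<close> to \<open>i\<close>. The indicator is there
    because \<open>\<zeta>\<close> is controlled on \<open>I\<close> only.\<close>
  define D where "D i j = {p \<in> space PA. fst p \<in> I \<and>
    ((case p of (t, \<omega>) \<Rightarrow> Z t \<omega>) - ?\<zeta> (fst p)) \<bullet> (axis i 1 - axis j 1) \<noteq> 0}" for i j :: 'n
  have D: "D i j \<in> sets PA" for i j
  proof -
    have [measurable]: "(\<lambda>p. case p of (t, \<omega>) \<Rightarrow> Z t \<omega>) \<in> borel_measurable PA"
      using Z by (simp add: predictable_def)
    have [measurable]: "(\<lambda>p. ?\<zeta> (fst p)) \<in> borel_measurable PA"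
      by (rule measurable_compose[OF measurable_fst_PA \<zeta>])
    have [measurable]: "I \<in> sets borel" by (rule time_set_cases(3)[OF I])
    note measurable_fst_PA[measurable]
    show ?thesis unfolding D_def by measurable
  qed
  have Din: "(u, \<omega>) \<in> D i j \<longleftrightarrow> u \<in> I \<and> (Z u \<omega> - \<zeta> u) \<bullet> (axis i 1 - axis j 1) \<noteq> 0" if "\<omega> \<in> space P" for u \<omega> i j
    using time_set_cases(2)[OF I] that by (auto simp: D_def space_PA)
  have "sim_M P X A I Z (\<lambda>t \<omega>. \<zeta> t) \<longleftrightarrow> (\<forall>i j. i \<noteq> j \<longrightarrow> (\<forall>T::nat.
     AE (u, \<omega>) in L. 0 < u \<and> u \<le> real T \<and> left_lim X u \<omega> = axis j 1 \<and> (u, \<omega>) \<in> D i j \<longrightarrow> A u $ i $ j = 0))"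
    unfolding sim_M_iff_intensity[OF I]
  proof (intro all_cong1 imp_cong refl)
    fix i j :: 'n
    \<comment> \<open>Jumps are positive times whereas \<open>I\<close> contains zero; the slice at
      zero is null.\<close>
    have nz: "AE (u, \<omega>) in L. u \<noteq> 0"
      by (rule AE_pair_if_AE_paths) (use AE_lborel_singleton[of 0] in simp_all)
    have "(AE (u, \<omega>) in L. u \<in> I \<and> left_lim X u \<omega> = axis j 1 \<and> (Z u \<omega> - \<zeta> u) \<bullet> (axis i 1 - axis j 1) \<noteq> 0 \<longrightarrow> A u $ i $ j = 0)
      \<longleftrightarrow> (AE p in L. \<forall>T::nat. case p of (u, \<omega>) \<Rightarrow> 0 < u \<and> u \<le> real T \<and> left_lim X u \<omega> = axis j 1 \<and> (u, \<omega>) \<in> D i j \<longrightarrow> A u $ i $ j = 0)"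
      (is "(AE p in L. ?l p) \<longleftrightarrow> (AE p in L. ?r p)")
    proof -
      have ev: "AE p in L. ?l p \<longleftrightarrow> ?r p"
        using nz AE_space[of L]
      proof eventually_elim
        case (elim p)
        obtain u \<omega> where p: "p = (u, \<omega>)" "\<omega> \<in> space P" "u \<noteq> 0" using elim by (cases p) (auto simp: space_pair_measure)
        obtain T where T: "u \<le> real (T::nat)" using real_arch_simple by blast
        have "u \<in> I \<Longrightarrow> 0 < u" using time_set_cases(2)[OF I] p(3) by force
        then show ?case unfolding p(1) prod.case Din[OF p(2)] using T by blast
      qed
      show ?thesis
      proof
        assume "AE p in L. ?l p"
        with ev show "AE p in L. ?r p" by eventually_elim (rule iffD1)
      next
        assume "AE p in L. ?r p"
        with ev show "AE p in L. ?l p" by eventually_elim (rule iffD2)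
      qed
    qed
    also have "\<dots> \<longleftrightarrow> (\<forall>T::nat. AE (u, \<omega>) in L. 0 < u \<and> u \<le> real T \<and> left_lim X u \<omega> = axis j 1 \<and> (u, \<omega>) \<in> D i j \<longrightarrow> A u $ i $ j = 0)"
      by (rule AE_all_countable)
    finally show "(AE (u, \<omega>) in L. u \<in> I \<and> left_lim X u \<omega> = axis j 1 \<and> (Z u \<omega> - \<zeta> u) \<bullet> (axis i 1 - axis j 1) \<noteq> 0 \<longrightarrow> A u $ i $ j = 0)
      \<longleftrightarrow> (\<forall>T::nat. AE (u, \<omega>) in L. 0 < u \<and> u \<le> real T \<and> left_lim X u \<omega> = axis j 1 \<and> (u, \<omega>) \<in> D i j \<longrightarrow> A u $ i $ j = 0)" .
  qed
  also have "\<dots> \<longleftrightarrow> (\<forall>i j. i \<noteq> j \<longrightarrow> (\<forall>T::nat. AE \<omega> in Q. \<forall>r\<in>jumps_of (from_to j i) \<omega> 0 (real T). (r, \<omega>) \<notin> D i j))"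
    using AE_jumps_iff_AE_intensity[OF _ _ D] by simp
  also have "\<dots> \<longleftrightarrow> (AE \<omega> in Q. \<forall>i j. i \<noteq> j \<longrightarrow> (\<forall>T::nat. \<forall>r\<in>jumps_of (from_to j i) \<omega> 0 (real T). (r, \<omega>) \<notin> D i j))"
    by (auto simp: AE_all_countable)
  also have "\<dots> \<longleftrightarrow> (AE \<omega> in Q. \<forall>r\<in>I. 0 < r \<longrightarrow> Z r \<omega> \<bullet> (X r \<omega> - left_lim X r \<omega>) = \<zeta> r \<bullet> (X r \<omega> - left_lim X r \<omega>))"
  proof (rule AE_cong)
    fix \<omega> assume "\<omega> \<in> space Q"
    then have \<omega>: "\<omega> \<in> space P" by simp
    show "(\<forall>i j. i \<noteq> j \<longrightarrow> (\<forall>T::nat. \<forall>r\<in>jumps_of (from_to j i) \<omega> 0 (real T). (r, \<omega>) \<notin> D i j)) \<longleftrightarrow>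
      (\<forall>r\<in>I. 0 < r \<longrightarrow> Z r \<omega> \<bullet> (X r \<omega> - left_lim X r \<omega>) = \<zeta> r \<bullet> (X r \<omega> - left_lim X r \<omega>))"
      (is "?l \<longleftrightarrow> ?r")
    proof
      assume l: ?l
      show ?r
      proof (intro ballI impI)
        fix r assume r: "r \<in> I" "0 < r"
        show "Z r \<omega> \<bullet> (X r \<omega> - left_lim X r \<omega>) = \<zeta> r \<bullet> (X r \<omega> - left_lim X r \<omega>)"
        proof (cases "X r \<omega> = left_lim X r \<omega>")
          case False
          obtain T :: nat where T: "r \<le> real T" using real_arch_simple by blast
          then have "r \<in> jumps \<omega> 0 (real T)" using r False by (simp add: jumps_def)
          then obtain i j where ij: "i \<noteq> j" "r \<in> jumps_of (from_to j i) \<omega> 0 (real T)"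
            using jumps_eq_Union[OF \<omega>, of 0 "real T"] by auto
          then have "(r, \<omega>) \<notin> D i j" using l by blast
          then have "(Z r \<omega> - \<zeta> r) \<bullet> (axis i 1 - axis j 1) = 0" using Din[OF \<omega>] r(1) by blast
          moreover have "X r \<omega> = axis i 1" "left_lim X r \<omega> = axis j 1"
            using ij(2) by (simp_all add: jumps_of_def from_to_def)
          ultimately show ?thesis by (simp add: inner_diff_left)
        qed simp
      qed
    next
      assume r: ?r
      show ?l
      proof (intro allI impI ballI)
        fix i j :: 'n and T :: nat and q assume q: "q \<in> jumps_of (from_to j i) \<omega> 0 (real T)"
        then have "0 < q" and "X q \<omega> = axis i 1" "left_lim X q \<omega> = axis j 1"
          by (simp_all add: jumps_of_def from_to_def jumps_def)
        moreover have "q \<in> I \<Longrightarrow> Z q \<omega> \<bullet> (X q \<omega> - left_lim X q \<omega>) = \<zeta> q \<bullet> (X q \<omega> - left_lim X q \<omega>)"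
          using r \<open>0 < q\<close> by blast
        ultimately have "q \<in> I \<Longrightarrow> (Z q \<omega> - \<zeta> q) \<bullet> (axis i 1 - axis j 1) = 0"
          by (simp add: inner_diff_left)
        then show "(q, \<omega>) \<notin> D i j" using Din[OF \<omega>] by blast
      qed
    qed
  qed
  finally show ?thesis .
qed

end

section \<open>Solutions along paths\<close>

lemma indefinite_integral_tendsto_left:
  fixes f w :: "real \<Rightarrow> real"
  assumes "a < t" "set_integrable lborel {a..t} w"
    and f: "\<forall>s\<in>{a..t}. f s - f a = (LINT x:{a..s}|lborel. w x)"
  shows "(f \<longlongrightarrow> f t) (at_left t)"
proof -
  have "((\<lambda>s. f a + (LINT x:{a..s}|lborel. w x)) \<longlongrightarrow> f a + (LINT x:{a..t}|lborel. w x)) (at_left t)"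
    by (intro tendsto_add tendsto_const set_integral_tendsto_left assms)
  moreover have "f a + (LINT x:{a..t}|lborel. w x) = f t" using f[rule_format, of t] assms(1) by simp
  moreover have "eventually (\<lambda>s. f a + (LINT x:{a..s}|lborel. w x) = f s) (at_left t)"
    unfolding eventually_at_left_field
  proof (intro exI[of _ a] conjI allI impI assms(1))
    fix s assume "a < s" "s < t"
    then show "f a + (LINT x:{a..s}|lborel. w x) = f s" using f[rule_format, of s] by simp
  qed
  ultimately show ?thesis using Lim_transform_eventually by metis
qed

text \<open>Components of states other than the initial one may be unbounded near zero. Continuity
  is therefore used on the compact sets \<open>S n\<close> away from zero, and the value at zero is
  attached separately.\<close>

lemma indefinite_integral_measurable:
  fixes f w :: "real \<Rightarrow> real"
  assumes I: "time_set I"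
    and f: "\<forall>a\<in>I \<inter> {0<..}. \<forall>b\<in>I \<inter> {0<..}. a \<le> b \<longrightarrow>
      set_integrable lborel {a..b} w \<and> f b - f a = (LINT x:{a..b}|lborel. w x)"
  shows "(\<lambda>t. indicator I t * f t) \<in> borel_measurable borel"
proof -
  obtain T :: "nat \<Rightarrow> real" where T: "\<forall>n. T n \<in> I" "\<forall>t\<in>I. eventually (\<lambda>n. t \<le> T n) sequentially"
    by (rule time_set_exhaust[OF I])
  define S where "S n = {1 / real (Suc n)..T n}" for n
  have SI: "S n \<subseteq> I \<inter> {0<..}" for n
  proof
    fix t assume t: "t \<in> S n"
    have "0 < 1 / real (Suc n)" by simp
    moreover have "1 / real (Suc n) \<le> t" "t \<le> T n" using t by (simp_all add: S_def)
    ultimately have "0 < t" "t \<le> T n" by (blast intro: less_le_trans)+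
    then show "t \<in> I \<inter> {0<..}" using time_set_cases(5)[OF I, of "T n"] T(1) by auto
  qed
  have "continuous_on (S n) f" for n
  proof (cases "S n = {}")
    case False
    let ?a = "1 / real (Suc n)"
    have ab: "?a \<in> S n" "T n \<in> S n" using False by (simp_all add: S_def)
    have "set_integrable lborel {?a..T n} w" using f SI ab by (metis False S_def atLeastatMost_empty_iff in_mono)
    from continuous_on_set_integral[OF this]
    have "continuous_on (S n) (\<lambda>t. f ?a + (LINT u:{?a..t}|lborel. w u))"
      unfolding S_def by (intro continuous_on_add continuous_on_const)
    then show ?thesis
    proof (rule continuous_on_eq)
      fix t assume t: "t \<in> S n"
      then have "?a \<le> t" by (simp add: S_def)
      then have "f t - f ?a = (LINT u:{?a..t}|lborel. w u)" using f SI ab(1) t by blast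
      then show "f ?a + (LINT u:{?a..t}|lborel. w u) = f t" by simp
    qed
  qed simp
  then have m: "(\<lambda>t. indicator (S n) t *\<^sub>R f t) \<in> borel_measurable borel" for n
    by (intro borel_measurable_continuous_on_indicator) (simp_all add: S_def)
  have "(\<lambda>t. indicator (I \<inter> {0<..}) t * f t) \<in> borel_measurable borel"
  proof (rule borel_measurable_LIMSEQ_real[OF _ m])
    fix t :: real
    show "(\<lambda>n. indicator (S n) t *\<^sub>R f t) \<longlonglongrightarrow> indicator (I \<inter> {0<..}) t * f t"
    proof (cases "t \<in> I \<inter> {0<..}")
      case True
      have lim: "(\<lambda>n. 1 / real (Suc n)) \<longlonglongrightarrow> (0::real)"
        using LIMSEQ_inverse_real_of_nat by (simp only: inverse_eq_divide)
      have "0 < t" using True by blast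
      from order_tendstoD(2)[OF lim this] have "eventually (\<lambda>n. 1 / real (Suc n) < t) sequentially" .
      moreover have "eventually (\<lambda>n. t \<le> T n) sequentially" using T(2) True by blast
      ultimately have "eventually (\<lambda>n. indicator (S n) t *\<^sub>R f t = indicator (I \<inter> {0<..}) t * f t) sequentially"
      proof eventually_elim
        case (elim n)
        then have "t \<in> S n" by (simp add: S_def del: of_nat_Suc)
        then show ?case using True by simp
      qed
      then show ?thesis by (rule tendsto_eventually)
    next
      case False
      then have "t \<notin> S n" for n using SI by blast
      then show ?thesis using False by simp
    qed
  qed
  then have "(\<lambda>t. indicator (I \<inter> {0<..}) t * f t + indicator {0} t * f 0) \<in> borel_measurable borel"
    by measurable
  moreover have "indicator (I \<inter> {0<..}) t * f t + indicator {0} t * f 0 = indicator I t * f t" for t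
    using time_set_cases(1,2)[OF I] by (cases "t = 0") (auto simp: indicator_def)
  ultimately show ?thesis by simp
qed

context markov_chain
begin

text \<open>The whole absolutely continuous part of the equation: the driver together with the
  compensating part of \<open>M\<close>.\<close>

definition drift :: "('a \<Rightarrow> real \<Rightarrow> real \<Rightarrow> real^'n \<Rightarrow> real) \<Rightarrow> (real \<Rightarrow> 'a \<Rightarrow> real^'n) \<Rightarrow> (real \<Rightarrow> 'a \<Rightarrow> real)
    \<Rightarrow> 'a \<Rightarrow> real \<Rightarrow> real" where
  "drift f Z Y \<omega> s = - f \<omega> s (left_lim Y s \<omega>) (Z s \<omega>) - Z s \<omega> \<bullet> (A s *v left_lim X s \<omega>)"

text \<open>The equation at a single sample point, with the integral against \<open>M\<close> split
  into jumps and density. Membership in \<open>space P\<close> is included so that the path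
  properties of \<open>X\<close> are at hand.\<close>

definition path_solution :: "real set \<Rightarrow> ('a \<Rightarrow> real \<Rightarrow> real \<Rightarrow> real^'n \<Rightarrow> real) \<Rightarrow> (real \<Rightarrow> 'a \<Rightarrow> real^'n)
    \<Rightarrow> (real \<Rightarrow> 'a \<Rightarrow> real) \<Rightarrow> 'a \<Rightarrow> bool" where
  "path_solution I f Z Y \<omega> \<longleftrightarrow> \<omega> \<in> space P \<and> (\<forall>t\<in>I.
    set_integrable lborel {0..t} (\<lambda>s. f \<omega> s (left_lim Y s \<omega>) (Z s \<omega>)) \<and>
    set_integrable lborel {0..t} (\<lambda>s. Z s \<omega> \<bullet> (A s *v left_lim X s \<omega>)) \<and>
    Y t \<omega> = Y 0 \<omega> + (LINT s:{0..t}|lborel. drift f Z Y \<omega> s) + jump_sum \<omega> (\<lambda>s. Z s \<omega>) 0 t)"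

lemma drift_eq:
  assumes "set_integrable lborel S (\<lambda>s. f \<omega> s (left_lim Y s \<omega>) (Z s \<omega>))"
    "set_integrable lborel S (\<lambda>s. Z s \<omega> \<bullet> (A s *v left_lim X s \<omega>))"
  shows "set_integrable lborel S (drift f Z Y \<omega>)"
    "(LINT s:S|lborel. drift f Z Y \<omega> s) = - (LINT s:S|lborel. f \<omega> s (left_lim Y s \<omega>) (Z s \<omega>))
      - (LINT s:S|lborel. Z s \<omega> \<bullet> (A s *v left_lim X s \<omega>))"
proof -
  note n = set_integral_uminus[OF assms(1)]
  have ni: "set_integrable lborel S (\<lambda>s. - f \<omega> s (left_lim Y s \<omega>) (Z s \<omega>))"
    using assms(1) unfolding set_integrable_def by simp
  show "set_integrable lborel S (drift f Z Y \<omega>)"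
    unfolding drift_def by (rule set_integral_diff(1)[OF ni assms(2)])
  show "(LINT s:S|lborel. drift f Z Y \<omega> s) = - (LINT s:S|lborel. f \<omega> s (left_lim Y s \<omega>) (Z s \<omega>))
      - (LINT s:S|lborel. Z s \<omega> \<bullet> (A s *v left_lim X s \<omega>))"
    unfolding drift_def using set_integral_diff(2)[OF ni assms(2)] n by simp
qed

lemma solves_equation_iff:
  "solves_equation P X A I f y0 Z Y \<longleftrightarrow> (\<forall>t\<in>I. Y t \<in> borel_measurable (F t)) \<and>
     (AE \<omega> in Q. Y 0 \<omega> = y0) \<and> (AE \<omega> in Q. path_solution I f Z Y \<omega>)"
proof -
  have "(AE \<omega> in Q. \<forall>t\<in>I.
        set_integrable lborel {0..t} (\<lambda>s. f \<omega> s (left_lim Y s \<omega>) (Z s \<omega>)) \<and>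
        set_integrable lborel {0..t} (\<lambda>s. Z s \<omega> \<bullet> (A s *v left_lim X s \<omega>)) \<and>
        Y t \<omega> = Y 0 \<omega> - (LINT s:{0..t}|lborel. f \<omega> s (left_lim Y s \<omega>) (Z s \<omega>))
                 + M_integral X A Z t \<omega>) \<longleftrightarrow> (AE \<omega> in Q. path_solution I f Z Y \<omega>)"
  proof (rule AE_cong)
    fix \<omega> assume "\<omega> \<in> space Q"
    then have \<omega>: "\<omega> \<in> space P" by simp
    have tr: "(True \<and> B) = B" for B by simp
    show "(\<forall>t\<in>I.
        set_integrable lborel {0..t} (\<lambda>s. f \<omega> s (left_lim Y s \<omega>) (Z s \<omega>)) \<and>
        set_integrable lborel {0..t} (\<lambda>s. Z s \<omega> \<bullet> (A s *v left_lim X s \<omega>)) \<and>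
        Y t \<omega> = Y 0 \<omega> - (LINT s:{0..t}|lborel. f \<omega> s (left_lim Y s \<omega>) (Z s \<omega>))
                 + M_integral X A Z t \<omega>) \<longleftrightarrow> path_solution I f Z Y \<omega>"
      unfolding path_solution_def eqTrueI[OF \<omega>] tr
    proof (intro ball_cong refl conj_cong)
      fix t assume "set_integrable lborel {0..t} (\<lambda>s. f \<omega> s (left_lim Y s \<omega>) (Z s \<omega>))"
        "set_integrable lborel {0..t} (\<lambda>s. Z s \<omega> \<bullet> (A s *v left_lim X s \<omega>))"
      from drift_eq(2)[of "{0..t}" f \<omega> Y Z, OF this]
      show "(Y t \<omega> = Y 0 \<omega> - (LINT s:{0..t}|lborel. f \<omega> s (left_lim Y s \<omega>) (Z s \<omega>)) + M_integral X A Z t \<omega>)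
        \<longleftrightarrow> (Y t \<omega> = Y 0 \<omega> + (LINT s:{0..t}|lborel. drift f Z Y \<omega> s) + jump_sum \<omega> (\<lambda>s. Z s \<omega>) 0 t)"
        unfolding M_integral_eq[OF \<omega>] jump_sum_def by auto
    qed
  qed
  then show ?thesis unfolding solves_equation_def by simp
qed

lemma path_solution_drift:
  assumes "path_solution I f Z Y \<omega>" "t \<in> I"
  shows "set_integrable lborel {0..t} (drift f Z Y \<omega>)"
  using assms drift_eq(1)[of "{0..t}" f \<omega> Y Z] by (simp add: path_solution_def)

lemma path_solution_equation:
  assumes "path_solution I f Z Y \<omega>" "t \<in> I"
  shows "Y t \<omega> = Y 0 \<omega> + (LINT s:{0..t}|lborel. drift f Z Y \<omega> s) + jump_sum \<omega> (\<lambda>s. Z s \<omega>) 0 t"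
  using assms unfolding path_solution_def by blast

lemma path_solution_tendsto_left:
  assumes I: "time_set I" and Y: "path_solution I f Z Y \<omega>" and t: "t \<in> I" "0 < t"
  shows "((\<lambda>s. Y s \<omega>) \<longlongrightarrow> Y t \<omega> - Z t \<omega> \<bullet> (X t \<omega> - left_lim X t \<omega>)) (at_left t)"
proof (rule path_equation_tendsto_left[OF t(2) _ path_solution_drift[OF Y t(1)], where z="\<lambda>s. Z s \<omega>"])
  show "\<omega> \<in> space P" using Y by (simp add: path_solution_def)
  fix s assume "0 \<le> s" "s \<le> t"
  then have "s \<in> I" using time_set_cases(5)[OF I t(1)] by auto
  then show "Y s \<omega> = Y 0 \<omega> + (LINT u:{0..s}|lborel. drift f Z Y \<omega> u) + jump_sum \<omega> (\<lambda>s. Z s \<omega>) 0 s"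
    by (rule path_solution_equation[OF Y])
qed

lemma path_solution_increment:
  assumes I: "time_set I" and Y: "path_solution I f Z Y \<omega>" and t: "t \<in> I" "0 \<le> s" "s \<le> t"
  shows "Y t \<omega> - Y s \<omega> = (LINT u:{s..t}|lborel. drift f Z Y \<omega> u) + jump_sum \<omega> (\<lambda>s. Z s \<omega>) s t"
proof (rule path_equation_increment[OF t(2,3) _ path_solution_drift[OF Y t(1)], of \<omega> "\<lambda>s. Y s \<omega>" "\<lambda>s. Z s \<omega>"])
  show "\<omega> \<in> space P" using Y by (simp add: path_solution_def)
  fix s assume "0 \<le> s" "s \<le> t"
  then have "s \<in> I" using time_set_cases(5)[OF I t(1)] by auto
  then show "Y s \<omega> = Y 0 \<omega> + (LINT u:{0..s}|lborel. drift f Z Y \<omega> u) + jump_sum \<omega> (\<lambda>s. Z s \<omega>) 0 s"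
    by (rule path_solution_equation[OF Y])
qed

lemma path_solution_left_lim:
  assumes I: "time_set I" and Y: "path_solution I f Z Y \<omega>"
  shows "AE s in lborel. s \<in> I \<longrightarrow> left_lim Y s \<omega> = Y s \<omega>"
proof -
  have \<omega>: "\<omega> \<in> space P" using Y by (simp add: path_solution_def)
  show ?thesis
    using AE_no_jump[OF \<omega>]
  proof eventually_elim
    case (elim s)
    show ?case
    proof
      assume s: "s \<in> I"
      then have "0 \<le> s" using time_set_cases(2)[OF I] by auto
      show "left_lim Y s \<omega> = Y s \<omega>"
      proof (cases "s = 0")
        case False
        then have "0 < s" using \<open>0 \<le> s\<close> by simp
        from path_solution_tendsto_left[OF I Y s this] elim \<open>0 \<le> s\<close>
        have "((\<lambda>s. Y s \<omega>) \<longlongrightarrow> Y s \<omega>) (at_left s)" by simp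
        then show ?thesis by (rule left_lim_eqI[of s Y \<omega>, OF \<open>0 < s\<close>])
      qed (simp add: left_lim_def)
    qed
  qed
qed

section \<open>Measurability along paths and replacement of drivers\<close>

lemma measurable_ident_F: "(\<lambda>\<omega>. \<omega>) \<in> measurable Q (F t)"
  using F_subset_Q[of t] sets.sets_into_space[of _ "F t"] by (intro measurableI) (auto simp: Int_absorb2)

text \<open>Predictable sets are product measurable; the maximum supplies values at negative times,
  which lie outside the predictable algebra.\<close>

lemma measurable_Z_pair:
  assumes "predictable P X Z"
  shows "(\<lambda>p. Z (max 0 (fst p)) (snd p)) \<in> borel_measurable (borel \<Otimes>\<^sub>M Q)"
proof -
  have m0: "(\<lambda>p. (max (0::real) (fst p), snd p)) \<in> measurable (borel \<Otimes>\<^sub>M Q) (borel \<Otimes>\<^sub>M Q)" by measurable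
  have "(\<lambda>p. (max (0::real) (fst p), snd p)) \<in> measurable (borel \<Otimes>\<^sub>M Q) PA"
  proof (rule measurableI)
    fix p :: "real \<times> 'a" assume "p \<in> space (borel \<Otimes>\<^sub>M Q)"
    then show "(max (0::real) (fst p), snd p) \<in> space PA" by (auto simp: space_PA space_pair_measure)
  next
    fix S assume "S \<in> sets PA"
    then show "(\<lambda>p. (max (0::real) (fst p), snd p)) -` S \<inter> space (borel \<Otimes>\<^sub>M Q) \<in> sets (borel \<Otimes>\<^sub>M Q)"
      using PA_subset by (intro measurable_sets[OF m0]) blast
  qed
  from measurable_compose[OF this assms[unfolded predictable_def]] show ?thesis by simp
qed

lemma measurable_Z_path:
  assumes "predictable P X Z" "\<omega> \<in> space P"
  shows "(\<lambda>s. Z s \<omega>) \<in> borel_measurable (restrict_space borel {0..T})"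
proof -
  have "(\<lambda>s. (s, \<omega>)) \<in> measurable (restrict_space borel {0..T}) (borel \<Otimes>\<^sub>M Q)"
    by (intro measurable_Pair measurable_restrict_space1) (use assms(2) in simp_all)
  from measurable_compose[OF this measurable_Z_pair[OF assms(1)]]
  have "(\<lambda>s. Z (max 0 s) \<omega>) \<in> borel_measurable (restrict_space borel {0..T})" by simp
  then show ?thesis
    by (rule measurable_cong[THEN iffD1, rotated]) (simp add: space_restrict_space)
qed

text \<open>The sample point is fixed, so this is a section of the jointly measurable driver
  composed with measurable paths.\<close>

lemma measurable_driver_path:
  assumes h: "progressive_driver P X I h" and Z: "predictable P X Z" and T: "T \<in> I" and \<omega>: "\<omega> \<in> space P"
    and y: "y \<in> borel_measurable (restrict_space borel {0..T})"
  shows "(\<lambda>s. h \<omega> s (y s) (Z s \<omega>)) \<in> borel_measurable (restrict_space borel {0..T})"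
proof -
  have "(\<lambda>s. (\<omega>, s, y s, Z s \<omega>)) \<in> measurable (restrict_space borel {0..T})
      (F T \<Otimes>\<^sub>M restrict_space borel {0..T} \<Otimes>\<^sub>M borel \<Otimes>\<^sub>M borel)"
    by (intro measurable_Pair measurable_const measurable_ident y measurable_Z_path[OF Z \<omega>]) (simp_all add: \<omega>)
  from measurable_compose[OF this h[unfolded progressive_driver_def, rule_format, OF T]] show ?thesis by simp
qed

text \<open>Only the values of a driver along \<open>(Y, Z)\<close> enter the equation. Progressive
  measurability of \<open>h\<close> lets the almost-everywhere equality carry integrability over as
  well.\<close>

lemma replace_driver:
  assumes I: "time_set I" and Y: "solves_equation P X A I f y0 Z Y"
    and h: "progressive_driver P X I h" and Z: "predictable P X Z"
    and eq: "AE \<omega> in Q. AE s in lborel. s \<in> I \<longrightarrow>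
      f \<omega> s (left_lim Y s \<omega>) (Z s \<omega>) = h \<omega> s (left_lim Y s \<omega>) (Z s \<omega>)"
  shows "solves_equation P X A I h y0 Z Y"
proof -
  note Y' = Y[unfolded solves_equation_iff]
  have "AE \<omega> in Q. path_solution I h Z Y \<omega>"
    using conjunct2[OF conjunct2[OF Y']] eq
  proof eventually_elim
    case (elim \<omega>)
    have \<omega>: "\<omega> \<in> space P" using elim(1) by (simp add: path_solution_def)
    have "set_integrable lborel {0..t} (\<lambda>s. h \<omega> s (left_lim Y s \<omega>) (Z s \<omega>)) \<and>
      (LINT s:{0..t}|lborel. drift h Z Y \<omega> s) = (LINT s:{0..t}|lborel. drift f Z Y \<omega> s)" if t: "t \<in> I" for t
    proof -
      have t0: "0 \<le> t" using time_set_cases(2)[OF I] t by auto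
      have fi: "set_integrable lborel {0..t} (\<lambda>s. f \<omega> s (left_lim Y s \<omega>) (Z s \<omega>))"
        and Zi: "set_integrable lborel {0..t} (\<lambda>s. Z s \<omega> \<bullet> (A s *v left_lim X s \<omega>))"
        using elim(1) t by (simp_all add: path_solution_def)
      \<comment> \<open>Left limits exist along a path solution, so \<open>left_lim Y\<close> is a
        measurable path although \<open>Y\<close> is only adapted.\<close>
      have "(\<lambda>s. left_lim Y s \<omega>) \<in> borel_measurable (restrict_space borel {0..t})"
      proof (rule measurable_left_lim_path[OF t0])
        fix r assume "0 < r" "r \<le> t"
        then have "r \<in> I" using time_set_cases(5)[OF I t] by auto
        from path_solution_tendsto_left[OF I elim(1) this \<open>0 < r\<close>]
        show "\<exists>l. ((\<lambda>s. Y s \<omega>) \<longlongrightarrow> l) (at_left r)" by blast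
      qed
      from measurable_driver_path[OF h Z t \<omega> this]
      have m: "(\<lambda>s. indicator {0..t} s *\<^sub>R h \<omega> s (left_lim Y s \<omega>) (Z s \<omega>)) \<in> borel_measurable lborel"
        by (simp add: borel_measurable_restrict_space_iff)
      have ae: "AE s in lborel. indicator {0..t} s *\<^sub>R f \<omega> s (left_lim Y s \<omega>) (Z s \<omega>) =
        indicator {0..t} s *\<^sub>R h \<omega> s (left_lim Y s \<omega>) (Z s \<omega>)"
        using elim(2)
      proof eventually_elim
        case (elim s)
        then show ?case using time_set_cases(5)[OF I t] by (cases "s \<in> {0..t}") auto
      qed
      have hi: "set_integrable lborel {0..t} (\<lambda>s. h \<omega> s (left_lim Y s \<omega>) (Z s \<omega>))"
        unfolding set_integrable_def
        by (rule integrable_cong_AE_imp[OF fi[unfolded set_integrable_def] m ae])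
      have "(LINT s:{0..t}|lborel. h \<omega> s (left_lim Y s \<omega>) (Z s \<omega>)) = (LINT s:{0..t}|lborel. f \<omega> s (left_lim Y s \<omega>) (Z s \<omega>))"
        unfolding set_lebesgue_integral_def
        by (rule integral_cong_AE[symmetric, OF borel_measurable_integrable[OF fi[unfolded set_integrable_def]] m ae])
      then show ?thesis using hi drift_eq(2)[of "{0..t}" h \<omega> Y Z, OF hi Zi] drift_eq(2)[of "{0..t}" f \<omega> Y Z, OF fi Zi] by simp
    qed
    then show ?case using elim(1) unfolding path_solution_def by simp
  qed
  then show ?thesis using Y' by (simp add: solves_equation_iff)
qed


section \<open>Drivers of state functions\<close>

text \<open>The times of \<open>I\<close> at which state \<open>i\<close> has positive probability.
  The start is deterministic, so at time zero exactly one state qualifies.\<close>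

definition state_times :: "real set \<Rightarrow> 'n \<Rightarrow> real set" where
  "state_times I i = (if \<forall>\<omega>\<in>space P. X 0 \<omega> = axis i 1 then I else I \<inter> {0<..})"

lemma state_times:
  assumes "time_set I"
  shows "I \<inter> {0<..} \<subseteq> state_times I i" "state_times I i \<subseteq> I" "is_interval (state_times I i)"
  using assms unfolding state_times_def time_set_def is_interval_1 by auto

lemma in_state_times:
  assumes "time_set I" "t \<in> I" "\<omega> \<in> space P" "X t \<omega> = axis i 1"
  shows "t \<in> state_times I i"
proof (cases "t = 0")
  case True
  obtain x0 where "\<forall>\<omega>\<in>space P. X 0 \<omega> = x0" using deterministic_start by blast
  then have "\<forall>\<omega>\<in>space P. X 0 \<omega> = axis i 1" using assms(3,4) True by metis
  then show ?thesis using assms(2) by (simp add: state_times_def)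
next
  case False
  then have "0 < t" using time_set_cases(2)[OF assms(1)] assms(2) by force
  then show ?thesis using assms(2) by (simp add: state_times_def)
qed

lemma solves_ode_system_iff:
  "solves_ode_system P X A I g \<zeta> \<longleftrightarrow> (\<forall>i. solves_ode_component A g \<zeta> i (state_times I i))"
proof -
  have mono: "solves_ode_component A g \<zeta> i J \<Longrightarrow> J' \<subseteq> J \<Longrightarrow> solves_ode_component A g \<zeta> i J'" for i J J'
    unfolding solves_ode_component_def Let_def by blast
  have "solves_ode_component A g \<zeta> i (I \<inter> {0<..}) \<and>
    ((\<forall>\<omega>\<in>space P. X 0 \<omega> = axis i 1) \<longrightarrow> solves_ode_component A g \<zeta> i I) \<longleftrightarrow>
    solves_ode_component A g \<zeta> i (state_times I i)" for i
    using mono[of i I "I \<inter> {0<..}"] by (auto simp: state_times_def)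
  then show ?thesis unfolding solves_ode_system_def by blast
qed

lemma AE_witness:
  assumes "AE \<omega> in Q. R \<omega>" "S \<in> sets Q" "measure Q S > 0"
  shows "\<exists>\<omega>\<in>S. R \<omega>"
proof (rule ccontr)
  assume "\<not> (\<exists>\<omega>\<in>S. R \<omega>)"
  then have "AE \<omega> in Q. \<omega> \<notin> S" using assms(1) by (auto elim!: eventually_mono)
  then have "S \<in> null_sets Q" using AE_iff_null_sets[OF assms(2)] by blast
  then show False using assms(3) by (simp add: measure_eq_0_null_sets)
qed

text \<open>Allows statements about deterministic functions to be read off single paths. An event of
  positive probability cannot avoid an almost sure property, and every state is charged at its
  \<open>state_times\<close>.\<close>

lemma state_witness:
  assumes I: "time_set I" and R: "AE \<omega> in Q. R \<omega>" and t: "t \<in> state_times I i"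
  obtains \<omega> where "\<omega> \<in> space P" "R \<omega>" "X t \<omega> = axis i 1" "left_lim X t \<omega> = axis i 1"
proof (cases "t = 0")
  case True
  then have X0: "\<forall>\<omega>\<in>space P. X 0 \<omega> = axis i 1"
    using t unfolding state_times_def by (auto split: if_splits)
  have "measure Q (space Q) > 0" using Q.prob_space by simp
  from AE_witness[OF R sets.top this] obtain \<omega> where "\<omega> \<in> space P" "R \<omega>" by auto
  then show ?thesis using X0 True by (intro that[of \<omega>]) (simp_all add: left_lim_def)
next
  case False
  then have t0: "0 < t" using state_times(2)[OF I, of i] t time_set_cases(2)[OF I] by force
  have "{\<omega> \<in> space P. X t \<omega> = axis i 1} \<in> sets P"
    using measurable_sets[OF measurable[OF less_imp_le[OF t0]], of "{axis i 1}"]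
    by (simp add: vimage_def Int_def conj_commute)
  then have "measure Q (at_state t i) > 0"
    using charges_all_states[OF t0, of i] by (simp add: at_state_def)
  moreover have "at_state t i \<in> sets Q" using t0 by (simp add: at_state_Q)
  \<comment> \<open>A fixed time is almost surely not a jump, so this may be demanded of the witness
    too.\<close>
  moreover have "AE \<omega> in Q. R \<omega> \<and> left_lim X t \<omega> = X t \<omega>" using R no_fixed_jump[OF t0] by eventually_elim simp
  ultimately obtain \<omega> where "\<omega> \<in> at_state t i" "R \<omega> \<and> left_lim X t \<omega> = X t \<omega>" using AE_witness by blast
  then show ?thesis by (intro that[of \<omega>]) (simp_all add: at_state_def)
qed

lemma constant_no_jumps:
  assumes "0 \<le> a" "\<forall>r\<in>{a..b}. X r \<omega> = x"
  shows "jumps \<omega> a b = {}"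
proof -
  have "left_lim X r \<omega> = X r \<omega>" if "a < r" "r \<le> b" for r
    using left_lim_const[of r a X \<omega> x] that assms by simp
  then show ?thesis by (auto simp: jumps_def)
qed

text \<open>The function \<open>u\<close> is absolutely continuous in time since, with positive probability,
  \<open>X\<close> stays in any given state around any given time, where \<open>Y\<close> has no jump.\<close>

lemma state_function_densities:
  assumes I: "time_set I" and Y: "AE \<omega> in Q. path_solution I f Z Y \<omega>"
    and u: "AE \<omega> in Q. \<forall>t\<in>I. Y t \<omega> = u t (X t \<omega>)"
  shows "\<exists>w. w \<in> borel_measurable borel \<and> (\<forall>a\<in>state_times I i. \<forall>b\<in>state_times I i. a \<le> b \<longrightarrow>
    set_integrable lborel {a..b} w \<and> u b (axis i 1) - u a (axis i 1) = (LINT x:{a..b}|lborel. w x))"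
proof -
  let ?J = "state_times I i"
  have "\<exists>\<delta>>0. \<exists>d. integrable lborel d \<and> (\<forall>a\<in>?J. \<forall>b\<in>?J. t - \<delta> < a \<longrightarrow> a \<le> b \<longrightarrow> b < t + \<delta> \<longrightarrow>
      u b (axis i 1) - u a (axis i 1) = (LINT x:{a..b}|lborel. d x))" if t: "t \<in> ?J" for t
  proof -
    have tI: "t \<in> I" "0 \<le> t" using state_times(2)[OF I] t time_set_cases(2)[OF I] by auto
    have "AE \<omega> in Q. path_solution I f Z Y \<omega> \<and> (\<forall>t\<in>I. Y t \<omega> = u t (X t \<omega>))" using Y u by eventually_elim simp
    from state_witness[OF I this t] obtain \<omega> where \<omega>: "\<omega> \<in> space P"
      and ps: "path_solution I f Z Y \<omega>" and Yu: "\<forall>t\<in>I. Y t \<omega> = u t (X t \<omega>)"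
      and X: "X t \<omega> = axis i 1" "left_lim X t \<omega> = axis i 1" by blast
    obtain \<delta> where \<delta>: "0 < \<delta>" "locally_constant \<omega> t \<delta>" by (rule locally_constant_ex[OF tI(2) \<omega>])
    have const: "X s \<omega> = axis i 1" if "0 \<le> s" "t - \<delta> < s" "s < t + \<delta>" for s
      using locally_constantD(1,3)[OF \<delta>(2), of s] that X by (cases "s < t") simp_all
    \<comment> \<open>One horizon for all admissible \<open>b\<close>, so that a single integrable
      density serves the whole neighbourhood.\<close>
    obtain T where T: "T \<in> I" "\<forall>b\<in>I. b < t + \<delta> \<longrightarrow> b \<le> T"
    proof (cases "I = {0..}")
      case True
      then show ?thesis using tI(2) \<delta>(1) by (intro that[of "t + \<delta>"]) auto
    next
      case False
      then obtain S where "S > 0" "I = {0..S}" using I by (auto simp: time_set_def)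
      then show ?thesis by (intro that[of S]) auto
    qed
    \<comment> \<open>The drift of the chosen path. Another time uses another path and perhaps
      another version, which is why the densities are glued.\<close>
    let ?d = "\<lambda>x. indicator {0..T} x *\<^sub>R drift f Z Y \<omega> x"
    have "u b (axis i 1) - u a (axis i 1) = (LINT x:{a..b}|lborel. ?d x)"
      if ab: "a \<in> ?J" "b \<in> ?J" "t - \<delta> < a" "a \<le> b" "b < t + \<delta>" for a b
    proof -
      have abI: "a \<in> I" "b \<in> I" using state_times(2)[OF I] ab by blast+
      then have a0: "0 \<le> a" using time_set_cases(2)[OF I] by auto
      have c: "\<forall>r\<in>{a..b}. X r \<omega> = axis i 1" using const ab a0 by simp
      have "Y b \<omega> - Y a \<omega> = (LINT x:{a..b}|lborel. drift f Z Y \<omega> x)"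
        using path_solution_increment[OF I ps abI(2) a0 ab(4)] constant_no_jumps[OF a0 c]
        by (simp add: jump_sum_def)
      also have "\<dots> = (LINT x:{a..b}|lborel. ?d x)"
        unfolding set_lebesgue_integral_def
        by (intro Bochner_Integration.integral_cong refl) (use T(2) abI ab(5) a0 in \<open>auto simp: indicator_def\<close>)
      finally show ?thesis using Yu abI c ab(4) by simp
    qed
    moreover have "integrable lborel ?d"
      using path_solution_drift[OF ps T(1)] by (simp add: set_integrable_def)
    ultimately show ?thesis using \<delta>(1) by blast
  qed
  note loc = this
  show ?thesis
  proof (rule glue_densities[OF state_times(3)[OF I, of i] loc])
    fix w assume "w \<in> borel_measurable borel" and "\<And>a b. a \<in> ?J \<Longrightarrow> b \<in> ?J \<Longrightarrow> a \<le> b \<Longrightarrow>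
      set_integrable lborel {a..b} w \<and> u b (axis i 1) - u a (axis i 1) = (LINT x:{a..b}|lborel. w x)"
    then show ?thesis by blast
  qed
qed

text \<open>The common form of both directions: in one the densities come from \<open>u\<close>, in
  the other they are the right-hand sides of the differential equations.\<close>

definition has_densities :: "real set \<Rightarrow> (real \<Rightarrow> real^'n) \<Rightarrow> ('n \<Rightarrow> real \<Rightarrow> real) \<Rightarrow> bool" where
  "has_densities I \<zeta> w \<longleftrightarrow> (\<forall>i. \<forall>a\<in>state_times I i. \<forall>b\<in>state_times I i. a \<le> b \<longrightarrow>
    set_integrable lborel {a..b} (w i) \<and> \<zeta> b $ i - \<zeta> a $ i = (LINT x:{a..b}|lborel. w i x))"

lemma measurable_state_vector:
  assumes I: "time_set I"
    and w: "has_densities I \<zeta> w"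
  shows "(\<lambda>t. indicator I t *\<^sub>R \<zeta> t) \<in> borel_measurable (borel :: real measure)"
proof (rule borel_measurable_vecI)
  fix i
  have "\<forall>a\<in>I \<inter> {0<..}. \<forall>b\<in>I \<inter> {0<..}. a \<le> b \<longrightarrow>
      set_integrable lborel {a..b} (w i) \<and> \<zeta> b $ i - \<zeta> a $ i = (LINT x:{a..b}|lborel. w i x)"
    using w[unfolded has_densities_def] state_times(1)[OF I, of i] by blast
  from indefinite_integral_measurable[OF I this]
  show "(\<lambda>t. (indicator I t *\<^sub>R \<zeta> t) $ i) \<in> borel_measurable borel" by simp
qed

lemma state_component_tendsto_left:
  assumes I: "time_set I" and t: "t \<in> I" "0 < t"
    and w: "has_densities I \<zeta> w"
  shows "((\<lambda>s. \<zeta> s $ i) \<longlongrightarrow> \<zeta> t $ i) (at_left t)"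
proof (rule indefinite_integral_tendsto_left[of "t / 2" t "w i" "\<lambda>s. \<zeta> s $ i"])
  \<comment> \<open>Starting at \<open>t / 2\<close> keeps the interval at positive times, where
    every component has a density.\<close>
  have mem: "s \<in> state_times I i" if "t / 2 \<le> s" "s \<le> t" for s
  proof -
    have "0 < s" using that t(2) by simp
    then have "s \<in> I" using time_set_cases(5)[OF I t(1)] that by auto
    then show ?thesis using state_times(1)[OF I, of i] \<open>0 < s\<close> by auto
  qed
  have h: "t / 2 \<le> t" using t(2) by simp
  show "t / 2 < t" using t(2) by simp
  show "set_integrable lborel {t / 2..t} (w i)" using w[unfolded has_densities_def] mem[of t] mem[of "t / 2"] h by blast
  show "\<forall>s\<in>{t / 2..t}. \<zeta> s $ i - \<zeta> (t / 2) $ i = (LINT x:{t / 2..s}|lborel. w i x)"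
    using w[unfolded has_densities_def] mem h by (metis atLeastAtMost_iff order_refl)
qed

text \<open>The left limit of \<open>Y\<close> at \<open>r\<close> is computed twice: the equation
  gives \<open>Y\<close> minus its jump, and, the state just before \<open>r\<close> being some
  \<open>j\<close>, continuity gives component \<open>j\<close> of \<open>\<zeta>\<close>.\<close>

lemma state_function_jumps:
  assumes I: "time_set I" and ps: "path_solution I f Z Y \<omega>" and Yu: "\<forall>t\<in>I. Y t \<omega> = X t \<omega> \<bullet> \<zeta> t"
    and w: "has_densities I \<zeta> w"
    and r: "r \<in> I" "0 < r"
  shows "Z r \<omega> \<bullet> (X r \<omega> - left_lim X r \<omega>) = \<zeta> r \<bullet> (X r \<omega> - left_lim X r \<omega>)"
proof -
  have \<omega>: "\<omega> \<in> space P" using ps by (simp add: path_solution_def)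
  obtain j where j: "left_lim X r \<omega> = axis j 1"
    using left_lim_Basis[OF less_imp_le[OF r(2)] \<omega>] by (auto simp: Basis_vec_real)
  obtain \<delta> where \<delta>: "0 < \<delta>" "locally_constant \<omega> r \<delta>" by (rule locally_constant_ex[OF less_imp_le[OF r(2)] \<omega>])
  have "eventually (\<lambda>s. \<zeta> s $ j = Y s \<omega>) (at_left r)"
    unfolding eventually_at_left_field
  proof (intro exI[of _ "max 0 (r - \<delta>)"] conjI allI impI)
    show "max 0 (r - \<delta>) < r" using \<delta>(1) r(2) by simp
    fix s assume s: "max 0 (r - \<delta>) < s" "s < r"
    then have "s \<in> I" using time_set_cases(5)[OF I r(1)] by auto
    moreover have "X s \<omega> = axis j 1" using locally_constantD(3)[OF \<delta>(2), of s] s j by simp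
    ultimately show "\<zeta> s $ j = Y s \<omega>" using Yu by (simp add: inner_commute[of "axis j 1"] inner_axis)
  qed
  from Lim_transform_eventually[OF state_component_tendsto_left[OF I r w] this]
  have "((\<lambda>s. Y s \<omega>) \<longlongrightarrow> \<zeta> r $ j) (at_left r)" .
  moreover have "((\<lambda>s. Y s \<omega>) \<longlongrightarrow> Y r \<omega> - Z r \<omega> \<bullet> (X r \<omega> - left_lim X r \<omega>)) (at_left r)"
    by (rule path_solution_tendsto_left[OF I ps r])
  ultimately have "Y r \<omega> - Z r \<omega> \<bullet> (X r \<omega> - left_lim X r \<omega>) = \<zeta> r $ j"
    using tendsto_unique[OF trivial_limit_at_left_real] by blast
  then show ?thesis using Yu r(1) j
    by (simp add: inner_diff_right inner_axis inner_commute[of "X r \<omega>" "\<zeta> r"])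
qed

text \<open>While the state is constant, the increments of \<open>Y\<close> are integrals of the
  drift and also of \<open>w i\<close>, and densities of the same increments agree almost
  everywhere. Bisection extends this to bounded horizons, and countably many of these exhaust
  \<open>I\<close>.\<close>

lemma state_function_drift:
  assumes I: "time_set I" and ps: "path_solution I f Z Y \<omega>" and Yu: "\<forall>t\<in>I. Y t \<omega> = X t \<omega> \<bullet> \<zeta> t"
    and w: "has_densities I \<zeta> w"
  shows "AE r in lborel. r \<in> I \<longrightarrow> (\<forall>i. X r \<omega> = axis i 1 \<longrightarrow> drift f Z Y \<omega> r = w i r)"
proof -
  have \<omega>: "\<omega> \<in> space P" using ps by (simp add: path_solution_def)
  let ?R = "\<lambda>r. \<forall>i. X r \<omega> = axis i 1 \<longrightarrow> drift f Z Y \<omega> r = w i r"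
  have const: "AE r in lborel. r \<in> {p..q} \<longrightarrow> ?R r"
    if pq: "0 \<le> p" "q \<in> I" "\<forall>r\<in>{p..q}. X r \<omega> = axis i 1" for p q i
  proof -
    have mem: "r \<in> state_times I i" if "r \<in> {p..q}" for r
      by (rule in_state_times[OF I _ \<omega>]) (use time_set_cases(5)[OF I pq(2)] pq(1,3) that in auto)
    have "AE r in lborel. r \<in> {p..q} \<longrightarrow> drift f Z Y \<omega> r = w i r"
    proof (cases "p \<le> q")
      case True
      show ?thesis
      proof (rule AE_eq_if_interval_integrals_eq)
        show "set_integrable lborel {p..q} (drift f Z Y \<omega>)"
          using pq(1) by (intro set_integrable_subset[OF path_solution_drift[OF ps pq(2)]]) auto
        show "set_integrable lborel {p..q} (w i)" using w[unfolded has_densities_def] mem[of p] mem[of q] True by simp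
        fix a b assume ab: "p \<le> a" "a \<le> b" "b \<le> q"
        have bI: "a \<in> I" "b \<in> I" using mem[of a] mem[of b] ab state_times(2)[OF I, of i] by auto
        have a0: "0 \<le> a" using pq(1) ab by simp
        have c: "\<forall>r\<in>{a..b}. X r \<omega> = axis i 1" using pq(3) ab by simp
        have "(LINT x:{a..b}|lborel. drift f Z Y \<omega> x) = Y b \<omega> - Y a \<omega>"
          using path_solution_increment[OF I ps bI(2) a0 ab(2)] constant_no_jumps[OF a0 c]
          by (simp add: jump_sum_def)
        also have "\<dots> = \<zeta> b $ i - \<zeta> a $ i"
          using Yu bI c ab(2) by (simp add: inner_commute[of "axis i 1"] inner_axis)
        also have "\<dots> = (LINT x:{a..b}|lborel. w i x)" using w[unfolded has_densities_def] mem[of a] mem[of b] ab by simp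
        finally show "(LINT x:{a..b}|lborel. drift f Z Y \<omega> x) = (LINT x:{a..b}|lborel. w i x)" .
      qed
    qed simp
    then show ?thesis
    proof eventually_elim
      case (elim r)
      show ?case
      proof (intro impI allI)
        fix k assume "r \<in> {p..q}" "X r \<omega> = axis k 1"
        moreover from this have "k = i" using pq(3) by (metis axis_eq_axis zero_neq_one)
        ultimately show "drift f Z Y \<omega> r = w k r" using elim by simp
      qed
    qed
  qed
  have all: "AE r in lborel. r \<in> {0..T} \<longrightarrow> ?R r" if T: "T \<in> I" for T
  proof -
    define B where "B = (\<lambda>a b. 0 \<le> a \<longrightarrow> b \<in> I \<longrightarrow> (AE r in lborel. r \<in> {a..b} \<longrightarrow> ?R r))"
    have T0: "0 \<le> T" using T time_set_cases(2)[OF I] by auto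
    have "B 0 T" using T0
    proof (induct rule: Bolzano)
      case (trans a b c)
      show ?case unfolding B_def
      proof (intro impI)
        assume ac: "0 \<le> a" "c \<in> I"
        then have "0 \<le> b" "b \<in> I" using trans(3,4) time_set_cases(5)[OF I ac(2)] by auto
        then have "AE r in lborel. r \<in> {a..b} \<longrightarrow> ?R r" "AE r in lborel. r \<in> {b..c} \<longrightarrow> ?R r"
          using trans(1,2) ac unfolding B_def by blast+
        then show "AE r in lborel. r \<in> {a..c} \<longrightarrow> ?R r"
          by eventually_elim (metis atLeastAtMost_iff linear)
      qed
    next
      case (local x)
      obtain \<delta> where \<delta>: "0 < \<delta>" "locally_constant \<omega> x \<delta>" by (rule locally_constant_ex[OF local(1) \<omega>])
      obtain i where i: "X x \<omega> = axis i 1" using states[OF local(1) \<omega>] by (auto simp: Basis_vec_real)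
      obtain j where j: "left_lim X x \<omega> = axis j 1" using left_lim_Basis[OF local(1) \<omega>] by (auto simp: Basis_vec_real)
      have "B a b" if ab: "a \<le> x" "x \<le> b" "b - a < \<delta>" for a b
        unfolding B_def
      proof (intro impI)
        assume ab': "0 \<le> a" "b \<in> I"
        have 1: "AE r in lborel. r \<in> {x..b} \<longrightarrow> ?R r"
        proof (rule const[of _ _ i])
          show "\<forall>r\<in>{x..b}. X r \<omega> = axis i 1" using locally_constantD(1)[OF \<delta>(2)] i ab by simp
        qed (use local ab' in simp_all)
        \<comment> \<open>The state at \<open>x\<close> may be a new one, so the part before
          \<open>x\<close> is half-open and is exhausted by compact intervals.\<close>
        have 2: "AE r in lborel. r \<in> {a..<x} \<longrightarrow> ?R r"
        proof (rule AE_on_real_set)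
          fix p q assume pq: "p \<in> {a..<x}" "q \<in> {a..<x}"
          show "AE r in lborel. r \<in> {p..q} \<longrightarrow> ?R r"
          proof (rule const[of _ _ j])
            show "\<forall>r\<in>{p..q}. X r \<omega> = axis j 1" using locally_constantD(3)[OF \<delta>(2)] j ab ab' pq by simp
            show "q \<in> I" using time_set_cases(5)[OF I ab'(2)] pq ab ab' by auto
          qed (use ab' pq in simp)
        qed
        from 1 2 show "AE r in lborel. r \<in> {a..b} \<longrightarrow> ?R r"
          by eventually_elim (metis atLeastAtMost_iff atLeastLessThan_iff not_le)
      qed
      then show ?case using \<delta>(1) by blast
    qed
    then show ?thesis using T by (simp add: B_def)
  qed
  obtain T :: "nat \<Rightarrow> real" where T: "\<forall>n. T n \<in> I" "\<forall>t\<in>I. eventually (\<lambda>n. t \<le> T n) sequentially"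
    by (rule time_set_exhaust[OF I])
  have "AE r in lborel. \<forall>n. r \<in> {0..T n} \<longrightarrow> ?R r" unfolding AE_all_countable using all T(1) by blast
  then show ?thesis
  proof eventually_elim
    case (elim r)
    show ?case
    proof
      assume r: "r \<in> I"
      then have "0 \<le> r" using time_set_cases(2)[OF I] by auto
      moreover obtain n where "r \<le> T n" using eventually_happens'[OF sequentially_bot] T(2) r by blast
      ultimately have "r \<in> {0..T n}" by simp
      with elim show "?R r" by blast
    qed
  qed
qed

end

text \<open>At a jump time the integrand along the path already refers to the new state. Writing
  \<open>E\<close> as \<open>F\<close> plus a term supported at \<open>b\<close> gives integrability
  and the value at once.\<close>

lemma set_integral_modify_endpoint:
  fixes E F :: "real \<Rightarrow> real"
  assumes F: "set_integrable lborel {a..b} F" and eq: "\<forall>r. a \<le> r \<longrightarrow> r < b \<longrightarrow> E r = F r"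
  shows "set_integrable lborel {a..b} E" "(LINT x:{a..b}|lborel. E x) = (LINT x:{a..b}|lborel. F x)"
proof -
  define c where "c = (if a \<le> b then E b - F b else 0)"
  have E: "indicator {a..b} x *\<^sub>R E x = indicator {a..b} x *\<^sub>R F x + indicator {b} x * c" for x
    using eq[rule_format, of x] by (cases x b rule: linorder_cases) (auto simp: c_def indicator_def)
  have i: "integrable lborel (\<lambda>x. indicator {b} x * c)" "(LINT x|lborel. indicator {b} x * c) = 0"
    by (simp_all add: integrable_mult_left)
  show "set_integrable lborel {a..b} E"
    unfolding set_integrable_def E
    by (rule Bochner_Integration.integrable_add[OF F[unfolded set_integrable_def] i(1)])
  show "(LINT x:{a..b}|lborel. E x) = (LINT x:{a..b}|lborel. F x)"
    unfolding set_lebesgue_integral_def E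
      Bochner_Integration.integral_add[OF F[unfolded set_integrable_def] i(1)] i(2) by simp
qed

section \<open>From state functions to Markovian drivers\<close>

context markov_chain
begin

text \<open>Lifts the measurable null set behind an almost sure property to the product, so
  \<open>R\<close> itself may be nonmeasurable.\<close>

lemma AE_snd:
  assumes "AE \<omega> in Q. R \<omega>" shows "AE (u :: real, \<omega>) in L. R \<omega>"
proof -
  obtain N where N: "{\<omega> \<in> space Q. \<not> R \<omega>} \<subseteq> N" "N \<in> null_sets Q"
    using assms by (auto simp: eventually_ae_filter)
  have NQ: "N \<in> sets Q" using N(2) by (rule null_setsD2)
  have "(\<lambda>p. snd p) \<in> measurable (borel \<Otimes>\<^sub>M Q :: (real \<times> 'a) measure) Q" by (rule measurable_snd)
  then have "Measurable.pred (borel \<Otimes>\<^sub>M Q) (\<lambda>p :: real \<times> 'a. snd p \<notin> N)"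
    using NQ by measurable
  moreover have "AE \<omega> in Q. AE u in (lborel :: real measure). \<omega> \<notin> N"
    using AE_not_in[OF N(2)] by eventually_elim simp
  ultimately have "AE (u :: real, \<omega>) in L. \<omega> \<notin> N"
    using AE_pair_if_AE_paths[of "\<lambda>u \<omega>. \<omega> \<notin> N"] by simp
  with AE_space[of L] show ?thesis
    by eventually_elim (use N(1) in \<open>auto simp: space_pair_measure\<close>)
qed

text \<open>Equivalent integrands have the same absolutely continuous part in their integrals
  against \<open>M\<close>, because the seminorm controls the pairing with the drift of
  \<open>X\<close>.\<close>

lemma sim_M_drift:
  assumes I: "time_set I" and s: "sim_M P X A I Z (\<lambda>t \<omega>. \<zeta> t)"
  shows "AE \<omega> in Q. AE t in lborel. t \<in> I \<longrightarrow> Z t \<omega> \<bullet> (A t *v left_lim X t \<omega>) = \<zeta> t \<bullet> (A t *v left_lim X t \<omega>)"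
proof -
  have "AE \<omega> in Q. AE t in lborel. t \<in> I \<longrightarrow> M_norm A X t \<omega> (Z t \<omega> - \<zeta> t) = 0"
    using s unfolding sim_M_def by (rule AE_paths_if_AE_pair)
  moreover have "AE \<omega> in Q. \<omega> \<in> space P" using AE_space[of Q] by simp
  ultimately show ?thesis
  proof eventually_elim
    case (elim \<omega>)
    note \<omega> = elim(2)
    from elim(1) show ?case
    proof eventually_elim
      case (elim t)
      show ?case
      proof
        assume t: "t \<in> I"
        then have "0 \<le> t" using time_set_cases(2)[OF I] by auto
        then show "Z t \<omega> \<bullet> (A t *v left_lim X t \<omega>) = \<zeta> t \<bullet> (A t *v left_lim X t \<omega>)"
          using elim t by (intro M_norm_eq_0_drift \<omega>) simp_all
      qed
    qed
  qed
qed

lemma X_inner: "X t \<omega> = axis i 1 \<Longrightarrow> X t \<omega> \<bullet> z = z $ i"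
  by (simp add: inner_commute[of "axis i 1"] inner_axis)

lemma measurable_X_progressive:
  assumes "0 \<le> T"
  shows "(\<lambda>p. X (fst (snd p)) (fst p)) \<in> borel_measurable (F T \<Otimes>\<^sub>M restrict_space borel {0..T} \<Otimes>\<^sub>M N)"
proof -
  have X: "(\<lambda>(t, \<omega>). X t \<omega>) \<in> borel_measurable (restrict_space borel {0..T} \<Otimes>\<^sub>M F T)"
    by (rule measurable_right_continuous[OF assms measurable_X_F]) (use right_continuous in auto)
  have "(\<lambda>p. (fst (snd p), fst p)) \<in> measurable (F T \<Otimes>\<^sub>M restrict_space borel {0..T} \<Otimes>\<^sub>M N)
    (restrict_space borel {0..T} \<Otimes>\<^sub>M F T)"
    by (rule measurable_Pair[OF measurable_compose[OF measurable_snd measurable_fst] measurable_fst])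
  from measurable_compose[OF this X] show ?thesis by simp
qed

text \<open>When the driver ignores \<open>y\<close> and \<open>z\<close>, the right-hand side does
  not involve the solution and is an explicit formula for it.\<close>

lemma uniquely_solvable_if_constant:
  assumes I: "time_set I" and Y: "solves_equation P X A I (\<lambda>\<omega> t y z. c \<omega> t) y0 Z Y"
  shows "uniquely_solvable P X A I (\<lambda>\<omega> t y z. c \<omega> t) y0 Z"
  unfolding uniquely_solvable_def
proof (intro conjI exI[of _ Y] Y allI impI)
  fix Y1 Y2
  assume "solves_equation P X A I (\<lambda>\<omega> t y z. c \<omega> t) y0 Z Y1 \<and> solves_equation P X A I (\<lambda>\<omega> t y z. c \<omega> t) y0 Z Y2"
  then have "AE \<omega> in Q. Y1 0 \<omega> = y0" "AE \<omega> in Q. path_solution I (\<lambda>\<omega> t y z. c \<omega> t) Z Y1 \<omega>"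
    "AE \<omega> in Q. Y2 0 \<omega> = y0" "AE \<omega> in Q. path_solution I (\<lambda>\<omega> t y z. c \<omega> t) Z Y2 \<omega>"
    unfolding solves_equation_iff by blast+
  then have "AE \<omega> in Q. \<forall>t\<in>I. Y1 t \<omega> = Y2 t \<omega>"
  proof eventually_elim
    case (elim \<omega>)
    show ?case
    proof
      fix t assume t: "t \<in> I"
      show "Y1 t \<omega> = Y2 t \<omega>"
        using path_solution_equation[OF elim(2) t] path_solution_equation[OF elim(4) t] elim(1,3)
        by (simp add: drift_def)
    qed
  qed
  then show "indistinguishable P I Y1 Y2" by (simp add: indistinguishable_def)
qed

lemma state_function_imp_markovian:
  assumes I: "time_set I" and Z: "predictable P X Z" and f: "progressive_driver P X I f"
    and Y: "solves_equation P X A I f y0 Z Y" and u: "state_function P X I Y u"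
  shows "sim_M P X A I Z (\<lambda>t \<omega>. \<chi> i. u t (axis i 1))"
    and "\<exists>g. markovian_driver P X A I y0 Y Z f g \<and>
               (\<exists>\<zeta>. sim_M P X A I Z (\<lambda>t \<omega>. \<zeta> t) \<and>
                    (AE \<omega> in completion P. X 0 \<omega> \<bullet> \<zeta> 0 = Y 0 \<omega>) \<and>
                    solves_ode_system P X A I g \<zeta>)"
proof -
  have I0: "t \<in> I \<Longrightarrow> 0 \<le> t" for t using time_set_cases(2)[OF I] by auto
  define \<zeta> :: "real \<Rightarrow> real^'n" where "\<zeta> = (\<lambda>t. \<chi> i. u t (axis i 1))"
  have ps: "AE \<omega> in Q. path_solution I f Z Y \<omega>" using Y unfolding solves_equation_iff by blast
  have Yu: "AE \<omega> in Q. \<forall>t\<in>I. Y t \<omega> = u t (X t \<omega>)"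
    using u by (simp add: state_function_def indistinguishable_def)
  have "\<forall>i. \<exists>w. w \<in> borel_measurable borel \<and> (\<forall>a\<in>state_times I i. \<forall>b\<in>state_times I i. a \<le> b \<longrightarrow>
    set_integrable lborel {a..b} w \<and> u b (axis i 1) - u a (axis i 1) = (LINT x:{a..b}|lborel. w x))"
    using state_function_densities[OF I ps Yu] by blast
  from choice[OF this] obtain w where
    w: "\<forall>i. w i \<in> borel_measurable borel \<and> (\<forall>a\<in>state_times I i. \<forall>b\<in>state_times I i. a \<le> b \<longrightarrow>
    set_integrable lborel {a..b} (w i) \<and> u b (axis i 1) - u a (axis i 1) = (LINT x:{a..b}|lborel. w i x))" by blast
  have hd: "has_densities I \<zeta> w" unfolding has_densities_def \<zeta>_def using w by simp
  have wm: "w i \<in> borel_measurable borel" for i using w by blast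
  have \<zeta>m: "(\<lambda>t. indicator I t *\<^sub>R \<zeta> t) \<in> borel_measurable borel" by (rule measurable_state_vector[OF I hd])
  have Y\<zeta>: "AE \<omega> in Q. \<forall>t\<in>I. Y t \<omega> = X t \<omega> \<bullet> \<zeta> t"
    using Yu AE_space[of Q]
  proof eventually_elim
    case (elim \<omega>)
    show ?case
    proof
      fix t assume t: "t \<in> I"
      obtain i where i: "X t \<omega> = axis i 1" using states[OF I0[OF t], of \<omega>] elim(2) by (auto simp: Basis_vec_real)
      have "Y t \<omega> = u t (axis i 1)" using elim(1) t i by simp
      then show "Y t \<omega> = X t \<omega> \<bullet> \<zeta> t" unfolding X_inner[OF i] by (simp add: \<zeta>_def)
    qed
  qed
  have sim: "sim_M P X A I Z (\<lambda>t \<omega>. \<zeta> t)"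
    unfolding sim_M_iff_jumps[OF I Z \<zeta>m]
    using ps Y\<zeta>
  proof eventually_elim
    case (elim \<omega>)
    show ?case using state_function_jumps[OF I elim hd] by blast
  qed
  then show "sim_M P X A I Z (\<lambda>t \<omega>. \<chi> i. u t (axis i 1))" by (simp add: \<zeta>_def)
  \<comment> \<open>Solves \<open>drift f Z Y \<omega> t = w i t\<close> for the driver, with
    \<open>\<zeta>\<close> for \<open>Z\<close> and state \<open>i\<close> for the left limit. The
    indicator makes \<open>c\<close> measurable and is one on \<open>I\<close>.\<close>
  define c where "c i t = - w i t - (indicator I t *\<^sub>R \<zeta> t) \<bullet> (A t *v axis i 1)" for i t
  \<comment> \<open>The coordinates of a state are indicators, so this sum selects
    \<open>c i\<close> at \<open>axis i 1\<close> and is visibly measurable in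
    \<open>x\<close>.\<close>
  define g :: "real^'n \<Rightarrow> real \<Rightarrow> real \<Rightarrow> real^'n \<Rightarrow> real" where "g x t y z = (\<Sum>i\<in>UNIV. x $ i * c i t)" for x t y z
  have gi: "g (axis i 1) t y z = c i t" for i t y z
    by (simp add: g_def axis_def if_distrib[of "\<lambda>x. x * _"] cong: if_cong)
  have cm: "c i \<in> borel_measurable (restrict_space borel {0..T})" for i T
  proof -
    have "(\<lambda>t. A t *v axis i 1) \<in> borel_measurable (restrict_space borel {0..T})"
      by (intro measurable_matrix_vector_mult measurable_rates_on) simp_all
    moreover have "w i \<in> borel_measurable (restrict_space borel {0..T})"
      "(\<lambda>t. indicator I t *\<^sub>R \<zeta> t) \<in> borel_measurable (restrict_space borel {0..T})"
      by (intro measurable_restrict_space1 wm \<zeta>m)+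
    ultimately show ?thesis unfolding c_def[abs_def] by measurable
  qed
  have prog: "progressive_driver P X I (\<lambda>\<omega> t y z. g (X t \<omega>) t y z)"
    unfolding progressive_driver_def
  proof
    fix T assume "T \<in> I"
    let ?M = "F T \<Otimes>\<^sub>M restrict_space borel {0..T} \<Otimes>\<^sub>M (borel :: real measure) \<Otimes>\<^sub>M (borel :: (real^'n) measure)"
    have X: "(\<lambda>p. X (fst (snd p)) (fst p) $ i) \<in> borel_measurable ?M" for i
      by (intro measurable_vec_nth' measurable_X_progressive I0 \<open>T \<in> I\<close>)
    have "(\<lambda>p. fst (snd p)) \<in> measurable ?M (restrict_space borel {0..T})" by measurable
    from measurable_compose[OF this cm]
    have "(\<lambda>p. c i (fst (snd p))) \<in> borel_measurable ?M" for i .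
    with X have "(\<lambda>p. \<Sum>i\<in>UNIV. X (fst (snd p)) (fst p) $ i * c i (fst (snd p))) \<in> borel_measurable ?M"
      by (intro borel_measurable_sum borel_measurable_times)
    then show "(\<lambda>(\<omega>, t, y, z). g (X t \<omega>) t y z) \<in> borel_measurable ?M"
      by (simp add: g_def case_prod_beta')
  qed
  have eq: "AE \<omega> in Q. AE s in lborel. s \<in> I \<longrightarrow>
      left_lim Y s \<omega> = Y s \<omega> \<and> (\<forall>y z. f \<omega> s (left_lim Y s \<omega>) (Z s \<omega>) = g (X s \<omega>) s y z)"
    using ps Y\<zeta> sim_M_drift[OF I sim]
  proof eventually_elim
    case (elim \<omega>)
    have \<omega>: "\<omega> \<in> space P" using elim(1) by (simp add: path_solution_def)
    show ?case
      using path_solution_left_lim[OF I elim(1)] state_function_drift[OF I elim(1,2) hd] elim(3) AE_no_jump[OF \<omega>]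
    proof eventually_elim
      case (elim s)
      show ?case
      proof (intro impI conjI allI)
        assume s: "s \<in> I"
        show "left_lim Y s \<omega> = Y s \<omega>" using elim(1) s by blast
        fix y z
        obtain i where i: "X s \<omega> = axis i 1" using states[OF I0[OF s] \<omega>] by (auto simp: Basis_vec_real)
        have "drift f Z Y \<omega> s = w i s" using elim(2) s i by blast
        moreover have "Z s \<omega> \<bullet> (A s *v left_lim X s \<omega>) = \<zeta> s \<bullet> (A s *v left_lim X s \<omega>)" using elim(3) s by blast
        moreover have "left_lim X s \<omega> = axis i 1" using elim(4) I0[OF s] i by simp
        ultimately have "f \<omega> s (left_lim Y s \<omega>) (Z s \<omega>) = c i s"
          using s by (simp add: drift_def c_def)
        then show "f \<omega> s (left_lim Y s \<omega>) (Z s \<omega>) = g (X s \<omega>) s y z" by (simp add: i gi)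
      qed
    qed
  qed
  have solves: "solves_equation P X A I (\<lambda>\<omega> t y z. g (X t \<omega>) t y z) y0 Z Y"
  proof (rule replace_driver[OF I Y prog Z])
    show "AE \<omega> in Q. AE s in lborel. s \<in> I \<longrightarrow>
      f \<omega> s (left_lim Y s \<omega>) (Z s \<omega>) = g (X s \<omega>) s (left_lim Y s \<omega>) (Z s \<omega>)"
      using eq by (elim eventually_mono) blast
  qed
  have g0: "(\<lambda>\<omega> t y z. g (X t \<omega>) t y z) = (\<lambda>\<omega> t y z. g (X t \<omega>) t 0 0)" by (simp add: g_def)
  have adm: "admissible_driver P X A I y0 Z (\<lambda>\<omega> t y z. g (X t \<omega>) t y z)"
    unfolding admissible_driver_def
  proof (intro conjI prog)
    show "invariant_driver P X A I (\<lambda>\<omega> t y z. g (X t \<omega>) t y z)"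
      unfolding invariant_driver_def by (simp add: g_def)
    show "uniquely_solvable P X A I (\<lambda>\<omega> t y z. g (X t \<omega>) t y z) y0 Z"
      unfolding g0 by (rule uniquely_solvable_if_constant[OF I solves[unfolded g0]])
  qed
  \<comment> \<open>\<open>Y\<close> is only adapted, so joint measurability is established with
    \<open>X t \<omega> \<bullet> \<zeta> t\<close> instead, and \<open>Y\<close> returns at the end
    through indistinguishability. The arguments \<open>0 0\<close> stand for any, since
    \<open>g\<close> ignores them.\<close>
  have Tn: "AE (t, \<omega>) in L. t \<in> {0..T} \<longrightarrow> f \<omega> t (Y t \<omega>) (Z t \<omega>) = g (X t \<omega>) t (Y t \<omega>) (Z t \<omega>)" if T: "T \<in> I" for T
  proof -
    let ?R = "restrict_space borel {0..T} \<Otimes>\<^sub>M Q"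
    have sub: "{0..T} \<subseteq> I" by (rule time_set_cases(5)[OF I T])
    have T0: "0 \<le> T" by (rule I0[OF T])
    have X: "(\<lambda>p. X (fst p) (snd p)) \<in> borel_measurable ?R"
      using measurable_X_pair[OF T0] by (simp add: case_prod_beta')
    have fst: "fst \<in> measurable ?R (restrict_space borel {0..T})" by (rule measurable_fst)
    have fstb: "(\<lambda>p. fst p) \<in> measurable ?R borel"
      by (rule measurable_compose[OF fst]) (rule measurable_restrict_space1, simp)
    have Zm: "(\<lambda>p. Z (max 0 (fst p)) (snd p)) \<in> borel_measurable ?R"
    proof -
      have "(\<lambda>p. (fst p, snd p)) \<in> measurable ?R (borel \<Otimes>\<^sub>M Q)"
        by (rule measurable_Pair[OF fstb measurable_snd])
      from measurable_compose[OF this measurable_Z_pair[OF Z]] show ?thesis by simp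
    qed
    have zm: "(\<lambda>p. indicator I (fst p) *\<^sub>R \<zeta> (fst p)) \<in> borel_measurable ?R"
      by (rule measurable_compose[OF fstb \<zeta>m])
    have ym: "(\<lambda>p. X (fst p) (snd p) \<bullet> (indicator I (fst p) *\<^sub>R \<zeta> (fst p))) \<in> borel_measurable ?R"
      using X zm by measurable
    have sF: "snd \<in> measurable ?R (F T)"
      by (rule measurable_compose[OF measurable_snd measurable_ident_F])
    have "(\<lambda>p. (snd p, fst p, X (fst p) (snd p) \<bullet> (indicator I (fst p) *\<^sub>R \<zeta> (fst p)), Z (max 0 (fst p)) (snd p)))
      \<in> measurable ?R (F T \<Otimes>\<^sub>M restrict_space borel {0..T} \<Otimes>\<^sub>M borel \<Otimes>\<^sub>M borel)"
      by (intro measurable_Pair sF fst ym Zm)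
    from measurable_compose[OF this f[unfolded progressive_driver_def, rule_format, OF T]]
    have fm: "(\<lambda>p. f (snd p) (fst p) (X (fst p) (snd p) \<bullet> (indicator I (fst p) *\<^sub>R \<zeta> (fst p))) (Z (max 0 (fst p)) (snd p)))
      \<in> borel_measurable ?R" by simp
    have "(\<lambda>p. (snd p, fst p, 0 :: real, 0 :: real^'n)) \<in> measurable ?R (F T \<Otimes>\<^sub>M restrict_space borel {0..T} \<Otimes>\<^sub>M borel \<Otimes>\<^sub>M borel)"
      by (intro measurable_Pair sF fst measurable_const) simp_all
    from measurable_compose[OF this prog[unfolded progressive_driver_def, rule_format, OF T]]
    have gm: "(\<lambda>p. g (X (fst p) (snd p)) (fst p) 0 0) \<in> borel_measurable ?R" by simp
    let ?l = "\<lambda>p. max 0 (min T (fst p))"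
    have fm': "(\<lambda>p. f (snd p) (?l p) (X (?l p) (snd p) \<bullet> (indicator I (?l p) *\<^sub>R \<zeta> (?l p))) (Z (max 0 (?l p)) (snd p))) \<in> borel_measurable (borel \<Otimes>\<^sub>M Q)"
      using measurable_clamp[OF T0 fm] by simp
    have gm': "(\<lambda>p. g (X (?l p) (snd p)) (?l p) 0 0) \<in> borel_measurable (borel \<Otimes>\<^sub>M Q)"
      using measurable_clamp[OF T0 gm] by simp
    note [measurable] = fm' gm'
    have "Measurable.pred (borel \<Otimes>\<^sub>M Q) (\<lambda>p. fst p \<in> {0..T} \<longrightarrow>
      f (snd p) (?l p) (X (?l p) (snd p) \<bullet> (indicator I (?l p) *\<^sub>R \<zeta> (?l p))) (Z (max 0 (?l p)) (snd p)) = g (X (?l p) (snd p)) (?l p) 0 0)"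
      by measurable
    moreover have "(fst p \<in> {0..T} \<longrightarrow>
      f (snd p) (?l p) (X (?l p) (snd p) \<bullet> (indicator I (?l p) *\<^sub>R \<zeta> (?l p))) (Z (max 0 (?l p)) (snd p)) = g (X (?l p) (snd p)) (?l p) 0 0)
      \<longleftrightarrow> (fst p \<in> {0..T} \<longrightarrow> f (snd p) (fst p) (X (fst p) (snd p) \<bullet> \<zeta> (fst p)) (Z (fst p) (snd p)) = g (X (fst p) (snd p)) (fst p) 0 0)"
      for p :: "real \<times> 'a"
    proof (cases "fst p \<in> {0..T}")
      case True
      then have "?l p = fst p" "max 0 (fst p) = fst p" "fst p \<in> I" using sub by auto
      then show ?thesis by simp
    next
      case False
      then show ?thesis by blast
    qed
    ultimately have pred: "Measurable.pred (borel \<Otimes>\<^sub>M Q) (\<lambda>p. fst p \<in> {0..T} \<longrightarrow>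
      f (snd p) (fst p) (X (fst p) (snd p) \<bullet> \<zeta> (fst p)) (Z (fst p) (snd p)) = g (X (fst p) (snd p)) (fst p) 0 0)"
      by simp
    have "AE (t, \<omega>) in L. t \<in> {0..T} \<longrightarrow> f \<omega> t (X t \<omega> \<bullet> \<zeta> t) (Z t \<omega>) = g (X t \<omega>) t 0 0"
    proof (rule AE_pair_if_AE_paths[OF pred])
      show "AE \<omega> in Q. AE t in lborel. t \<in> {0..T} \<longrightarrow> f \<omega> t (X t \<omega> \<bullet> \<zeta> t) (Z t \<omega>) = g (X t \<omega>) t 0 0"
        using eq Y\<zeta>
      proof eventually_elim
        case (elim \<omega>)
        from elim(1) show ?case
        proof eventually_elim
          case (elim t)
          show ?case
          proof
            assume "t \<in> {0..T}"
            then have t: "t \<in> I" using sub by blast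
            have "Y t \<omega> = X t \<omega> \<bullet> \<zeta> t" using \<open>\<forall>t\<in>I. Y t \<omega> = X t \<omega> \<bullet> \<zeta> t\<close> t by blast
            then show "f \<omega> t (X t \<omega> \<bullet> \<zeta> t) (Z t \<omega>) = g (X t \<omega>) t 0 0" using elim t by metis
          qed
        qed
      qed
    qed
    with AE_snd[OF Y\<zeta>] show ?thesis
    proof eventually_elim
      case (elim p)
      obtain t \<omega> where p: "p = (t, \<omega>)" by (cases p)
      have g0': "g x s y z = g x s 0 0" for x s y z by (simp add: g_def)
      show ?case unfolding p prod.case
      proof
        assume t: "t \<in> {0..T}"
        then have "Y t \<omega> = X t \<omega> \<bullet> \<zeta> t" using elim(1) sub unfolding p prod.case by blast
        then show "f \<omega> t (Y t \<omega>) (Z t \<omega>) = g (X t \<omega>) t (Y t \<omega>) (Z t \<omega>)"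
          unfolding g0'[of _ _ "Y t \<omega>"] using elim(2) t unfolding p prod.case by simp
      qed
    qed
  qed
  have AEI: "AE (t, \<omega>) in L. t \<in> I \<longrightarrow> f \<omega> t (Y t \<omega>) (Z t \<omega>) = g (X t \<omega>) t (Y t \<omega>) (Z t \<omega>)"
  proof -
    obtain T :: "nat \<Rightarrow> real" where T: "\<forall>n. T n \<in> I" "\<forall>t\<in>I. eventually (\<lambda>n. t \<le> T n) sequentially"
      by (rule time_set_exhaust[OF I])
    have "AE p in L. \<forall>n. case p of (t, \<omega>) \<Rightarrow> t \<in> {0..T n} \<longrightarrow> f \<omega> t (Y t \<omega>) (Z t \<omega>) = g (X t \<omega>) t (Y t \<omega>) (Z t \<omega>)"
      unfolding AE_all_countable using Tn T(1) by blast
    then show ?thesis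
    proof eventually_elim
      case (elim p)
      obtain t \<omega> where p: "p = (t, \<omega>)" by (cases p)
      show ?case unfolding p prod.case
      proof
        assume t: "t \<in> I"
        obtain n where "t \<le> T n" using eventually_happens'[OF sequentially_bot] T(2) t by blast
        then have "t \<in> {0..T n}" using I0[OF t] by simp
        with elim[rule_format, of n] show "f \<omega> t (Y t \<omega>) (Z t \<omega>) = g (X t \<omega>) t (Y t \<omega>) (Z t \<omega>)"
          unfolding p prod.case by blast
      qed
    qed
  qed
  have "AE \<omega> in Q. X 0 \<omega> \<bullet> \<zeta> 0 = Y 0 \<omega>"
    using Y\<zeta> by eventually_elim (use time_set_cases(1)[OF I] in simp)
  moreover have "solves_ode_system P X A I g \<zeta>"
    unfolding solves_ode_system_iff solves_ode_component_def Let_def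
  proof (intro allI ballI impI)
    fix i s t assume st: "s \<in> state_times I i" "t \<in> state_times I i" "s \<le> t"
    have wI: "set_integrable lborel {s..t} (w i)" "\<zeta> t $ i - \<zeta> s $ i = (LINT x:{s..t}|lborel. w i x)"
      using hd st unfolding has_densities_def by blast+
    have sub: "{s..t} \<subseteq> I" using st state_times(2)[OF I, of i] by (intro time_set_cases(4)[OF I]) auto
    \<comment> \<open>On \<open>I\<close> the indicator in \<open>c\<close> is one and the rate
      terms cancel.\<close>
    have rhs: "- g (axis i 1) r (axis i 1 \<bullet> \<zeta> r) (\<zeta> r) - \<zeta> r \<bullet> (A r *v axis i 1) = w i r" if "r \<in> {s..t}" for r
      using sub that by (auto simp: gi c_def)
    have "set_integrable lborel {s..t} (\<lambda>r. - g (axis i 1) r (axis i 1 \<bullet> \<zeta> r) (\<zeta> r) - \<zeta> r \<bullet> (A r *v axis i 1))"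
      using wI(1) rhs by (subst set_integrable_cong[OF refl refl]) simp_all
    moreover have "(LINT r:{s..t}|lborel. - g (axis i 1) r (axis i 1 \<bullet> \<zeta> r) (\<zeta> r) - \<zeta> r \<bullet> (A r *v axis i 1)) = (LINT x:{s..t}|lborel. w i x)"
      using rhs by (intro set_lebesgue_integral_cong) simp_all
    ultimately show "set_integrable lborel {s..t} (\<lambda>r. - g (axis i 1) r (axis i 1 \<bullet> \<zeta> r) (\<zeta> r) - \<zeta> r \<bullet> (A r *v axis i 1)) \<and>
      axis i 1 \<bullet> \<zeta> t - axis i 1 \<bullet> \<zeta> s =
      (LINT r:{s..t}|lborel. - g (axis i 1) r (axis i 1 \<bullet> \<zeta> r) (\<zeta> r) - \<zeta> r \<bullet> (A r *v axis i 1))"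
      using wI(2) by (simp add: inner_commute[of "axis i 1"] inner_axis)
  qed
  ultimately show "\<exists>g. markovian_driver P X A I y0 Y Z f g \<and>
               (\<exists>\<zeta>. sim_M P X A I Z (\<lambda>t \<omega>. \<zeta> t) \<and>
                    (AE \<omega> in completion P. X 0 \<omega> \<bullet> \<zeta> 0 = Y 0 \<omega>) \<and>
                    solves_ode_system P X A I g \<zeta>)"
    unfolding markovian_driver_def using adm AEI sim by blast
qed

section \<open>State functions from differential equations\<close>

lemma has_densities_ode:
  assumes I: "time_set I" and ode: "solves_ode_system P X A I g \<zeta>"
  shows "has_densities I \<zeta> (\<lambda>i r. - g (axis i 1) r (\<zeta> r $ i) (\<zeta> r) - \<zeta> r \<bullet> (A r *v axis i 1))"
proof -
  have e: "axis i 1 \<bullet> z = z $ i" for i and z :: "real^'n" by (simp add: inner_commute[of "axis i 1"] inner_axis)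
  show ?thesis
    using ode unfolding solves_ode_system_iff solves_ode_component_def Let_def has_densities_def e by blast
qed

text \<open>Between jumps the path follows one component and accumulates its density; at a jump from
  \<open>j\<close> to \<open>i\<close> it switches components, which contributes exactly the term of
  \<open>jump_sum\<close>. Bisection assembles the local identities.\<close>

lemma densities_path:
  assumes I: "time_set I" and \<omega>: "\<omega> \<in> space P" and hd: "has_densities I \<zeta> w"
    and E: "\<forall>r\<in>I. \<forall>i. X r \<omega> = axis i 1 \<longrightarrow> E r = w i r" and T: "T \<in> I"
  shows "set_integrable lborel {0..T} E \<and>
    X T \<omega> \<bullet> \<zeta> T = X 0 \<omega> \<bullet> \<zeta> 0 + (LINT r:{0..T}|lborel. E r) + jump_sum \<omega> \<zeta> 0 T"
proof -
  define Y where "Y t = X t \<omega> \<bullet> \<zeta> t" for t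
  define B where "B = (\<lambda>a b. 0 \<le> a \<longrightarrow> a \<le> b \<longrightarrow> b \<in> I \<longrightarrow> set_integrable lborel {a..b} E \<and>
    Y b - Y a = (LINT r:{a..b}|lborel. E r) + jump_sum \<omega> \<zeta> a b)"
  have T0: "0 \<le> T" using T time_set_cases(2)[OF I] by auto
  have join: "B a c" if "B a b" "B b c" "a \<le> b" "b \<le> c" for a b c
    unfolding B_def
  proof (intro impI)
    assume ac: "0 \<le> a" "a \<le> c" "c \<in> I"
    have b: "0 \<le> b" "b \<in> I" using that(3,4) ac time_set_cases(5)[OF I ac(3)] by auto
    have 1: "set_integrable lborel {a..b} E" "Y b - Y a = (LINT r:{a..b}|lborel. E r) + jump_sum \<omega> \<zeta> a b"
      using that(1,3) ac(1) b unfolding B_def by blast+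
    have 2: "set_integrable lborel {b..c} E" "Y c - Y b = (LINT r:{b..c}|lborel. E r) + jump_sum \<omega> \<zeta> b c"
      using that(2,4) ac(3) b unfolding B_def by blast+
    have i: "set_integrable lborel {a..c} E" by (rule set_integrable_join[OF that(3,4) 1(1) 2(1)])
    then show "set_integrable lborel {a..c} E \<and> Y c - Y a = (LINT r:{a..c}|lborel. E r) + jump_sum \<omega> \<zeta> a c"
      using 1(2) 2(2) set_integral_split[OF that(3,4) i] jump_sum_split[OF ac(1) that(3,4) \<omega>, of \<zeta>] by linarith
  qed
  \<comment> \<open>The disjunct \<open>0 < q\<close> covers a right endpoint at which the path has
    just left state \<open>i\<close>; at positive times component \<open>i\<close> has a density
    whatever the state is.\<close>
  have const: "set_integrable lborel {p..q} (w i) \<and> \<zeta> q $ i - \<zeta> p $ i = (LINT r:{p..q}|lborel. w i r)"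
    if "p \<in> I" "q \<in> I" "X p \<omega> = axis i 1" "X q \<omega> = axis i 1 \<or> 0 < q" "p \<le> q" for p q i
  proof -
    have "p \<in> state_times I i" by (rule in_state_times[OF I that(1) \<omega> that(3)])
    moreover have "q \<in> state_times I i"
      using in_state_times[OF I that(2) \<omega>] state_times(1)[OF I, of i] that(2,4) by auto
    ultimately show ?thesis using hd that(5) unfolding has_densities_def by blast
  qed
  have "B 0 T" using T0
  proof (induct rule: Bolzano)
    case (trans a b c)
    then show ?case by (rule join)
  next
    case (local x)
    obtain \<delta> where \<delta>: "0 < \<delta>" "locally_constant \<omega> x \<delta>" by (rule locally_constant_ex[OF local(1) \<omega>])
    obtain i where i: "X x \<omega> = axis i 1" using states[OF local(1) \<omega>] by (auto simp: Basis_vec_real)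
    obtain j where j: "left_lim X x \<omega> = axis j 1" using left_lim_Basis[OF local(1) \<omega>] by (auto simp: Basis_vec_real)
    have right: "B x b" if b: "x \<le> b" "b < x + \<delta>" for b
      unfolding B_def
    proof (intro impI)
      assume bI: "b \<in> I"
      have sub: "{x..b} \<subseteq> I" using time_set_cases(5)[OF I bI] local(1) by auto
      have c: "\<forall>r\<in>{x..b}. X r \<omega> = axis i 1" using locally_constantD(1)[OF \<delta>(2)] i b by simp
      have w: "set_integrable lborel {x..b} (w i) \<and> \<zeta> b $ i - \<zeta> x $ i = (LINT r:{x..b}|lborel. w i r)"
        by (rule const) (use sub c b in auto)
      have Ew: "\<forall>r. x \<le> r \<longrightarrow> r < b \<longrightarrow> E r = w i r"
      proof (intro allI impI)
        fix r assume "x \<le> r" "r < b"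
        then have "r \<in> {x..b}" by simp
        then have "r \<in> I" "X r \<omega> = axis i 1" using sub c by blast+
        then show "E r = w i r" using E by blast
      qed
      have "jump_sum \<omega> \<zeta> x b = 0" using constant_no_jumps[OF local(1) c] by (simp add: jump_sum_def)
      moreover have "Y b = \<zeta> b $ i" "Y x = \<zeta> x $ i" using c b by (simp_all add: Y_def inner_commute[of "axis _ 1"] inner_axis)
      ultimately show "set_integrable lborel {x..b} E \<and> Y b - Y x = (LINT r:{x..b}|lborel. E r) + jump_sum \<omega> \<zeta> x b"
        using set_integral_modify_endpoint[OF conjunct1[OF w] Ew] w by simp
    qed
    have left: "B a x" if a: "a < x" "x < a + \<delta>" for a
      unfolding B_def
    proof (intro impI)
      assume aI: "0 \<le> a" "x \<in> I"
      have sub: "{a..x} \<subseteq> I" using time_set_cases(5)[OF I aI(2)] aI by auto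
      have c: "X r \<omega> = axis j 1" "left_lim X r \<omega> = axis j 1" if "a \<le> r" "r < x" for r
        using locally_constantD(3,4)[OF \<delta>(2), of r] j a aI that by simp_all
      have w: "set_integrable lborel {a..x} (w j) \<and> \<zeta> x $ j - \<zeta> a $ j = (LINT r:{a..x}|lborel. w j r)"
        by (rule const) (use sub c(1)[of a] a aI in auto)
      have Ew: "\<forall>r. a \<le> r \<longrightarrow> r < x \<longrightarrow> E r = w j r"
      proof (intro allI impI)
        fix r assume "a \<le> r" "r < x"
        then have "r \<in> {a..x}" "X r \<omega> = axis j 1" using c(1) by simp_all
        then have "r \<in> I" "X r \<omega> = axis j 1" using sub by blast+
        then show "E r = w j r" using E by blast
      qed
      have "jumps \<omega> a x \<subseteq> {x}"
      proof
        fix r assume "r \<in> jumps \<omega> a x"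
        then have "a < r" "r \<le> x" "X r \<omega> \<noteq> left_lim X r \<omega>" by (simp_all add: jumps_def)
        then show "r \<in> {x}" using c[of r] by (cases "r = x") simp_all
      qed
      then have "jump_sum \<omega> \<zeta> a x = (\<Sum>r\<in>{x}. \<zeta> r \<bullet> (X r \<omega> - left_lim X r \<omega>))"
        unfolding jump_sum_def using a(1) by (intro sum.mono_neutral_left) (auto simp: jumps_def)
      \<comment> \<open>If \<open>x\<close> is not a jump, then \<open>i = j\<close> and both sides
        vanish.\<close>
      then have "jump_sum \<omega> \<zeta> a x = \<zeta> x $ i - \<zeta> x $ j" by (simp add: i j inner_diff_right inner_axis)
      moreover have "Y x = \<zeta> x $ i" "Y a = \<zeta> a $ j" using i c(1)[of a] a(1) by (simp_all add: Y_def inner_commute[of "axis _ 1"] inner_axis)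
      ultimately show "set_integrable lborel {a..x} E \<and> Y x - Y a = (LINT r:{a..x}|lborel. E r) + jump_sum \<omega> \<zeta> a x"
        using set_integral_modify_endpoint[OF conjunct1[OF w] Ew] w by simp
    qed
    have "B a b" if ab: "a \<le> x" "x \<le> b" "b - a < \<delta>" for a b
    proof (cases "a = x")
      case True
      then show ?thesis using right[of b] ab by simp
    next
      case False
      then show ?thesis using join[OF left[of a] right[of b]] ab by simp
    qed
    then show ?case using \<delta>(1) by blast
  qed
  then show ?thesis using T T0 by (auto simp: B_def Y_def)
qed

lemma markovian_imp_state_function:
  assumes I: "time_set I" and Z: "predictable P X Z"
    and Y: "solves_equation P X A I f y0 Z Y" and g: "markovian_driver P X A I y0 Y Z f g"
    and sim: "sim_M P X A I Z (\<lambda>t \<omega>. \<zeta> t)" and init: "AE \<omega> in Q. X 0 \<omega> \<bullet> \<zeta> 0 = Y 0 \<omega>"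
    and ode: "solves_ode_system P X A I g \<zeta>"
  shows "state_function P X I Y (\<lambda>t x. x \<bullet> \<zeta> t)"
proof -
  have I0: "t \<in> I \<Longrightarrow> 0 \<le> t" for t using time_set_cases(2)[OF I] by auto
  let ?h = "\<lambda>\<omega> t y z. g (X t \<omega>) t y z"
  have prog: "progressive_driver P X I ?h" and inv: "invariant_driver P X A I ?h"
    and uniq: "uniquely_solvable P X A I ?h y0 Z"
    and fg: "AE (t, \<omega>) in L. t \<in> I \<longrightarrow> f \<omega> t (Y t \<omega>) (Z t \<omega>) = g (X t \<omega>) t (Y t \<omega>) (Z t \<omega>)"
    using g unfolding markovian_driver_def admissible_driver_def by blast+
  have ps: "AE \<omega> in Q. path_solution I f Z Y \<omega>" and Y0: "AE \<omega> in Q. Y 0 \<omega> = y0"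
    using Y unfolding solves_equation_iff by blast+
  have hY: "solves_equation P X A I ?h y0 Z Y"
  proof (rule replace_driver[OF I Y prog Z])
    show "AE \<omega> in Q. AE s in lborel. s \<in> I \<longrightarrow>
      f \<omega> s (left_lim Y s \<omega>) (Z s \<omega>) = g (X s \<omega>) s (left_lim Y s \<omega>) (Z s \<omega>)"
      using ps AE_paths_if_AE_pair[OF fg]
    proof eventually_elim
      case (elim \<omega>)
      show ?case using path_solution_left_lim[OF I elim(1)] elim(2) by eventually_elim simp
    qed
  qed
  define w where "w i r = - g (axis i 1) r (\<zeta> r $ i) (\<zeta> r) - \<zeta> r \<bullet> (A r *v axis i 1)" for i r
  have hd: "has_densities I \<zeta> w" using has_densities_ode[OF I ode] by (simp add: w_def[abs_def])
  have \<zeta>m: "(\<lambda>t. indicator I t *\<^sub>R \<zeta> t) \<in> borel_measurable borel" by (rule measurable_state_vector[OF I hd])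
  define Y' where "Y' t \<omega> = X t \<omega> \<bullet> \<zeta> t" for t \<omega>
  define E where "E \<omega> r = - g (X r \<omega>) r (X r \<omega> \<bullet> \<zeta> r) (\<zeta> r) - \<zeta> r \<bullet> (A r *v X r \<omega>)" for \<omega> r
  \<comment> \<open>An auxiliary driver that ignores \<open>y\<close> and \<open>z\<close>, chosen
    so that the drift of \<open>Y'\<close> is \<open>E\<close>. Its integrability comes from the
    differential equations.\<close>
  let ?e = "\<lambda>\<omega> t (y::real) (z::real^'n). - E \<omega> t - Z t \<omega> \<bullet> (A t *v left_lim X t \<omega>)"
  have eY': "solves_equation P X A I ?e y0 Z Y'"
    unfolding solves_equation_iff
  proof (intro conjI ballI)
    show "Y' t \<in> borel_measurable (F t)" if "t \<in> I" for t
      unfolding Y'_def[abs_def] using measurable_X_F[OF I0[OF that] order_refl] by measurable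
    show "AE \<omega> in Q. Y' 0 \<omega> = y0" using init Y0 by eventually_elim (simp add: Y'_def)
    have jumps: "AE \<omega> in Q. \<forall>r\<in>I. 0 < r \<longrightarrow> Z r \<omega> \<bullet> (X r \<omega> - left_lim X r \<omega>) = \<zeta> r \<bullet> (X r \<omega> - left_lim X r \<omega>)"
      using sim unfolding sim_M_iff_jumps[OF I Z \<zeta>m] .
    from ps jumps show "AE \<omega> in Q. path_solution I ?e Z Y' \<omega>"
    proof eventually_elim
      case (elim \<omega>)
      have \<omega>: "\<omega> \<in> space P" using elim(1) by (simp add: path_solution_def)
      have Ew: "\<forall>r\<in>I. \<forall>i. X r \<omega> = axis i 1 \<longrightarrow> E \<omega> r = w i r"
        by (simp add: E_def w_def inner_commute[of "axis _ 1"] inner_axis)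
      show ?case
        unfolding path_solution_def
      proof (intro conjI \<omega> ballI)
        fix t assume t: "t \<in> I"
        note dp = densities_path[OF I \<omega> hd Ew t]
        show Zi: "set_integrable lborel {0..t} (\<lambda>s. Z s \<omega> \<bullet> (A s *v left_lim X s \<omega>))"
          using elim(1) t by (simp add: path_solution_def)
        show "set_integrable lborel {0..t} (\<lambda>s. - E \<omega> s - Z s \<omega> \<bullet> (A s *v left_lim X s \<omega>))"
          using dp Zi by (intro set_integral_diff(1)) (simp_all add: set_integrable_def)
        have "jump_sum \<omega> (\<lambda>s. Z s \<omega>) 0 t = jump_sum \<omega> \<zeta> 0 t"
          unfolding jump_sum_def
        proof (rule sum.cong[OF refl])
          fix r assume "r \<in> jumps \<omega> 0 t"
          then have "0 < r" "r \<in> {0..t}" by (simp_all add: jumps_def)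
          then show "Z r \<omega> \<bullet> (X r \<omega> - left_lim X r \<omega>) = \<zeta> r \<bullet> (X r \<omega> - left_lim X r \<omega>)"
            using elim(2) time_set_cases(5)[OF I t] by blast
        qed
        moreover have "drift ?e Z Y' \<omega> s = E \<omega> s" for s by (simp add: drift_def)
        ultimately show "Y' t \<omega> = Y' 0 \<omega> + (LINT s:{0..t}|lborel. drift ?e Z Y' \<omega> s) + jump_sum \<omega> (\<lambda>s. Z s \<omega>) 0 t"
          using dp by (simp add: Y'_def)
      qed
    qed
  qed
  have hY': "solves_equation P X A I ?h y0 Z Y'"
  proof (rule replace_driver[OF I eY' prog Z])
    \<comment> \<open>Invariance speaks of predictable processes, so \<open>\<zeta>\<close> is cut
      off outside \<open>I\<close>. It then allows \<open>Z\<close> to be replaced by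
      \<open>\<zeta>\<close> inside \<open>g\<close>.\<close>
    have \<zeta>p: "predictable P X (\<lambda>t \<omega>. indicator I t *\<^sub>R \<zeta> t)"
      using measurable_compose[OF measurable_fst_PA \<zeta>m] by (simp add: predictable_def case_prod_beta')
    have "sim_M P X A I Z (\<lambda>t \<omega>. indicator I t *\<^sub>R \<zeta> t)"
      using sim unfolding sim_M_def by eventually_elim auto
    then have "AE (t, \<omega>) in L. t \<in> I \<longrightarrow> (\<forall>y. g (X t \<omega>) t y (Z t \<omega>) = g (X t \<omega>) t y (indicator I t *\<^sub>R \<zeta> t))"
      using inv Z \<zeta>p unfolding invariant_driver_def by blast
    from AE_paths_if_AE_pair[OF this]
    have inv': "AE \<omega> in Q. AE t in lborel. t \<in> I \<longrightarrow> (\<forall>y. g (X t \<omega>) t y (Z t \<omega>) = g (X t \<omega>) t y (indicator I t *\<^sub>R \<zeta> t))" .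
    have "AE \<omega> in Q. path_solution I ?e Z Y' \<omega>" using eY' unfolding solves_equation_iff by blast
    with inv' sim_M_drift[OF I sim] show "AE \<omega> in Q. AE s in lborel. s \<in> I \<longrightarrow>
      - E \<omega> s - Z s \<omega> \<bullet> (A s *v left_lim X s \<omega>) = g (X s \<omega>) s (left_lim Y' s \<omega>) (Z s \<omega>)"
    proof eventually_elim
      case (elim \<omega>)
      have \<omega>: "\<omega> \<in> space P" using elim(3) by (simp add: path_solution_def)
      from elim(1,2) path_solution_left_lim[OF I elim(3)] AE_no_jump[OF \<omega>] show ?case
      proof eventually_elim
        case (elim s)
        show ?case
        proof
          assume s: "s \<in> I"
          have "left_lim X s \<omega> = X s \<omega>" using elim(4) I0[OF s] by blast
          moreover have "Z s \<omega> \<bullet> (A s *v left_lim X s \<omega>) = \<zeta> s \<bullet> (A s *v left_lim X s \<omega>)" using elim(2) s by blast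
          moreover have "left_lim Y' s \<omega> = X s \<omega> \<bullet> \<zeta> s" using elim(3) s by (simp add: Y'_def)
          moreover have "g (X s \<omega>) s y (Z s \<omega>) = g (X s \<omega>) s y (\<zeta> s)" for y using elim(1) s by simp
          ultimately show "- E \<omega> s - Z s \<omega> \<bullet> (A s *v left_lim X s \<omega>) = g (X s \<omega>) s (left_lim Y' s \<omega>) (Z s \<omega>)"
            by (simp add: E_def)
        qed
      qed
    qed
  qed
  \<comment> \<open>Both processes solve the equation driven by \<open>g\<close> with the same data,
    and admissibility of that driver includes unique solvability.\<close>
  have "indistinguishable P I Y Y'"
    using uniq hY hY' unfolding uniquely_solvable_def by blast
  then show ?thesis by (simp add: state_function_def indistinguishable_def Y'_def)
qed

end

theorem theorem2:
  fixes P :: "'a measure"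
    and X :: "real \<Rightarrow> 'a \<Rightarrow> real^'n"
    and A :: "real \<Rightarrow> real^'n^'n"
    and I :: "real set"
    and f :: "'a \<Rightarrow> real \<Rightarrow> real \<Rightarrow> real^'n \<Rightarrow> real"
    and y0 :: real
    and Y :: "real \<Rightarrow> 'a \<Rightarrow> real"
    and Z :: "real \<Rightarrow> 'a \<Rightarrow> real^'n"
  assumes "markov_chain P X A"
    and "time_set I"
    and "predictable P X Z"
    and "admissible_driver P X A I y0 Z f"
    and "locally_square_bounded P I Y"
    and "solves_equation P X A I f y0 Z Y"
  shows "((\<exists>u. state_function P X I Y u) \<longleftrightarrow>
          (\<exists>g. markovian_driver P X A I y0 Y Z f g \<and>
               (\<exists>\<zeta>. sim_M P X A I Z (\<lambda>t \<omega>. \<zeta> t) \<and>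
                    (AE \<omega> in completion P. X 0 \<omega> \<bullet> \<zeta> 0 = Y 0 \<omega>) \<and>
                    solves_ode_system P X A I g \<zeta>))) \<and>
         (\<forall>u. state_function P X I Y u \<longrightarrow> sim_M P X A I Z (\<lambda>t \<omega>. \<chi> i. u t (axis i 1)))"
proof -
  interpret markov_chain P X A by (rule assms(1))
  have "progressive_driver P X I f" using assms(4) by (simp add: admissible_driver_def)
  note to_markovian = state_function_imp_markovian[OF assms(2,3) this assms(6)]
  \<comment> \<open>The witness in the converse direction is
    \<open>u t x = x \<bullet> \<zeta> t\<close>.\<close>
  show ?thesis
    using to_markovian markovian_imp_state_function[OF assms(2,3,6)] by blast
qed

end
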